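(* Let $\Omega\subset\mathbb{R}^N$ be a bounded open set, $0<s<1$, $1<p<\frac Ns$, and let $V$ be a positive weight in $L^r(\Omega)$ with $r>\frac{N}{sp}$. Let $I(u)=[u]_{s,p}^p+\|u\|_p^p$, $S_V=\{u\in W^{s,p}_0(\Omega):\int_\Omega V|u|^p\,dx=1\}$, and $$\lambda_2(\Omega)=\inf_{f\in\mathcal{C}_1(\Omega)}\ \max_{u\in\operatorname{Im}(f)}I(u),\qquad \mathcal{C}_1(\Omega)=\{f:\mathbb{S}^1\to S_V:\ f\text{ odd and continuous}\}.$$ Then every eigenvalue $\lambda>\lambda_1(p,V)$ of $$(-\Delta_p)^su+|u|^{p-2}u=\lambda V(x)|u|^{p-2}u\ \text{ in }\Omega,\qquad u=0\ \text{ in }\mathbb{R}^N\setminus\Omega$$ satisfies $\lambda\ge\lambda_2(\Omega)$. In particular $\lambda_1(p,V)$ is isolated (in the set of eigenvalues).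
   Context: Let $K(N,s,p)=(1-s)\mathcal{K}(N,p)$ with $\mathcal{K}(N,p)^{-1}=\frac1p\int_{\mathbb{S}^{N-1}}|\omega_N|^p\,dS_\omega$, and $[u]_{s,p}^p=K(N,s,p)\iint_{\mathbb{R}^N\times\mathbb{R}^N}\frac{|u(x)-u(y)|^p}{|x-y|^{N+sp}}\,dx\,dy$. $W^{s,p}_0(\Omega)$ is the space of $u\in L^p(\mathbb{R}^N)$ with $[u]_{s,p}<\infty$ and $u=0$ a.e. in $\mathbb{R}^N\setminus\Omega$, with norm $(\|u\|_p^p+[u]_{s,p}^p)^{1/p}$; $S_V$ carries the induced topology. The operator $(-\Delta_p)^s$ is the Fréchet derivative of $u\mapsto\frac1p[u]_{s,p}^p$, i.e. $\langle(-\Delta_p)^su,v\rangle=K(N,s,p)\iint_{\mathbb{R}^{2N}}\frac{|u(x)-u(y)|^{p-2}(u(x)-u(y))(v(x)-v(y))}{|x-y|^{N+sp}}\,dx\,dy$. A real number $\lambda$ is an eigenvalue, with eigenfunction $u$, if $u\in W^{s,p}_0(\Omega)\setminus\{0\}$ and $\langle(-\Delta_p)^su,v\rangle+\int_\Omega|u|^{p-2}uv\,dx=\lambda\int_\Omega V|u|^{p-2}uv\,dx$ for all $v\in W^{s,p}_0(\Omega)$. The first eigenvalue is $$\lambda_1(p,V)=\inf\left\{\frac{[u]_{s,p}^p+\|u\|_p^p}{\int_\Omega V|u|^p\,dx}:\ u\in W^{s,p}_0(\Omega)\setminus\{0\},\ \int_\Omega V|u|^p\,dx>0\right\}.$$ 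*)

theory Defs
  imports "HOL-Analysis.Analysis"
begin

text \<open>
  The ambient space \<open>\<real>\<^sup>N\<close> is a type \<open>'a :: euclidean_space\<close> with \<open>N = DIM('a)\<close>.
  Elements of the function spaces are represented by Lebesgue measurable functions
  \<open>'a \<Rightarrow> real\<close>, and equality of elements is equality almost everywhere.
\<close>

text \<open>
  Surface measure on the unit sphere, in polar-coordinates form: a Borel set \<open>A\<close> gets \<open>N\<close>
  times the volume of the cone \<open>{x \<in> ball 0 1. x / |x| \<in> A}\<close>. The origin, which \<open>sgn\<close>
  maps to \<open>0\<close>, is a null set. For \<open>N = 1\<close> this is counting measure on \<open>{-1, 1}\<close>.
\<close>

definition sphere_measure :: "'a::euclidean_space measure" where
  "sphere_measure =
     scale_measure (of_nat DIM('a)) (distr (restrict_space lborel (ball 0 1)) borel sgn)"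

text \<open>
  \<open>\<K>(N,p)\<close> and \<open>K(N,s,p) = (1 - s) \<K>(N,p)\<close>. The coordinate \<open>\<omega>\<^sub>N\<close> is the component along some
  fixed basis vector; by symmetry the integral does not depend on which one.
\<close>

definition K_const :: "'a::euclidean_space itself \<Rightarrow> real \<Rightarrow> real" where
  "K_const _ p =
     inverse (1 / p * (LINT \<omega>|(sphere_measure :: 'a measure). \<bar>\<omega> \<bullet> (SOME b. b \<in> Basis)\<bar> powr p))"

definition Ks_const :: "'a::euclidean_space itself \<Rightarrow> real \<Rightarrow> real \<Rightarrow> real" where
  "Ks_const T s p = (1 - s) * K_const T p"

definition gagliardo_integrand ::
    "real \<Rightarrow> real \<Rightarrow> ('a::euclidean_space \<Rightarrow> real) \<Rightarrow> 'a \<times> 'a \<Rightarrow> real" where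
  "gagliardo_integrand s p u =
     (\<lambda>(x, y). \<bar>u x - u y\<bar> powr p / norm (x - y) powr (real DIM('a) + s * p))"

text \<open>The \<open>p\<close>-th power \<open>[u]\<^sub>s\<^sub>,\<^sub>p\<^sup>p\<close>; it is only used where the integrand is integrable.\<close>

definition gagliardo_pow :: "real \<Rightarrow> real \<Rightarrow> ('a::euclidean_space \<Rightarrow> real) \<Rightarrow> real" where
  "gagliardo_pow s p u = Ks_const TYPE('a) s p * (LINT z|lebesgue. gagliardo_integrand s p u z)"

definition Lp_pow :: "real \<Rightarrow> ('a::euclidean_space \<Rightarrow> real) \<Rightarrow> real" where
  "Lp_pow p u = (LINT x|lebesgue. \<bar>u x\<bar> powr p)"

definition W0 :: "real \<Rightarrow> real \<Rightarrow> 'a::euclidean_space set \<Rightarrow> ('a \<Rightarrow> real) set" where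
  "W0 s p \<Omega> = {u. u \<in> borel_measurable lebesgue
      \<and> integrable lebesgue (\<lambda>x. \<bar>u x\<bar> powr p)
      \<and> integrable lebesgue (gagliardo_integrand s p u)
      \<and> (AE x in lebesgue. x \<notin> \<Omega> \<longrightarrow> u x = 0)}"

definition energy :: "real \<Rightarrow> real \<Rightarrow> ('a::euclidean_space \<Rightarrow> real) \<Rightarrow> real" where
  "energy s p u = gagliardo_pow s p u + Lp_pow p u"

definition W_norm :: "real \<Rightarrow> real \<Rightarrow> ('a::euclidean_space \<Rightarrow> real) \<Rightarrow> real" where
  "W_norm s p u = energy s p u powr (1 / p)"

definition weighted_pow ::
    "real \<Rightarrow> 'a::euclidean_space set \<Rightarrow> ('a \<Rightarrow> real) \<Rightarrow> ('a \<Rightarrow> real) \<Rightarrow> real" where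
  "weighted_pow p \<Omega> V u = (LINT x:\<Omega>|lebesgue. V x * \<bar>u x\<bar> powr p)"

definition frac_plap ::
    "real \<Rightarrow> real \<Rightarrow> ('a::euclidean_space \<Rightarrow> real) \<Rightarrow> ('a \<Rightarrow> real) \<Rightarrow> real" where
  "frac_plap s p u v = Ks_const TYPE('a) s p *
     (LINT (x, y)|lebesgue.
        \<bar>u x - u y\<bar> powr (p - 2) * (u x - u y) * (v x - v y)
          / norm (x - y) powr (real DIM('a) + s * p))"

text \<open>
  For \<open>p \<le> 2\<close> the convention \<open>0 powr a = 0\<close> makes \<open>|t| powr (p - 2) * t\<close> vanish at
  \<open>t = 0\<close>, as intended.
\<close>

definition is_eigenvalue ::
    "real \<Rightarrow> real \<Rightarrow> 'a::euclidean_space set \<Rightarrow> ('a \<Rightarrow> real) \<Rightarrow> real \<Rightarrow> bool" where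
  "is_eigenvalue s p \<Omega> V \<mu> \<longleftrightarrow>
     (\<exists>u \<in> W0 s p \<Omega>. \<not> (AE x in lebesgue. u x = 0) \<and>
        (\<forall>v \<in> W0 s p \<Omega>.
           frac_plap s p u v + (LINT x:\<Omega>|lebesgue. \<bar>u x\<bar> powr (p - 2) * u x * v x)
             = \<mu> * (LINT x:\<Omega>|lebesgue. V x * \<bar>u x\<bar> powr (p - 2) * u x * v x)))"

definition lambda1 ::
    "real \<Rightarrow> real \<Rightarrow> 'a::euclidean_space set \<Rightarrow> ('a \<Rightarrow> real) \<Rightarrow> real" where
  "lambda1 s p \<Omega> V =
     Inf {energy s p u / weighted_pow p \<Omega> V u | u.
            u \<in> W0 s p \<Omega> \<and> \<not> (AE x in lebesgue. u x = 0) \<and> weighted_pow p \<Omega> V u > 0}"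

definition S_V ::
    "real \<Rightarrow> real \<Rightarrow> 'a::euclidean_space set \<Rightarrow> ('a \<Rightarrow> real) \<Rightarrow> ('a \<Rightarrow> real) set" where
  "S_V s p \<Omega> V = {u \<in> W0 s p \<Omega>. weighted_pow p \<Omega> V u = 1}"

text \<open>
  Odd continuous maps from the circle, realised as the unit circle of \<open>complex\<close>, to \<open>S_V\<close>.
  Since \<open>S_V\<close> consists of representatives, oddness is equality almost everywhere and
  continuity is with respect to the (semi)norm \<open>W_norm\<close>.
\<close>

definition C1 ::
    "real \<Rightarrow> real \<Rightarrow> 'a::euclidean_space set \<Rightarrow> ('a \<Rightarrow> real) \<Rightarrow> (complex \<Rightarrow> 'a \<Rightarrow> real) set" where
  "C1 s p \<Omega> V = {f.
      (\<forall>\<omega> \<in> sphere 0 1. f \<omega> \<in> S_V s p \<Omega> V)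
      \<and> (\<forall>\<omega> \<in> sphere 0 1. AE x in lebesgue. f (- \<omega>) x = - f \<omega> x)
      \<and> (\<forall>\<omega> \<in> sphere 0 1.
           ((\<lambda>\<theta>. W_norm s p (\<lambda>x. f \<theta> x - f \<omega> x)) \<longlongrightarrow> 0) (at \<omega> within sphere 0 1))}"

text \<open>
  The inner supremum is a maximum, \<open>energy s p \<circ> f\<close> being continuous on the compact circle.
\<close>

definition lambda2 ::
    "real \<Rightarrow> real \<Rightarrow> 'a::euclidean_space set \<Rightarrow> ('a \<Rightarrow> real) \<Rightarrow> real" where
  "lambda2 s p \<Omega> V = (INF f \<in> C1 s p \<Omega> V. SUP u \<in> f ` sphere 0 1. energy s p u)"

end

theory Submission
  imports Defs "HOL-Complex_Analysis.Great_Picard"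
begin

text \<open>
  An eigenfunction \<open>u\<close> for \<open>\<mu> > \<lambda>\<^sub>1\<close> changes sign: a nonnegative one is positive almost everywhere in
  \<open>\<Omega>\<close>, and testing with \<open>w\<^sup>p / (u + \<delta>)\<^sup>p\<^sup>-\<^sup>1\<close> and Picone's inequality would give
  \<open>\<mu> \<integral> V w\<^sup>p \<le> I(w)\<close> for all \<open>w \<ge> 0\<close>, hence \<open>\<mu> \<le> \<lambda>\<^sub>1\<close>. Normalising \<open>\<omega>\<^sub>1 u\<^sup>+ + \<omega>\<^sub>2 u\<^sup>-\<close> for \<open>\<omega>\<close> on the circle
  then gives an odd loop in \<open>S\<^sub>V\<close> on which \<open>I \<le> \<mu>\<close>, because \<open>|a \<alpha> + b \<beta>|\<^sup>p\<close> is at most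
  \<open>|\<alpha> + \<beta>|\<^sup>p\<^sup>-\<^sup>2 (\<alpha> + \<beta>) (|a|\<^sup>p \<alpha> + |b|\<^sup>p \<beta>)\<close> whenever \<open>\<alpha> \<beta> \<ge> 0\<close>.

  For the isolation, averaging over dyadic cells and chaining over the scales shows that the space
  embeds compactly into \<open>L\<^sup>p(V dx)\<close>, so \<open>\<lambda>\<^sub>1\<close> is attained and first eigenfunctions have one sign.
  Normalised eigenfunctions for eigenvalues tending to \<open>\<lambda>\<^sub>1\<close> would converge almost everywhere to a first
  eigenfunction, say a positive one; but testing with \<open>u\<^sup>-\<close> and the embedding bound \<open>\<integral> V\<^sup>r\<close> over
  \<open>{u < 0}\<close> from below.
\<close>

subsection \<open>The power nonlinearity and the discrete Picone inequality\<close>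

text \<open>The seminorm is treated as a plain \<open>L^p\<close> norm of a weighted difference
  quotient on the product space, so the nonlocal and the zero order terms obey the same one-variable
  inequalities for \<open>|t|^p\<close>, integrated against the equation. In the two-parameter
  inequality \<alpha> and \<beta> are the increments of u^+ and of -u^-. Both parts are
  nondecreasing in u, hence the condition \<alpha> \<beta> \<ge> 0, and the right-hand side is the
  equation tested with |a|^p u^+ - |b|^p u^-. The Picone quotient is admissible only for bounded w
  and with \<delta> > 0: general competitors are truncated, and letting \<delta> tend to 0 requires
  u > 0 almost everywhere. On cells of side 2^-k, replacing u by its averages costs 2^(-k s p) in
  the p-th power, while Jensen bounds averages of V by 2^(k N / r) times its \<open>L^r\<close>
  norm; the product decays exactly when r > N / (s p). The contradiction at the end: with n = u^-,
  I(n) \<le> \<mu> int V n^p \<le> \<mu> C |V 1_{u<0}|_r I(n), so the norm of V on {u < 0} is at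
  least 1 / (\<mu> C), whereas convergence to a positive limit sends it to 0.\<close>

definition psi :: "real \<Rightarrow> real \<Rightarrow> real" where
  "psi p t = \<bar>t\<bar> powr (p - 2) * t"

lemma psi_0 [simp]: "psi p 0 = 0"
  by (simp add: psi_def)

lemma psi_mult_self: "psi p t * t = \<bar>t\<bar> powr p"
proof (cases "t = 0")
  case False
  have "\<bar>t\<bar> powr p = \<bar>t\<bar> powr (p - 2) * \<bar>t\<bar> powr 2"
    using powr_add[of "\<bar>t\<bar>" "p - 2" 2] by simp
  also have "\<bar>t\<bar> powr 2 = t * t"
    using False by (simp add: power2_eq_square)
  finally show ?thesis by (simp add: psi_def)
qed simp

lemma psi_nonneg: "t \<ge> 0 \<Longrightarrow> psi p t = t powr (p - 1)"
proof (cases "t = 0")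
  case False
  assume "t \<ge> 0"
  with False have "t powr (p - 1) = t powr (p - 2) * t powr 1"
    using powr_add[of t "p - 2" 1] by (simp del: powr_one)
  with False \<open>t \<ge> 0\<close> show ?thesis by (simp add: psi_def)
qed simp

lemma psi_minus [simp]: "psi p (- t) = - psi p t"
  by (simp add: psi_def)

lemma abs_psi: "\<bar>psi p t\<bar> = \<bar>t\<bar> powr (p - 1)"
  using psi_nonneg[of "\<bar>t\<bar>" p] by (simp add: psi_def abs_mult)

lemma psi_mult: "psi p (c * t) = psi p c * psi p t"
  by (simp add: psi_def abs_mult powr_mult)

lemma borel_measurable_psi [measurable]: "psi p \<in> borel_measurable borel"
  unfolding psi_def by measurable

lemma has_real_derivative_abs_powr:
  assumes "p > 1"
  shows "((\<lambda>t. \<bar>t\<bar> powr p) has_real_derivative p * psi p x) (at x)"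
proof -
  consider "x > 0" | "x < 0" | "x = 0" by linarith
  then show ?thesis
  proof cases
    case 1
    have "((\<lambda>t. t powr p) has_real_derivative p * x powr (p - 1)) (at x)"
      by (rule has_real_derivative_powr) (use 1 in auto)
    moreover have "eventually (\<lambda>t. t powr p = \<bar>t\<bar> powr p) (nhds x)"
      using eventually_nhds_in_open[of "{0<..}" x] 1 by (auto elim!: eventually_mono)
    ultimately have "((\<lambda>t. \<bar>t\<bar> powr p) has_real_derivative p * x powr (p - 1)) (at x)"
      by (simp cong: DERIV_cong_ev)
    moreover have "psi p x = x powr (p - 1)"
      using 1 by (simp add: psi_nonneg)
    ultimately show ?thesis
      by simp
  next
    case 2
    have "((\<lambda>t. (- t) powr p) has_real_derivative p * (- x) powr (p - 1) * (- 1)) (at x)"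
      using 2 by (auto intro!: derivative_eq_intros simp: powr_diff)
    moreover have "eventually (\<lambda>t. (- t) powr p = \<bar>t\<bar> powr p) (nhds x)"
      using eventually_nhds_in_open[of "{..<0}" x] 2 by (auto elim!: eventually_mono)
    ultimately have "((\<lambda>t. \<bar>t\<bar> powr p) has_real_derivative - (p * (- x) powr (p - 1))) (at x)"
      by (simp cong: DERIV_cong_ev)
    moreover have "psi p x = - ((- x) powr (p - 1))"
      using psi_minus[of p "- x"] psi_nonneg[of "- x" p] 2 by simp
    ultimately show ?thesis
      by simp
  next
    \<comment> \<open>At 0 the difference quotient has modulus |h|^(p-1), which tends to 0 because p
      > 1.\<close>
    case 3
    have "((\<lambda>h::real. \<bar>h\<bar> powr (p - 1)) \<longlongrightarrow> \<bar>0\<bar> powr (p - 1)) (at 0)"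
      by (intro tendsto_powr' tendsto_intros) (use assms in auto)
    then have "((\<lambda>h::real. \<bar>h\<bar> powr (p - 1)) \<longlongrightarrow> 0) (at 0)"
      by simp
    moreover have "\<bar>\<bar>h\<bar> powr p / h\<bar> = \<bar>h\<bar> powr (p - 1)" for h :: real
      using psi_mult_self[of p h, symmetric] by (cases "h = 0") (auto simp: abs_mult abs_psi)
    ultimately have "((\<lambda>h::real. \<bar>\<bar>h\<bar> powr p / h\<bar>) \<longlongrightarrow> 0) (at 0)"
      by simp
    then have "((\<lambda>h::real. \<bar>h\<bar> powr p / h) \<longlongrightarrow> 0) (at 0)"
      by (rule tendsto_rabs_zero_cancel)
    then show ?thesis
      using 3 by (simp add: DERIV_def)
  qed
qed

text \<open>The open half line is \<open>powr_convex\<close>; at the endpoint 0 the inequality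
  reduces to s^p \<le> s on (0, 1).\<close>

lemma convex_on_powr:
  assumes "p \<ge> (1::real)"
  shows "convex_on {0..} (\<lambda>x. x powr p)"
proof (rule convex_onI)
  fix t x y :: real
  assume t: "0 < t" "t < 1" and xy: "x \<in> {0..}" "y \<in> {0..}"
  have small: "s powr p \<le> s" if "0 < s" "s < 1" for s :: real
    using powr_mono'[of 1 p s] that assms by simp
  consider "x = 0" | "y = 0" | "x > 0" "y > 0" using xy by force
  then show "((1 - t) *\<^sub>R x + t *\<^sub>R y) powr p \<le> (1 - t) * x powr p + t * y powr p"
  proof cases
    case 1
    then show ?thesis using small[of t] t xy by (simp add: powr_mult mult_right_mono)
  next
    case 2
    then show ?thesis using small[of "1 - t"] t xy by (simp add: powr_mult mult_right_mono)
  next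
    case 3
    then show ?thesis
      using convex_onD[OF powr_convex[OF assms], of t x y] t by simp
  qed
qed simp

lemma abs_powr_convex:
  fixes a b t p :: real
  assumes "p \<ge> 1" "0 \<le> t" "t \<le> 1"
  shows "\<bar>(1 - t) * a + t * b\<bar> powr p \<le> (1 - t) * \<bar>a\<bar> powr p + t * \<bar>b\<bar> powr p"
proof -
  have "\<bar>(1 - t) * a + t * b\<bar> powr p \<le> ((1 - t) * \<bar>a\<bar> + t * \<bar>b\<bar>) powr p"
    using assms abs_triangle_ineq[of "(1 - t) * a" "t * b"] by (intro powr_mono2) (auto simp: abs_mult)
  also have "\<dots> \<le> (1 - t) * \<bar>a\<bar> powr p + t * \<bar>b\<bar> powr p"
    using convex_onD[OF convex_on_powr[OF assms(1)], of t "\<bar>a\<bar>" "\<bar>b\<bar>"] assms by simp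
  finally show ?thesis .
qed

text \<open>Convexity applied to the points x / (1 - t) and y / t. The free parameter matters: a
  special t turns this into Picone's inequality, and t near 0 makes it a nearly sharp triangle
  inequality with constant close to 1 in front of x.\<close>

lemma abs_add_powr_le:
  fixes x y t p :: real
  assumes "p \<ge> 1" "0 < t" "t < 1"
  shows "\<bar>x + y\<bar> powr p \<le> (1 - t) powr (1 - p) * \<bar>x\<bar> powr p + t powr (1 - p) * \<bar>y\<bar> powr p"
proof -
  have eq: "s * \<bar>z / s\<bar> powr p = s powr (1 - p) * \<bar>z\<bar> powr p" if "s > 0" for s z :: real
    using that by (simp add: powr_divide powr_diff)
  have "\<bar>(1 - t) * (x / (1 - t)) + t * (y / t)\<bar> powr p
     \<le> (1 - t) * \<bar>x / (1 - t)\<bar> powr p + t * \<bar>y / t\<bar> powr p"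
    by (rule abs_powr_convex) (use assms in auto)
  then show ?thesis
    using assms by (simp only: eq) simp
qed

lemma abs_add_powr_le2:
  fixes x y p :: real
  assumes "p \<ge> 1"
  shows "\<bar>x + y\<bar> powr p \<le> 2 powr p * (\<bar>x\<bar> powr p + \<bar>y\<bar> powr p)"
proof -
  have "\<bar>x + y\<bar> powr p \<le> (2 * max \<bar>x\<bar> \<bar>y\<bar>) powr p"
    using assms by (intro powr_mono2) auto
  also have "\<dots> = 2 powr p * max \<bar>x\<bar> \<bar>y\<bar> powr p"
    by (simp add: powr_mult)
  also have "\<dots> \<le> 2 powr p * (\<bar>x\<bar> powr p + \<bar>y\<bar> powr p)"
    by (intro mult_left_mono) (auto simp: max_def)
  finally show ?thesis .
qed

text \<open>By symmetry a > b. If c \<le> d the left-hand side is not positive; otherwise c = (c -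
  d) + d is split by \<open>abs_add_powr_le\<close>.\<close>

lemma discrete_Picone:
  fixes a b c d p :: real
  assumes p: "p > 1" and pos: "a > 0" "b > 0" "c \<ge> 0" "d \<ge> 0"
  shows "psi p (a - b) * (c powr p / a powr (p - 1) - d powr p / b powr (p - 1)) \<le> \<bar>c - d\<bar> powr p"
proof -
  have main: "psi p (a - b) * (c powr p / a powr (p - 1) - d powr p / b powr (p - 1)) \<le> \<bar>c - d\<bar> powr p"
    if "a > b" "b > 0" "c \<ge> 0" "d \<ge> 0" for a b c d :: real
  proof (cases "c \<le> d")
    case True
    have "c powr p / a powr (p - 1) \<le> d powr p / b powr (p - 1)"
      using that True p by (intro frac_le powr_mono2) auto
    then have "psi p (a - b) * (c powr p / a powr (p - 1) - d powr p / b powr (p - 1)) \<le> 0"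
      using that by (intro mult_nonneg_nonpos) (auto simp: psi_nonneg)
    then show ?thesis by (meson order_trans powr_ge_zero)
  next
    case False
    \<comment> \<open>The choice that matches coefficients: a^(p-1) (1-t)^(p-1) is
      \<open>psi p (a - b)\<close> and t^(1-p) is (a / b)^(p-1).\<close>
    define t where "t = b / a"
    have t: "0 < t" "t < 1" using that by (auto simp: t_def)
    have "c powr p = \<bar>(c - d) + d\<bar> powr p" using that by simp
    also have "\<dots> \<le> (1 - t) powr (1 - p) * \<bar>c - d\<bar> powr p + t powr (1 - p) * \<bar>d\<bar> powr p"
      by (rule abs_add_powr_le) (use t p in auto)
    finally have "c powr p - t powr (1 - p) * d powr p \<le> (1 - t) powr (1 - p) * \<bar>c - d\<bar> powr p"
      using that by simp
    then have "(1 - t) powr (p - 1) * (c powr p - t powr (1 - p) * d powr p)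
        \<le> (1 - t) powr (p - 1) * ((1 - t) powr (1 - p) * \<bar>c - d\<bar> powr p)"
      by (intro mult_left_mono) auto
    also have "\<dots> = \<bar>c - d\<bar> powr p"
      using t by (simp add: mult.assoc[symmetric] powr_add[symmetric])
    also have "(1 - t) powr (p - 1) * (c powr p - t powr (1 - p) * d powr p)
        = psi p (a - b) * (c powr p / a powr (p - 1) - d powr p / b powr (p - 1))"
    proof -
      have "psi p (a - b) = (a * (1 - t)) powr (p - 1)"
        using that by (simp add: psi_nonneg t_def algebra_simps)
      also have "\<dots> = a powr (p - 1) * (1 - t) powr (p - 1)"
        using that t by (simp add: powr_mult)
      finally have 1: "psi p (a - b) = a powr (p - 1) * (1 - t) powr (p - 1)" .
      have "b powr (p - 1) = t powr (p - 1) * a powr (p - 1)"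
        using that by (simp add: t_def powr_divide)
      moreover have "t powr (1 - p) = inverse (t powr (p - 1))"
        using powr_minus[of t "p - 1"] by simp
      ultimately show ?thesis
        using that t by (simp add: 1 field_simps)
    qed
    finally show ?thesis .
  qed
  consider "a > b" | "b > a" | "a = b" by linarith
  then show ?thesis
  proof cases
    case 2
    have "psi p (a - b) = - psi p (b - a)"
      using psi_minus[of p "b - a"] by simp
    then show ?thesis using main[of a b d c] 2 pos by (simp add: abs_minus_commute algebra_simps)
  qed (use main pos in auto)
qed

text \<open>Convexity used twice: a + t b lies between a and a + b, and a lies between a + t b and a
  - b with weight t / (1 + t). The bound is free of t and serves as the majorant when
  differentiating under the integral.\<close>

lemma abs_powr_diff_quotient_bound:
  fixes a b t p :: real
  assumes p: "p \<ge> 1" and t: "0 < t" "t \<le> 1"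
  shows "\<bar>(\<bar>a + t * b\<bar> powr p - \<bar>a\<bar> powr p) / t\<bar> \<le> 2 powr p * (\<bar>a\<bar> powr p + \<bar>b\<bar> powr p)"
proof -
  have upper: "\<bar>a + t * b\<bar> powr p - \<bar>a\<bar> powr p \<le> t * (\<bar>a + b\<bar> powr p - \<bar>a\<bar> powr p)"
    using abs_powr_convex[of p t a "a + b"] assms by (simp add: algebra_simps)
  have "\<bar>a\<bar> powr p = \<bar>(1 - t / (1 + t)) * (a + t * b) + t / (1 + t) * (a - b)\<bar> powr p"
  proof -
    have "(1 - t / (1 + t)) * (a + t * b) + t / (1 + t) * (a - b) = a"
      using t by (simp add: divide_simps) (simp add: algebra_simps)
    then show ?thesis by simp
  qed
  also have "\<dots> \<le> (1 - t / (1 + t)) * \<bar>a + t * b\<bar> powr p + t / (1 + t) * \<bar>a - b\<bar> powr p"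
    by (rule abs_powr_convex) (use assms in auto)
  finally have "(1 + t) * \<bar>a\<bar> powr p \<le> (1 + t) * ((1 - t / (1 + t)) * \<bar>a + t * b\<bar> powr p + t / (1 + t) * \<bar>a - b\<bar> powr p)"
    using t by (intro mult_left_mono) auto
  also have "\<dots> = \<bar>a + t * b\<bar> powr p + t * \<bar>a - b\<bar> powr p"
  proof -
    have "(1 + t) * ((1 - t / (1 + t)) * X + t / (1 + t) * Y) = X + t * Y" for X Y
      using t by (simp add: divide_simps)
    then show ?thesis .
  qed
  finally have lower: "\<bar>a + t * b\<bar> powr p - \<bar>a\<bar> powr p \<ge> t * (\<bar>a\<bar> powr p - \<bar>a - b\<bar> powr p)"
    by (simp add: algebra_simps)
  define B where "B = 2 powr p * (\<bar>a\<bar> powr p + \<bar>b\<bar> powr p)"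
  have "\<bar>a + b\<bar> powr p \<le> B" "\<bar>a - b\<bar> powr p \<le> B"
    using abs_add_powr_le2[OF p, of a b] abs_add_powr_le2[OF p, of a "- b"] by (auto simp: B_def)
  then have "t * (\<bar>a + b\<bar> powr p - \<bar>a\<bar> powr p) \<le> t * B" "t * (- B) \<le> t * (\<bar>a\<bar> powr p - \<bar>a - b\<bar> powr p)"
    using t powr_ge_zero[of "\<bar>a\<bar>" p] by (intro mult_left_mono; linarith)+
  with upper lower have "\<bar>\<bar>a + t * b\<bar> powr p - \<bar>a\<bar> powr p\<bar> \<le> t * B"
    by (simp add: abs_le_iff algebra_simps)
  then show ?thesis using t by (simp add: B_def field_simps)
qed

lemma psi_mult_bound: "p > 1 \<Longrightarrow> \<bar>psi p a * b\<bar> \<le> \<bar>a\<bar> powr p + \<bar>b\<bar> powr p"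
proof -
  assume p: "p > 1"
  have "\<bar>psi p a * b\<bar> = \<bar>a\<bar> powr (p - 1) * \<bar>b\<bar>"
    by (simp add: abs_mult abs_psi)
  also have "\<dots> \<le> max \<bar>a\<bar> \<bar>b\<bar> powr (p - 1) * max \<bar>a\<bar> \<bar>b\<bar>"
    using p by (intro mult_mono powr_mono2) auto
  also have "\<dots> = max \<bar>a\<bar> \<bar>b\<bar> powr p"
    using psi_mult_self[of p "max \<bar>a\<bar> \<bar>b\<bar>"] by (simp add: psi_nonneg)
  also have "\<dots> \<le> \<bar>a\<bar> powr p + \<bar>b\<bar> powr p"
    by (auto simp: max_def)
  finally show ?thesis .
qed

lemma integrable_psi_mult:
  fixes f g :: "'b \<Rightarrow> real" and p :: real
  assumes "p > 1" and [measurable]: "f \<in> borel_measurable M" "g \<in> borel_measurable M"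
    and "integrable M (\<lambda>x. \<bar>f x\<bar> powr p)" "integrable M (\<lambda>x. \<bar>g x\<bar> powr p)"
  shows "integrable M (\<lambda>x. psi p (f x) * g x)"
proof (rule Bochner_Integration.integrable_bound)
  show "integrable M (\<lambda>x. \<bar>f x\<bar> powr p + \<bar>g x\<bar> powr p)"
    using assms by auto
qed (use psi_mult_bound[OF assms(1)] in auto)

lemma integrable_abs_powr_add:
  fixes f g :: "'b \<Rightarrow> real" and p :: real
  assumes "p \<ge> 1" and [measurable]: "f \<in> borel_measurable M" "g \<in> borel_measurable M"
    and "integrable M (\<lambda>x. \<bar>f x\<bar> powr p)" "integrable M (\<lambda>x. \<bar>g x\<bar> powr p)"
  shows "integrable M (\<lambda>x. \<bar>f x + g x\<bar> powr p)"
proof (rule Bochner_Integration.integrable_bound)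
  show "integrable M (\<lambda>x. 2 powr p * (\<bar>f x\<bar> powr p + \<bar>g x\<bar> powr p))"
    using assms by auto
qed (use abs_add_powr_le2[OF assms(1)] in auto)

text \<open>Stated for arbitrary p-integrable functions on any measure space, so that one lemma
  differentiates the Gagliardo, the \<open>L^p\<close> and the weighted term of the
  functional.\<close>

lemma integral_abs_powr_first_variation:
  fixes f g :: "'b \<Rightarrow> real" and p :: real
  assumes p: "p > 1" and [measurable]: "f \<in> borel_measurable M" "g \<in> borel_measurable M"
    and int: "integrable M (\<lambda>x. \<bar>f x\<bar> powr p)" "integrable M (\<lambda>x. \<bar>g x\<bar> powr p)"
  shows "(\<lambda>n. ((LINT x|M. \<bar>f x + inverse (real (Suc n)) * g x\<bar> powr p) - (LINT x|M. \<bar>f x\<bar> powr p))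
            / inverse (real (Suc n))) \<longlonglongrightarrow> p * (LINT x|M. psi p (f x) * g x)"
proof -
  define t where "t n = inverse (real (Suc n))" for n
  have t: "0 < t n" "t n \<le> 1" for n by (auto simp: t_def field_simps)
  have int': "integrable M (\<lambda>x. \<bar>f x + t n * g x\<bar> powr p)" for n
    using p int t[of n] by (intro integrable_abs_powr_add) (auto simp: abs_mult powr_mult)
  have "(\<lambda>n. LINT x|M. (\<bar>f x + t n * g x\<bar> powr p - \<bar>f x\<bar> powr p) / t n) \<longlonglongrightarrow> (LINT x|M. p * (psi p (f x) * g x))"
  proof (rule integral_dominated_convergence)
    show "integrable M (\<lambda>x. 2 powr p * (\<bar>f x\<bar> powr p + \<bar>g x\<bar> powr p))"
      using int by auto
    show "AE x in M. (\<lambda>n. (\<bar>f x + t n * g x\<bar> powr p - \<bar>f x\<bar> powr p) / t n) \<longlonglongrightarrow> p * (psi p (f x) * g x)"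
    proof (rule AE_I2)
      fix x
      have "((\<lambda>s. \<bar>f x + s * g x\<bar> powr p) has_real_derivative (p * psi p (f x + 0 * g x)) * g x) (at 0)"
        by (rule DERIV_chain2[where f = "\<lambda>t. \<bar>t\<bar> powr p"])
           (auto intro!: has_real_derivative_abs_powr p derivative_eq_intros)
      then have "((\<lambda>s. (\<bar>f x + s * g x\<bar> powr p - \<bar>f x\<bar> powr p) / s) \<longlongrightarrow> p * (psi p (f x) * g x)) (at 0)"
        by (simp add: DERIV_def mult.assoc)
      moreover have "filterlim t (at 0) sequentially"
        using LIMSEQ_inverse_real_of_nat t unfolding t_def[abs_def] filterlim_at by (auto intro!: always_eventually)
      ultimately show "(\<lambda>n. (\<bar>f x + t n * g x\<bar> powr p - \<bar>f x\<bar> powr p) / t n) \<longlonglongrightarrow> p * (psi p (f x) * g x)"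
        by (rule filterlim_compose)
    qed
    show "AE x in M. norm ((\<bar>f x + t n * g x\<bar> powr p - \<bar>f x\<bar> powr p) / t n)
            \<le> 2 powr p * (\<bar>f x\<bar> powr p + \<bar>g x\<bar> powr p)" for n
      using abs_powr_diff_quotient_bound[of p "t n"] t[of n] p by (intro AE_I2) simp
  qed measurable
  then show ?thesis
    using int int' unfolding t_def[symmetric] by simp
qed

subsection \<open>Lebesgue measure on products and the function space\<close>

text \<open>\<open>lebesgue\<close> on a product type completes the product measure and is not
  itself a product measure; null sets are therefore carried over through \<open>lborel\<close>. The
  measurability lemmas for \<open>fst\<close> and \<open>snd\<close> below go through Borel versions
  for the same reason.\<close>

lemma AE_lebesgue_fst:
  assumes "AE x in lebesgue. P x"
  shows "AE z in (lebesgue :: ('a::euclidean_space \<times> 'b::euclidean_space) measure). P (fst z)"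
proof -
  from assms have "AE x in lborel. P x" by (simp add: AE_completion_iff)
  then obtain N where N: "N \<in> null_sets lborel" "{x. \<not> P x} \<subseteq> N"
    by (auto elim!: AE_E simp: null_sets_def)
  have "N \<times> (UNIV :: 'b set) \<in> null_sets (lborel \<Otimes>\<^sub>M lborel)"
    using N by (intro lborel.times_in_null_sets1) auto
  then have "AE z in (lborel :: ('a \<times> 'b) measure). P (fst z)"
    unfolding lborel_prod by (rule AE_I') (use N in auto)
  then show ?thesis by (simp add: AE_completion_iff)
qed

lemma AE_lebesgue_snd:
  assumes "AE x in lebesgue. P x"
  shows "AE z in (lebesgue :: ('a::euclidean_space \<times> 'b::euclidean_space) measure). P (snd z)"
proof -
  from assms have "AE x in lborel. P x" by (simp add: AE_completion_iff)
  then obtain N where N: "N \<in> null_sets lborel" "{x. \<not> P x} \<subseteq> N"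
    by (auto elim!: AE_E simp: null_sets_def)
  have "(UNIV :: 'a set) \<times> N \<in> null_sets (lborel \<Otimes>\<^sub>M lborel)"
    using N by (intro lborel.times_in_null_sets2) auto
  then have "AE z in (lborel :: ('a \<times> 'b) measure). P (snd z)"
    unfolding lborel_prod by (rule AE_I') (use N in auto)
  then show ?thesis by (simp add: AE_completion_iff)
qed

lemma AE_lebesgue_pairD:
  fixes P :: "'a::euclidean_space \<times> 'b::euclidean_space \<Rightarrow> bool"
  assumes "AE z in lebesgue. P z"
  shows "AE x in lebesgue. AE y in lebesgue. P (x, y)"
proof -
  have "AE z in (lborel \<Otimes>\<^sub>M lborel). P z"
    using assms unfolding lborel_prod by (simp add: AE_completion_iff)
  from lborel_pair.AE_pair[OF this] show ?thesis
    by (simp add: AE_completion_iff)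
qed

lemma borel_measurable_lebesgue_fst [measurable (raw)]:
  fixes u :: "'a::euclidean_space \<Rightarrow> real"
  assumes "u \<in> borel_measurable lebesgue"
  shows "(\<lambda>z. u (fst z)) \<in> borel_measurable (lebesgue :: ('a \<times> 'b::euclidean_space) measure)"
proof -
  obtain u' where [measurable]: "u' \<in> borel_measurable lborel" and ae: "AE x in lborel. u x = u' x"
    using completion_ex_borel_measurable_real[OF assms] by auto
  have "(\<lambda>z::'a \<times> 'b. u' (fst z)) \<in> borel_measurable lborel"
    unfolding lborel_prod[symmetric] by measurable
  then have "(\<lambda>z::'a \<times> 'b. u' (fst z)) \<in> borel_measurable lebesgue"
    by (rule measurable_completion)
  moreover have "AE z in (lebesgue :: ('a \<times> 'b) measure). u' (fst z) = u (fst z)"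
    using AE_lebesgue_fst[OF AE_completion[OF ae]] by (auto elim: AE_mp)
  ultimately show ?thesis by (rule borel_measurable_AE)
qed

lemma borel_measurable_lebesgue_snd [measurable (raw)]:
  fixes u :: "'a::euclidean_space \<Rightarrow> real"
  assumes "u \<in> borel_measurable lebesgue"
  shows "(\<lambda>z. u (snd z)) \<in> borel_measurable (lebesgue :: ('b::euclidean_space \<times> 'a) measure)"
proof -
  obtain u' where [measurable]: "u' \<in> borel_measurable lborel" and ae: "AE x in lborel. u x = u' x"
    using completion_ex_borel_measurable_real[OF assms] by auto
  have "(\<lambda>z::'b \<times> 'a. u' (snd z)) \<in> borel_measurable lborel"
    unfolding lborel_prod[symmetric] by measurable
  then have "(\<lambda>z::'b \<times> 'a. u' (snd z)) \<in> borel_measurable lebesgue"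
    by (rule measurable_completion)
  moreover have "AE z in (lebesgue :: ('b \<times> 'a) measure). u' (snd z) = u (snd z)"
    using AE_lebesgue_snd[OF AE_completion[OF ae]] by (auto elim: AE_mp)
  ultimately show ?thesis by (rule borel_measurable_AE)
qed

section \<open>Positivity of the normalising constant\<close>

text \<open>In polar form the sphere integral is N times the integral of |sgn x . b|^p over the unit
  ball. The integrand lies between 0 and 1 and vanishes only on the hyperplane orthogonal to b, a
  null set.\<close>

lemma K_const_pos:
  assumes "p > 0"
  shows "K_const TYPE('a::euclidean_space) p > 0"
proof -
  define b :: 'a where "b = (SOME b. b \<in> Basis)"
  have b: "b \<in> Basis" unfolding b_def by (rule someI_ex) (use nonempty_Basis in \<open>simp add: ex_in_conv\<close>)
  define N where "N = real DIM('a)"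
  define f where "f \<omega> = \<bar>\<omega> \<bullet> b\<bar> powr p" for \<omega> :: 'a
  have [measurable]: "f \<in> borel_measurable borel" unfolding f_def by measurable
  have f01: "0 \<le> f (sgn x)" "f (sgn x) \<le> 1" for x
  proof -
    have "\<bar>sgn x \<bullet> b\<bar> \<le> norm (sgn x)" using Basis_le_norm[OF b, of "sgn x"] .
    also have "\<dots> \<le> 1" by (simp add: norm_sgn)
    finally show "f (sgn x) \<le> 1" using assms powr_mono2[of p "\<bar>sgn x \<bullet> b\<bar>" 1] by (simp add: f_def)
  qed (simp add: f_def)
  have [measurable]: "(sgn :: 'a \<Rightarrow> 'a) \<in> borel_measurable borel"
    unfolding sgn_div_norm[abs_def] by measurable
  let ?B = "restrict_space lborel (ball (0::'a) 1)"
  have sm: "(sphere_measure :: 'a measure) = density (distr ?B borel sgn) (\<lambda>_. ennreal N)"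
    unfolding sphere_measure_def by (rule measure_eqI) (auto simp: emeasure_density_const N_def ennreal_of_nat_eq_real_of_nat)
  have "(LINT \<omega>|sphere_measure. f \<omega>) = (LINT \<omega>|distr ?B borel sgn. N * f \<omega>)"
    unfolding sm by (subst integral_real_density) (auto simp: N_def)
  also have "\<dots> = (LINT x|?B. N * f (sgn x))"
    by (subst integral_distr) (auto intro: measurable_restrict_space1)
  also have "\<dots> = (LINT x:ball 0 1|lborel. N * f (sgn x))"
    unfolding set_lebesgue_integral_def by (subst integral_restrict_space) auto
  also have "\<dots> = N * (LINT x:ball 0 1|lborel. f (sgn x))"
    by (rule set_integral_mult_right)
  finally have eq: "(LINT \<omega>|sphere_measure. f \<omega>) = N * (LINT x:ball 0 1|lborel. f (sgn x))" .
  have int: "integrable lborel (\<lambda>x::'a. indicator (ball 0 1) x *\<^sub>R f (sgn x))"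
  proof (rule Bochner_Integration.integrable_bound)
    show "integrable lborel (indicator (ball (0::'a) 1) :: 'a \<Rightarrow> real)"
      by (rule integrable_real_indicator) (auto simp: emeasure_ball)
  qed (use f01 in \<open>auto simp: indicator_def\<close>)
  have "(LINT x:ball (0::'a) 1|lborel. f (sgn x)) \<ge> 0"
    unfolding set_lebesgue_integral_def using f01 by (intro integral_nonneg_AE) auto
  moreover have "(LINT x:ball (0::'a) 1|lborel. f (sgn x)) \<noteq> 0"
  proof
    assume "(LINT x:ball (0::'a) 1|lborel. f (sgn x)) = 0"
    then have "AE x::'a in lborel. indicator (ball 0 1) x *\<^sub>R f (sgn x) = 0"
      unfolding set_lebesgue_integral_def using int f01 by (subst (asm) integral_nonneg_eq_0_iff_AE) auto
    moreover have "AE x::'a in lborel. x \<notin> {x. b \<bullet> x = 0}"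
    proof -
      have "negligible {x::'a. b \<bullet> x = 0}"
        by (rule negligible_hyperplane) (use b nonzero_Basis in auto)
      then have "{x::'a. b \<bullet> x = 0} \<in> null_sets lebesgue"
        by (simp add: negligible_iff_null_sets)
      then have "AE x::'a in lebesgue. x \<notin> {x. b \<bullet> x = 0}"
        by (rule AE_not_in)
      then show ?thesis by (simp add: AE_completion_iff)
    qed
    ultimately have "AE x::'a in lborel. x \<notin> ball 0 1"
    proof eventually_elim
      case (elim x)
      then show ?case
        by (auto simp: f_def sgn_div_norm inner_commute split: split_indicator_asm)
    qed
    then have "emeasure lborel (ball (0::'a) 1) = 0"
      by (subst (asm) AE_iff_measurable[where N = "ball 0 1"]) auto
    then show False using content_ball_gt_0_iff[of "0::'a" 1] by (simp add: measure_def)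
  qed
  ultimately have "(LINT x:ball (0::'a) 1|lborel. f (sgn x)) > 0" by linarith
  then have "(LINT \<omega>|sphere_measure. f \<omega>) > 0" unfolding eq by (simp add: N_def)
  then show ?thesis unfolding K_const_def b_def[symmetric] using assms by (simp add: f_def[abs_def])
qed

lemma Ks_const_pos:
  assumes "p > 0" "s < 1"
  shows "Ks_const TYPE('a::euclidean_space) s p > 0"
  using K_const_pos[where 'a = 'a, OF assms(1)] assms(2) by (simp add: Ks_const_def)

text \<open>The weighted difference quotient turns the Gagliardo seminorm into a plain \<open>L\<^sup>p\<close> norm on
  the product space; on the diagonal it is \<open>0\<close>.\<close>

definition dquot :: "real \<Rightarrow> real \<Rightarrow> ('a::euclidean_space \<Rightarrow> real) \<Rightarrow> 'a \<times> 'a \<Rightarrow> real" where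
  "dquot s p u z = (u (fst z) - u (snd z)) / norm (fst z - snd z) powr ((real DIM('a) + s * p) / p)"

lemma borel_measurable_dquot [measurable (raw)]:
  fixes u :: "'a::euclidean_space \<Rightarrow> real"
  assumes [measurable]: "u \<in> borel_measurable lebesgue"
  shows "dquot s p u \<in> borel_measurable lebesgue"
proof -
  have [measurable]: "(\<lambda>z::'a \<times> 'a. fst z - snd z) \<in> borel_measurable lborel"
    by (simp add: borel_measurable_continuous_onI continuous_intros)
  have "(\<lambda>z::'a \<times> 'a. norm (fst z - snd z) powr ((real DIM('a) + s * p) / p)) \<in> borel_measurable lborel"
    by measurable
  then have [measurable]: "(\<lambda>z::'a \<times> 'a. norm (fst z - snd z) powr ((real DIM('a) + s * p) / p)) \<in> borel_measurable lebesgue"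
    by (rule measurable_completion)
  show ?thesis unfolding dquot_def[abs_def] by measurable
qed

lemma gagliardo_integrand_eq_dquot:
  assumes "p > 0"
  shows "gagliardo_integrand s p u = (\<lambda>z. \<bar>dquot s p u z\<bar> powr p)"
  using assms by (simp add: fun_eq_iff split_beta gagliardo_integrand_def dquot_def powr_divide powr_powr)

lemma frac_plap_eq_dquot:
  fixes u :: "'a::euclidean_space \<Rightarrow> real"
  assumes "p > 0"
  shows "frac_plap s p u v = Ks_const TYPE('a) s p * (LINT z|lebesgue. psi p (dquot s p u z) * dquot s p v z)"
proof -
  have eq: "\<bar>u x - u y\<bar> powr (p - 2) * (u x - u y) * (v x - v y) / norm (x - y) powr (real DIM('a) + s * p)
      = psi p (dquot s p u (x, y)) * dquot s p v (x, y)" for x y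
  proof (cases "x = y")
    case False
    define c where "c = (real DIM('a) + s * p) / p"
    define n where "n = norm (x - y)"
    have n: "n > 0" using False by (simp add: n_def)
    \<comment> \<open>The exponent N + s p equals c p and is distributed over the three factors of
      the integrand: c (p - 2) to the power of u, and c to each of the two increments.\<close>
    have "n powr (real DIM('a) + s * p) = n powr (c * (p - 2) + c + c)"
    proof -
      have "real DIM('a) + s * p = c * p" using assms by (simp add: c_def)
      then show ?thesis by (simp add: algebra_simps)
    qed
    also have "\<dots> = (n powr c) powr (p - 2) * n powr c * n powr c"
      by (simp only: powr_add powr_powr)
    finally show ?thesis
      using n by (simp add: psi_def dquot_def c_def[symmetric] n_def[symmetric] powr_divide)
  qed (simp add: dquot_def)
  show ?thesis unfolding frac_plap_def eq by (simp add: case_prod_unfold)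
qed

lemma dquot_lin: "dquot s p (\<lambda>x. a * u x + b * v x) z = a * dquot s p u z + b * dquot s p v z"
  by (simp add: dquot_def field_simps add_divide_distrib[symmetric] diff_divide_distrib[symmetric])

lemma abs_dquot_mono:
  fixes w u v :: "'a::euclidean_space \<Rightarrow> real"
  assumes "\<bar>w (fst z) - w (snd z)\<bar> \<le> C * (\<bar>u (fst z) - u (snd z)\<bar> + \<bar>v (fst z) - v (snd z)\<bar>)"
  shows "\<bar>dquot s p w z\<bar> \<le> C * (\<bar>dquot s p u z\<bar> + \<bar>dquot s p v z\<bar>)"
proof -
  define n where "n = norm (fst z - snd z) powr ((real DIM('a) + s * p) / p)"
  have "n \<ge> 0" by (simp add: n_def)
  from divide_right_mono[OF assms this] show ?thesis
    unfolding dquot_def n_def[symmetric] using \<open>n \<ge> 0\<close>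
    by (simp add: abs_divide add_divide_distrib[symmetric])
qed

section \<open>Stability of the space under linear combinations and Lipschitz maps\<close>

lemma W0_D:
  assumes "u \<in> W0 s p \<Omega>" "p > 0"
  shows "u \<in> borel_measurable lebesgue" "integrable lebesgue (\<lambda>x. \<bar>u x\<bar> powr p)"
    "integrable lebesgue (\<lambda>z. \<bar>dquot s p u z\<bar> powr p)" "AE x in lebesgue. x \<notin> \<Omega> \<longrightarrow> u x = 0"
  using assms by (auto simp: W0_def gagliardo_integrand_eq_dquot cong: integrable_cong)

text \<open>Pointwise bounds on values and on increments dominate both integrands at once. This
  single criterion yields closure under linear combinations and truncations, and the admissibility
  of the Picone quotients.\<close>

lemma W0_dominated:
  fixes w :: "'a::euclidean_space \<Rightarrow> real"
  assumes "u \<in> W0 s p \<Omega>" "v \<in> W0 s p \<Omega>" "p \<ge> 1" and [measurable]: "w \<in> borel_measurable lebesgue"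
    and lip: "\<And>x y. \<bar>w x - w y\<bar> \<le> C * (\<bar>u x - u y\<bar> + \<bar>v x - v y\<bar>)"
    and bound: "\<And>x. \<bar>w x\<bar> \<le> C * (\<bar>u x\<bar> + \<bar>v x\<bar>)"
  shows "w \<in> W0 s p \<Omega>"
proof -
  have p: "p > 0" using assms by simp
  note u [measurable] = W0_D[OF assms(1) p] and v [measurable] = W0_D[OF assms(2) p]
  have C: "\<bar>C * (\<bar>a\<bar> + \<bar>b\<bar>)\<bar> powr p = \<bar>C\<bar> powr p * \<bar>\<bar>a\<bar> + \<bar>b\<bar>\<bar> powr p" for a b
    by (simp add: abs_mult powr_mult)
  have le: "\<bar>a\<bar> powr p \<le> \<bar>C * (\<bar>b\<bar> + \<bar>c\<bar>)\<bar> powr p" if "\<bar>a\<bar> \<le> C * (\<bar>b\<bar> + \<bar>c\<bar>)" for a b c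
    using that p by (intro powr_mono2) auto
  have "integrable lebesgue (\<lambda>x. \<bar>w x\<bar> powr p)"
  proof (rule Bochner_Integration.integrable_bound)
    show "integrable lebesgue (\<lambda>x. \<bar>C * (\<bar>u x\<bar> + \<bar>v x\<bar>)\<bar> powr p)"
      unfolding C using assms(3) u v by (intro integrable_mult_right integrable_abs_powr_add) auto
  qed (use le[OF bound] in auto)
  moreover have "integrable lebesgue (\<lambda>z. \<bar>dquot s p w z\<bar> powr p)"
  proof (rule Bochner_Integration.integrable_bound)
    show "integrable lebesgue (\<lambda>z. \<bar>C * (\<bar>dquot s p u z\<bar> + \<bar>dquot s p v z\<bar>)\<bar> powr p)"
      unfolding C using assms(3) u v by (intro integrable_mult_right integrable_abs_powr_add) auto
    show "AE z in lebesgue. norm (\<bar>dquot s p w z\<bar> powr p)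
        \<le> norm (\<bar>C * (\<bar>dquot s p u z\<bar> + \<bar>dquot s p v z\<bar>)\<bar> powr p)"
      using le[OF abs_dquot_mono[where w = w and u = u and v = v and p = p, OF lip]] by auto
  qed measurable
  moreover have "AE x in lebesgue. x \<notin> \<Omega> \<longrightarrow> w x = 0"
    using u(4) v(4)
  proof eventually_elim
    case (elim x)
    then show ?case using bound[of x] by auto
  qed
  ultimately show ?thesis
    using p by (auto simp: W0_def gagliardo_integrand_eq_dquot cong: integrable_cong)
qed

lemma W0_lin:
  fixes u v :: "'a::euclidean_space \<Rightarrow> real"
  assumes "u \<in> W0 s p \<Omega>" "v \<in> W0 s p \<Omega>" "p \<ge> 1"
  shows "(\<lambda>x. a * u x + b * v x) \<in> W0 s p \<Omega>"
proof (rule W0_dominated[where C = "max \<bar>a\<bar> \<bar>b\<bar>", OF assms])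
  have p: "p > 0" using assms by simp
  note [measurable] = W0_D(1)[OF assms(1) p] W0_D(1)[OF assms(2) p]
  show "(\<lambda>x. a * u x + b * v x) \<in> borel_measurable lebesgue" by measurable
  have *: "\<bar>a * X + b * Y\<bar> \<le> max \<bar>a\<bar> \<bar>b\<bar> * (\<bar>X\<bar> + \<bar>Y\<bar>)" for X Y
  proof -
    have "\<bar>a * X + b * Y\<bar> \<le> \<bar>a\<bar> * \<bar>X\<bar> + \<bar>b\<bar> * \<bar>Y\<bar>"
      by (metis abs_mult abs_triangle_ineq)
    also have "\<dots> \<le> max \<bar>a\<bar> \<bar>b\<bar> * \<bar>X\<bar> + max \<bar>a\<bar> \<bar>b\<bar> * \<bar>Y\<bar>"
      by (intro add_mono mult_right_mono) auto
    finally show ?thesis by (simp add: distrib_left)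
  qed
  show "\<bar>a * u x + b * v x - (a * u y + b * v y)\<bar> \<le> max \<bar>a\<bar> \<bar>b\<bar> * (\<bar>u x - u y\<bar> + \<bar>v x - v y\<bar>)" for x y
    using *[of "u x - u y" "v x - v y"] by (simp add: algebra_simps)
  show "\<bar>a * u x + b * v x\<bar> \<le> max \<bar>a\<bar> \<bar>b\<bar> * (\<bar>u x\<bar> + \<bar>v x\<bar>)" for x by (rule *)
qed

lemma W0_lipschitz_image:
  fixes u :: "'a::euclidean_space \<Rightarrow> real"
  assumes "u \<in> W0 s p \<Omega>" "p \<ge> 1" and [measurable]: "F \<in> borel_measurable borel"
    and "\<And>a b. \<bar>F a - F b\<bar> \<le> \<bar>a - b\<bar>" "F 0 = 0"
  shows "(\<lambda>x. F (u x)) \<in> W0 s p \<Omega>"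
proof (rule W0_dominated[where C = 1, OF assms(1,1,2)])
  have [measurable]: "u \<in> borel_measurable lebesgue"
    by (rule W0_D(1)[OF assms(1)]) (use assms in auto)
  show "(\<lambda>x. F (u x)) \<in> borel_measurable lebesgue" by measurable
  show "\<bar>F (u x) - F (u y)\<bar> \<le> 1 * (\<bar>u x - u y\<bar> + \<bar>u x - u y\<bar>)" for x y
    by (rule order_trans[OF assms(4)]) simp
  show "\<bar>F (u x)\<bar> \<le> 1 * (\<bar>u x\<bar> + \<bar>u x\<bar>)" for x
    using assms(4)[of "u x" 0] assms(5) by simp
qed

subsection \<open>Lipschitz functions in the space\<close>

lemma ennreal_le_suminf: "(f :: nat \<Rightarrow> ennreal) j \<le> suminf f"
  using sum_le_suminf[of f "{j}"] by simp

text \<open>The j-th term integrates to a constant times 2^(j b) 2^(j d N), so the series is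
  geometric with ratio 2^(b + d N) < 1. With d = 1 the balls exhaust the space, with d = -1 they
  shrink to the origin.\<close>

lemma nn_integral_dyadic_balls_finite:
  fixes f :: "'a::euclidean_space \<Rightarrow> ennreal"
  assumes "b + d * real DIM('a) < 0" "C \<ge> 0"
    and le: "\<And>x. f x \<le> (\<Sum>j. ennreal (C * 2 powr (real j * b)) * indicator (ball 0 (2 * 2 powr (real j * d))) x)"
  shows "(\<integral>\<^sup>+ x. f x \<partial>lborel) < \<infinity>"
proof -
  define q where "q = 2 powr (b + d * real DIM('a))"
  have q: "0 < q" "q < 1" using assms(1) by (auto simp: q_def powr_less_one)
  have m: "(\<lambda>x::'a. ennreal c * indicator (ball 0 \<rho>) x) \<in> borel_measurable lborel" for c \<rho>
    by (intro borel_measurable_times_ennreal borel_measurable_indicator borel_measurable_const) auto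
  define A where "A = C * unit_ball_vol (real DIM('a)) * 2 ^ DIM('a)"
  have "(\<integral>\<^sup>+ x. f x \<partial>lborel)
      \<le> (\<integral>\<^sup>+ x. (\<Sum>j. ennreal (C * 2 powr (real j * b)) * indicator (ball 0 (2 * 2 powr (real j * d))) (x::'a)) \<partial>lborel)"
    by (rule nn_integral_mono) (rule le)
  also have "\<dots> = (\<Sum>j. \<integral>\<^sup>+ x. ennreal (C * 2 powr (real j * b)) * indicator (ball 0 (2 * 2 powr (real j * d))) (x::'a) \<partial>lborel)"
    by (rule nn_integral_suminf[OF m])
  also have "\<dots> = (\<Sum>j. ennreal (A * q ^ j))"
  proof (rule arg_cong[where f = suminf], rule ext)
    fix j
    have "q ^ j = 2 powr (real j * b) * 2 powr (real j * d * real DIM('a))"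
      by (simp add: q_def powr_add[symmetric] powr_powr powr_realpow[symmetric] algebra_simps)
    moreover have "(2 powr (real j * d)) ^ DIM('a) = 2 powr (real j * d * real DIM('a))"
      by (simp add: powr_powr powr_realpow[symmetric])
    ultimately have "C * 2 powr (real j * b) * (unit_ball_vol (real DIM('a)) * (2 * 2 powr (real j * d)) ^ DIM('a)) = A * q ^ j"
      by (simp add: A_def power_mult_distrib mult_ac)
    moreover have "(\<integral>\<^sup>+ x. ennreal (C * 2 powr (real j * b)) * indicator (ball 0 (2 * 2 powr (real j * d))) (x::'a) \<partial>lborel)
      = ennreal (C * 2 powr (real j * b)) * ennreal (unit_ball_vol (real DIM('a)) * (2 * 2 powr (real j * d)) ^ DIM('a))"
      by (subst nn_integral_cmult_indicator) (auto simp: emeasure_ball)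
    ultimately show "(\<integral>\<^sup>+ x. ennreal (C * 2 powr (real j * b)) * indicator (ball 0 (2 * 2 powr (real j * d))) (x::'a) \<partial>lborel) = ennreal (A * q ^ j)"
      using assms(2) by (simp flip: ennreal_mult)
  qed
  also have "\<dots> = ennreal (\<Sum>j. A * q ^ j)"
    using q assms(2) by (intro suminf_ennreal2) (auto simp: A_def intro!: summable_mult summable_geometric)
  also have "\<dots> < \<infinity>" by simp
  finally show ?thesis .
qed

lemma dyadic_scale:
  assumes "t \<ge> (1::real)"
  obtains j :: nat where "2 powr real j \<le> t" "t < 2 * 2 powr real j"
proof
  define k where "k = nat \<lfloor>log 2 t\<rfloor>"
  have k: "real k = of_int \<lfloor>log 2 t\<rfloor>" using assms by (simp add: k_def)
  have "2 powr real k \<le> 2 powr log 2 t" unfolding k by (intro powr_mono) auto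
  then show "2 powr real k \<le> t" using assms by simp
  have "2 powr log 2 t < 2 powr (1 + real k)" unfolding k by (intro powr_less_mono) linarith+
  then show "t < 2 * 2 powr real k" using assms by (simp add: powr_add)
qed

lemma nn_integral_norm_powr_far:
  assumes "a > real DIM('a::euclidean_space)"
  shows "(\<integral>\<^sup>+ x. ennreal (norm x powr (- a)) * indicator {x. norm x \<ge> 1} (x::'a) \<partial>lborel) < \<infinity>"
proof (rule nn_integral_dyadic_balls_finite[where b = "- a" and d = 1 and C = 1])
  have a: "a > 0" using assms by (meson of_nat_0_le_iff order_le_less_trans)
  fix x :: 'a
  show "ennreal (norm x powr (- a)) * indicator {x. norm x \<ge> 1} x
     \<le> (\<Sum>j. ennreal (1 * 2 powr (real j * - a)) * indicator (ball 0 (2 * 2 powr (real j * 1))) x)" (is "_ \<le> suminf ?F")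
  proof (cases "norm x \<ge> 1")
    case True
    from dyadic_scale[OF this] obtain j where j: "2 powr real j \<le> norm x" "norm x < 2 * 2 powr real j" by metis
    have "norm x powr (- a) \<le> (2 powr real j) powr (- a)"
      using j a by (intro powr_mono2') auto
    then have "ennreal (norm x powr (- a)) \<le> ?F j"
      using j by (simp add: powr_powr ennreal_leI)
    also have "\<dots> \<le> suminf ?F"
      by (rule ennreal_le_suminf)
    finally show ?thesis using True by simp
  qed simp
qed (use assms in auto)

lemma nn_integral_norm_powr_near:
  assumes "a < real DIM('a::euclidean_space)"
  shows "(\<integral>\<^sup>+ x. ennreal (norm x powr (- a)) * indicator {x. 0 < norm x \<and> norm x < 1} (x::'a) \<partial>lborel) < \<infinity>"
proof (rule nn_integral_dyadic_balls_finite[where b = "a" and d = "- 1" and C = "2 powr \<bar>a\<bar>"])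
  fix x :: 'a
  show "ennreal (norm x powr (- a)) * indicator {x. 0 < norm x \<and> norm x < 1} x
     \<le> (\<Sum>j. ennreal (2 powr \<bar>a\<bar> * 2 powr (real j * a)) * indicator (ball 0 (2 * 2 powr (real j * - 1))) x)" (is "_ \<le> suminf ?F")
  proof (cases "0 < norm x \<and> norm x < 1")
    case True
    \<comment> \<open>The inverse radius is at least 1, so dyadic scales again run over the
      naturals; the factor \<open>2 powr \<bar>a\<bar>\<close> absorbs the rounding for either sign
      of \<open>a\<close>.\<close>
    define t where "t = 1 / norm x"
    have t: "t \<ge> 1" using True by (simp add: t_def)
    from dyadic_scale[OF this] obtain j where j: "2 powr real j \<le> t" "t < 2 * 2 powr real j" by metis
    have "t powr a \<le> 2 powr \<bar>a\<bar> * (2 powr real j) powr a"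
    proof (cases "a \<ge> 0")
      case True
      have "t powr a \<le> (2 * 2 powr real j) powr a"
        using j t True by (intro powr_mono2) auto
      then show ?thesis using True by (simp add: powr_mult)
    next
      case False
      have "t powr a \<le> 1 * (2 powr real j) powr a"
        using j t False by (simp add: powr_mono2')
      also have "\<dots> \<le> 2 powr \<bar>a\<bar> * (2 powr real j) powr a"
        by (intro mult_right_mono) (auto intro: ge_one_powr_ge_zero)
      finally show ?thesis .
    qed
    moreover have "norm x powr (- a) = t powr a"
      using True by (simp add: t_def powr_divide powr_minus_divide)
    moreover have "norm x < 2 * 2 powr (- real j)"
    proof -
      have "norm x * 2 powr real j \<le> 1" using j(1) True by (simp add: t_def field_simps)
      then show ?thesis using True by (simp add: powr_minus field_simps)
    qed
    ultimately have "ennreal (norm x powr (- a)) \<le> ?F j"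
      by (simp add: powr_powr ennreal_leI)
    also have "\<dots> \<le> suminf ?F"
      by (rule ennreal_le_suminf)
    finally show ?thesis using True by simp
  qed simp
qed (use assms in auto)

text \<open>Near the origin the integrand is a power of exponent -(N + s p - p), integrable because
  s < 1; far away it decays with exponent -(N + s p), integrable because s > 0.\<close>

lemma nn_integral_truncated_kernel:
  assumes "0 < s" "s < 1" "p > 0" "M \<ge> 0"
  shows "(\<integral>\<^sup>+ h. ennreal (min (norm h) M powr p / norm h powr (real DIM('a) + s * p)) \<partial>(lborel :: 'a::euclidean_space measure)) < \<infinity>"
    (is "(\<integral>\<^sup>+ h. ennreal (?J h) \<partial>lborel) < \<infinity>")
proof -
  let ?N = "real DIM('a)"
  have "(\<integral>\<^sup>+ h. ennreal (?J h) \<partial>lborel) \<le>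
     (\<integral>\<^sup>+ h. ennreal (norm h powr (- (?N + s * p - p))) * indicator {x. 0 < norm x \<and> norm x < 1} (h::'a)
       + ennreal (M powr p) * (ennreal (norm h powr (- (?N + s * p))) * indicator {x. norm x \<ge> 1} h) \<partial>lborel)"
  proof (intro nn_integral_mono)
    fix h :: 'a
    consider "h = 0" | "0 < norm h \<and> norm h < 1" | "norm h \<ge> 1" by fastforce
    then show "ennreal (?J h) \<le> ennreal (norm h powr (- (?N + s * p - p))) * indicator {x. 0 < norm x \<and> norm x < 1} h
       + ennreal (M powr p) * (ennreal (norm h powr (- (?N + s * p))) * indicator {x. norm x \<ge> 1} h)"
    proof cases
      case 2
      have "?J h \<le> norm h powr p / norm h powr (?N + s * p)"
        using assms by (intro divide_right_mono powr_mono2) auto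
      also have "\<dots> = norm h powr (- (?N + s * p - p))"
        by (simp flip: powr_diff)
      finally show ?thesis using 2 by (simp add: ennreal_leI)
    next
      case 3
      have "?J h \<le> M powr p / norm h powr (?N + s * p)"
        using assms by (intro divide_right_mono powr_mono2) auto
      also have "\<dots> = M powr p * norm h powr (- (?N + s * p))"
        unfolding powr_minus_divide by simp
      finally show ?thesis using 3 by (simp add: ennreal_leI flip: ennreal_mult)
    qed (use assms in simp)
  qed
  also have "\<dots> = (\<integral>\<^sup>+ h. ennreal (norm h powr (- (?N + s * p - p))) * indicator {x. 0 < norm x \<and> norm x < 1} (h::'a) \<partial>lborel)
       + ennreal (M powr p) * (\<integral>\<^sup>+ h. ennreal (norm h powr (- (?N + s * p))) * indicator {x. norm x \<ge> 1} (h::'a) \<partial>lborel)"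
    by (subst nn_integral_add) (auto simp: nn_integral_cmult)
  also have "\<dots> < \<infinity>"
    using nn_integral_norm_powr_near[where 'a = 'a, of "?N + s * p - p"] nn_integral_norm_powr_far[where 'a = 'a, of "?N + s * p"] assms
    by (auto simp: ennreal_mult_less_top)
  finally show ?thesis .
qed

lemma nn_integral_lborel_translate:
  fixes f :: "'a::euclidean_space \<Rightarrow> ennreal"
  assumes [measurable]: "f \<in> borel_measurable borel"
  shows "(\<integral>\<^sup>+ x. f (x - c) \<partial>lborel) = (\<integral>\<^sup>+ x. f x \<partial>lborel)"
proof -
  have "(\<integral>\<^sup>+ x. f x \<partial>lborel) = (\<integral>\<^sup>+ x. f x \<partial>distr lborel borel ((+) (- c)))"
    by (simp add: lborel_distr_plus)
  also have "\<dots> = (\<integral>\<^sup>+ x. f (x - c) \<partial>lborel)"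
    by (subst nn_integral_distr) auto
  finally show ?thesis by simp
qed

text \<open>An increment is at most min(|x - y|, M) and vanishes unless one of the two points lies
  in \<Omega>. The double integral is thus at most twice the volume of \<Omega> times the integral
  of the truncated kernel.\<close>

lemma lipschitz_in_W0:
  fixes \<phi> :: "'a::euclidean_space \<Rightarrow> real"
  assumes sp: "0 < s" "s < 1" "1 < p" and \<Omega>: "open \<Omega>" "bounded \<Omega>"
    and \<phi>: "\<And>x y. \<bar>\<phi> x - \<phi> y\<bar> \<le> norm (x - y)" "\<And>x. 0 \<le> \<phi> x" "\<And>x. \<phi> x \<le> M" "\<And>x. x \<notin> \<Omega> \<Longrightarrow> \<phi> x = 0"
  shows "\<phi> \<in> W0 s p \<Omega>"
proof -
  have M: "M \<ge> 0" using \<phi>(2,3) order_trans by blast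
  have "continuous_on UNIV \<phi>"
    using \<phi>(1) by (intro lipschitz_on_continuous_on[where L = 1] lipschitz_onI) (auto simp: dist_norm)
  then have [measurable]: "\<phi> \<in> borel_measurable borel"
    by (rule borel_measurable_continuous_onI)
  have [measurable]: "\<phi> \<in> borel_measurable lebesgue"
    by (intro measurable_completion) simp
  have [measurable]: "\<Omega> \<in> sets borel" using \<Omega> by auto
  have fin: "emeasure lborel \<Omega> < \<infinity>" using emeasure_bounded_finite[OF \<Omega>(2)] .
  define J :: "'a \<Rightarrow> ennreal" where "J h = ennreal (min (norm h) M powr p / norm h powr (real DIM('a) + s * p))" for h
  have [measurable]: "J \<in> borel_measurable borel" unfolding J_def[abs_def] by measurable
  have J: "(\<integral>\<^sup>+ h. J h \<partial>lborel) < \<infinity>"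
    unfolding J_def using nn_integral_truncated_kernel[of s p M] sp M by simp
  have J_minus: "J (- h) = J h" for h by (simp add: J_def)
  have Jx: "(\<integral>\<^sup>+ y. J (x - y) \<partial>lborel) = (\<integral>\<^sup>+ h. J h \<partial>lborel)" for x
  proof -
    have "(\<integral>\<^sup>+ y. J (x - y) \<partial>lborel) = (\<integral>\<^sup>+ y. J (y - x) \<partial>lborel)"
      by (rule nn_integral_cong) (metis J_minus minus_diff_eq)
    then show ?thesis using nn_integral_lborel_translate[of J x] by simp
  qed
  have Jy: "(\<integral>\<^sup>+ x. J (x - y) \<partial>lborel) = (\<integral>\<^sup>+ h. J h \<partial>lborel)" for y
    using nn_integral_lborel_translate[of J y] by simp
  have [measurable]: "(\<lambda>z::'a \<times> 'a. J (fst z - snd z)) \<in> borel_measurable (lborel \<Otimes>\<^sub>M lborel)"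
    by measurable
  have gm: "gagliardo_integrand s p \<phi> \<in> borel_measurable lebesgue"
    using sp by (subst gagliardo_integrand_eq_dquot) measurable
  have I1: "(\<integral>\<^sup>+ z. indicator \<Omega> (fst z) * J (fst z - snd z) \<partial>(lborel \<Otimes>\<^sub>M lborel)) = emeasure lborel \<Omega> * (\<integral>\<^sup>+ h. J h \<partial>lborel)"
  proof -
    have "(\<integral>\<^sup>+ z. indicator \<Omega> (fst z) * J (fst z - snd z) \<partial>(lborel \<Otimes>\<^sub>M lborel))
        = (\<integral>\<^sup>+ x. \<integral>\<^sup>+ y. indicator \<Omega> x * J (x - y) \<partial>lborel \<partial>lborel)"
      by (subst lborel.nn_integral_fst[symmetric]) simp_all
    also have "\<dots> = (\<integral>\<^sup>+ x. (\<integral>\<^sup>+ h. J h \<partial>lborel) * indicator \<Omega> x \<partial>lborel)"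
      by (intro nn_integral_cong) (simp add: nn_integral_cmult Jx mult.commute)
    also have "\<dots> = (\<integral>\<^sup>+ h. J h \<partial>lborel) * emeasure lborel \<Omega>"
      by (rule nn_integral_cmult_indicator) simp
    finally show ?thesis by (simp add: mult.commute)
  qed
  have I2: "(\<integral>\<^sup>+ z. indicator \<Omega> (snd z) * J (fst z - snd z) \<partial>(lborel \<Otimes>\<^sub>M lborel)) = emeasure lborel \<Omega> * (\<integral>\<^sup>+ h. J h \<partial>lborel)"
  proof -
    have "(\<integral>\<^sup>+ z. indicator \<Omega> (snd z) * J (fst z - snd z) \<partial>(lborel \<Otimes>\<^sub>M lborel))
        = (\<integral>\<^sup>+ y. \<integral>\<^sup>+ x. indicator \<Omega> y * J (x - y) \<partial>lborel \<partial>lborel)"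
      by (subst lborel_pair.nn_integral_snd[symmetric]) simp_all
    also have "\<dots> = (\<integral>\<^sup>+ y. (\<integral>\<^sup>+ h. J h \<partial>lborel) * indicator \<Omega> y \<partial>lborel)"
      by (intro nn_integral_cong) (simp add: nn_integral_cmult Jy mult.commute)
    also have "\<dots> = (\<integral>\<^sup>+ h. J h \<partial>lborel) * emeasure lborel \<Omega>"
      by (rule nn_integral_cmult_indicator) simp
    finally show ?thesis by (simp add: mult.commute)
  qed
  have "(\<integral>\<^sup>+ z. ennreal (norm (gagliardo_integrand s p \<phi> z)) \<partial>lebesgue)
     \<le> (\<integral>\<^sup>+ z. indicator \<Omega> (fst z) * J (fst z - snd z) + indicator \<Omega> (snd z) * J (fst z - snd z) \<partial>(lborel \<Otimes>\<^sub>M lborel))"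
    unfolding nn_integral_completion lborel_prod
  proof (intro nn_integral_mono)
    fix z :: "'a \<times> 'a"
    obtain x y where z: "z = (x, y)" by force
    have "gagliardo_integrand s p \<phi> z \<le> min (norm (x - y)) M powr p / norm (x - y) powr (real DIM('a) + s * p)"
      unfolding gagliardo_integrand_def z prod.case using \<phi>(1)[of x y] \<phi>(2,3)[of x] \<phi>(2,3)[of y] sp
      by (intro divide_right_mono powr_mono2) auto
    moreover have "gagliardo_integrand s p \<phi> z \<ge> 0" by (simp add: gagliardo_integrand_def z)
    moreover have "gagliardo_integrand s p \<phi> z = 0" if "x \<notin> \<Omega>" "y \<notin> \<Omega>"
      using \<phi>(4)[OF that(1)] \<phi>(4)[OF that(2)] sp by (simp add: gagliardo_integrand_def z)
    ultimately show "ennreal (norm (gagliardo_integrand s p \<phi> z)) \<le> indicator \<Omega> (fst z) * J (fst z - snd z) + indicator \<Omega> (snd z) * J (fst z - snd z)"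
      unfolding z by (cases "x \<in> \<Omega>"; cases "y \<in> \<Omega>") (auto simp: J_def ennreal_leI intro: add_increasing)
  qed
  also have "\<dots> = (\<integral>\<^sup>+ z. indicator \<Omega> (fst z) * J (fst z - snd z) \<partial>(lborel \<Otimes>\<^sub>M lborel))
      + (\<integral>\<^sup>+ z. indicator \<Omega> (snd z) * J (fst z - snd z) \<partial>(lborel \<Otimes>\<^sub>M lborel))"
    by (rule nn_integral_add) measurable
  also have "\<dots> = emeasure lborel \<Omega> * (\<integral>\<^sup>+ h. J h \<partial>lborel) + emeasure lborel \<Omega> * (\<integral>\<^sup>+ h. J h \<partial>lborel)"
    by (simp only: I1 I2)
  also have "\<dots> < \<infinity>"
    using fin J by (simp add: ennreal_mult_less_top)
  finally have "(\<integral>\<^sup>+ z. ennreal (norm (gagliardo_integrand s p \<phi> z)) \<partial>lebesgue) < \<infinity>" .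
  then have "integrable lebesgue (gagliardo_integrand s p \<phi>)"
    using gm by (rule integrableI_bounded[rotated])
  moreover have "integrable lebesgue (\<lambda>x. \<bar>\<phi> x\<bar> powr p)"
  proof (rule Bochner_Integration.integrable_bound)
    show "integrable lebesgue (\<lambda>x. M powr p * indicator \<Omega> x)"
      using fin by (intro integrable_mult_right integrable_real_indicator) auto
    show "(\<lambda>x. \<bar>\<phi> x\<bar> powr p) \<in> borel_measurable lebesgue" by (intro measurable_completion) simp
    show "AE x in lebesgue. norm (\<bar>\<phi> x\<bar> powr p) \<le> norm (M powr p * indicator \<Omega> x)"
    proof (intro AE_I2)
      fix x
      show "norm (\<bar>\<phi> x\<bar> powr p) \<le> norm (M powr p * indicator \<Omega> x)"
        using \<phi>(2,3)[of x] \<phi>(4)[of x] sp by (cases "x \<in> \<Omega>") (auto intro!: powr_mono2)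
    qed
  qed
  ultimately show ?thesis
    using \<phi>(4) by (auto simp: W0_def intro!: measurable_completion)
qed

text \<open>The distance to the complement gives a bounded member of the space that is positive on
  all of \<Omega>: the numerator of the test functions in the strong maximum principle, and a
  competitor showing that the Rayleigh quotients form a nonempty set.\<close>

lemma infdist_in_W0:
  fixes \<Omega> :: "'a::euclidean_space set"
  assumes sp: "0 < s" "s < 1" "1 < p" and \<Omega>: "open \<Omega>" "bounded \<Omega>"
  obtains \<phi> M where "\<phi> \<in> W0 s p \<Omega>" "\<And>x. 0 \<le> \<phi> x" "\<And>x. \<phi> x \<le> M" "\<And>x. x \<in> \<Omega> \<Longrightarrow> 0 < \<phi> x"
proof -
  have ne: "- \<Omega> \<noteq> {}" using \<Omega>(2) not_bounded_UNIV by (metis compl_bot_eq double_compl)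
  then obtain z where z: "z \<in> - \<Omega>" by blast
  obtain B where B: "\<And>x. x \<in> \<Omega> \<Longrightarrow> dist z x \<le> B"
    using \<Omega>(2) bounded_any_center[of \<Omega> z] by auto
  define \<phi> where "\<phi> x = infdist x (- \<Omega>)" for x
  have out: "\<phi> x = 0" if "x \<notin> \<Omega>" for x using that by (simp add: \<phi>_def)
  have bd: "\<phi> x \<le> max B 0" for x
  proof (cases "x \<in> \<Omega>")
    case True
    then show ?thesis using infdist_le[OF z, of x] B[OF True] by (auto simp: \<phi>_def dist_commute)
  qed (simp add: out)
  have "\<phi> \<in> W0 s p \<Omega>"
  proof (rule lipschitz_in_W0[OF sp \<Omega> _ _ bd out])
    show "\<bar>\<phi> x - \<phi> y\<bar> \<le> norm (x - y)" for x y
      using infdist_triangle_abs[of x "- \<Omega>" y] by (simp add: \<phi>_def dist_norm)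
  qed (simp add: \<phi>_def infdist_nonneg)
  moreover have "\<phi> x > 0" if "x \<in> \<Omega>" for x
    using that \<Omega>(1) ne in_closed_iff_infdist_zero[of "- \<Omega>" x] infdist_nonneg[of x "- \<Omega>"]
    by (auto simp: \<phi>_def less_le)
  moreover have "0 \<le> \<phi> x" for x by (simp add: \<phi>_def infdist_nonneg)
  ultimately show ?thesis using bd by (intro that[of \<phi> "max B 0"])
qed

section \<open>Pointwise inequalities for the two-part estimate and the Picone test
  functions\<close>

text \<open>For nonnegative \<alpha> and \<beta>, the number a \<alpha> + b \<beta> is \<alpha> +
  \<beta> times a convex combination of a and b, so convexity of |t|^p applies; oddness of
  \<open>psi\<close> settles the nonpositive case.\<close>

lemma abs_powr_two_term_le:
  fixes a b \<alpha> \<beta> p :: real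
  assumes p: "p \<ge> 1" and "\<alpha> * \<beta> \<ge> 0"
  shows "\<bar>a * \<alpha> + b * \<beta>\<bar> powr p \<le> psi p (\<alpha> + \<beta>) * (\<bar>a\<bar> powr p * \<alpha> + \<bar>b\<bar> powr p * \<beta>)"
proof -
  have main: "\<bar>a * \<alpha> + b * \<beta>\<bar> powr p \<le> psi p (\<alpha> + \<beta>) * (\<bar>a\<bar> powr p * \<alpha> + \<bar>b\<bar> powr p * \<beta>)"
    if "\<alpha> \<ge> 0" "\<beta> \<ge> 0" for \<alpha> \<beta>
  proof (cases "\<alpha> + \<beta> = 0")
    case False
    define S where "S = \<alpha> + \<beta>"
    define t where "t = \<beta> / S"
    have S: "S > 0" and t: "0 \<le> t" "t \<le> 1" using that False by (auto simp: S_def t_def)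
    have ab: "\<alpha> = S * (1 - t)" "\<beta> = S * t" using S by (auto simp: t_def S_def field_simps)
    have "\<bar>a * \<alpha> + b * \<beta>\<bar> powr p = \<bar>S * ((1 - t) * a + t * b)\<bar> powr p"
      by (simp add: ab algebra_simps)
    also have "\<dots> = S powr p * \<bar>(1 - t) * a + t * b\<bar> powr p"
      using S by (simp add: abs_mult powr_mult)
    also have "\<dots> \<le> S powr p * ((1 - t) * \<bar>a\<bar> powr p + t * \<bar>b\<bar> powr p)"
      using abs_powr_convex[OF p t, of a b] by (intro mult_left_mono) auto
    also have "S powr p = psi p S * S"
      using psi_mult_self[of p S] S by simp
    also have "psi p S * S * ((1 - t) * \<bar>a\<bar> powr p + t * \<bar>b\<bar> powr p)
        = psi p (\<alpha> + \<beta>) * (\<bar>a\<bar> powr p * \<alpha> + \<bar>b\<bar> powr p * \<beta>)"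
      unfolding S_def[symmetric] by (simp add: ab algebra_simps)
    finally show ?thesis .
  next
    case True
    then have "\<alpha> = 0" "\<beta> = 0" using that by auto
    then show ?thesis by simp
  qed
  consider "\<alpha> \<ge> 0" "\<beta> \<ge> 0" | "- \<alpha> \<ge> 0" "- \<beta> \<ge> 0"
    using assms(2) by (fastforce simp: zero_le_mult_iff)
  then show ?thesis
  proof cases
    case 2
    have "\<bar>a * \<alpha> + b * \<beta>\<bar> powr p = \<bar>a * - \<alpha> + b * - \<beta>\<bar> powr p"
      using abs_minus_cancel[of "a * \<alpha> + b * \<beta>"] by simp
    also have "\<dots> \<le> psi p (- \<alpha> + - \<beta>) * (\<bar>a\<bar> powr p * - \<alpha> + \<bar>b\<bar> powr p * - \<beta>)"
      by (rule main) (use 2 in auto)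
    also have "\<dots> = psi p (\<alpha> + \<beta>) * (\<bar>a\<bar> powr p * \<alpha> + \<bar>b\<bar> powr p * \<beta>)"
      using psi_minus[of p "\<alpha> + \<beta>"] by (simp add: algebra_simps)
    finally show ?thesis .
  qed (use main in auto)
qed

lemma powr_lipschitz_bounded:
  fixes a b M p :: real
  assumes "p > 1" "0 \<le> a" "a \<le> M" "0 \<le> b" "b \<le> M"
  shows "\<bar>a powr p - b powr p\<bar> \<le> p * M powr (p - 1) * \<bar>a - b\<bar>"
proof -
  have "norm (\<bar>a\<bar> powr p - \<bar>b\<bar> powr p) \<le> p * M powr (p - 1) * norm (a - b)"
  proof (rule field_differentiable_bound[of "{0..M}" "\<lambda>t. \<bar>t\<bar> powr p" "\<lambda>t. p * psi p t"])
    show "((\<lambda>t. \<bar>t\<bar> powr p) has_field_derivative p * psi p z) (at z within {0..M})" for z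
      using has_real_derivative_abs_powr[OF assms(1), of z] has_field_derivative_at_within by blast
    show "norm (p * psi p z) \<le> p * M powr (p - 1)" if "z \<in> {0..M}" for z
      using that assms(1) by (auto simp: abs_mult abs_psi intro!: powr_mono2)
  qed (use assms in auto)
  then show ?thesis using assms by simp
qed

lemma powr_negative_lipschitz:
  fixes a b \<delta> p :: real
  assumes "p > 1" "\<delta> > 0" "0 \<le> a" "0 \<le> b"
  shows "\<bar>(a + \<delta>) powr (1 - p) - (b + \<delta>) powr (1 - p)\<bar> \<le> (p - 1) * \<delta> powr (- p) * \<bar>a - b\<bar>"
proof -
  have "norm ((a + \<delta>) powr (1 - p) - (b + \<delta>) powr (1 - p)) \<le> (p - 1) * \<delta> powr (- p) * norm (a - b)"
  proof (rule field_differentiable_bound[of "{0..}" "\<lambda>t. (t + \<delta>) powr (1 - p)" "\<lambda>t. (1 - p) * (t + \<delta>) powr (- p)"])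
    show "((\<lambda>t. (t + \<delta>) powr (1 - p)) has_field_derivative (1 - p) * (z + \<delta>) powr (- p)) (at z within {0..})"
      if "z \<in> {0..}" for z
    proof -
      have "((\<lambda>t. t powr (1 - p)) has_real_derivative (1 - p) * (z + \<delta>) powr (1 - p - 1)) (at (z + \<delta>))"
        by (rule has_real_derivative_powr) (use that assms in auto)
      then have "((\<lambda>t. (t + \<delta>) powr (1 - p)) has_real_derivative (1 - p) * (z + \<delta>) powr (1 - p - 1) * 1) (at z within {0..})"
        by (rule DERIV_chain2) (auto intro!: derivative_eq_intros)
      then show ?thesis by simp
    qed
    show "norm ((1 - p) * (z + \<delta>) powr (- p)) \<le> (p - 1) * \<delta> powr (- p)" if "z \<in> {0..}" for z
      using that assms by (auto simp: abs_mult intro!: powr_mono2')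
  qed (use assms in auto)
  then show ?thesis by simp
qed

text \<open>The test functions of Picone type are admissible because of the regularisation \<open>\<delta>\<close>.\<close>

lemma picone_test_in_W0:
  fixes u w :: "'a::euclidean_space \<Rightarrow> real"
  assumes p: "1 < p" and u: "u \<in> W0 s p \<Omega>" "\<And>x. u x \<ge> 0"
    and w: "w \<in> W0 s p \<Omega>" "\<And>x. w x \<ge> 0" "\<And>x. w x \<le> M" and \<delta>: "\<delta> > 0"
  shows "(\<lambda>x. w x powr p / (u x + \<delta>) powr (p - 1)) \<in> W0 s p \<Omega>"
proof -
  have M: "M \<ge> 0" using w(2,3) order_trans by blast
  have [measurable]: "u \<in> borel_measurable lebesgue" "w \<in> borel_measurable lebesgue"
    using W0_D(1)[OF u(1)] W0_D(1)[OF w(1)] p by auto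
  have eq: "w x powr p / (u x + \<delta>) powr (p - 1) = w x powr p * (u x + \<delta>) powr (1 - p)" for x
    using powr_minus_divide[of "u x + \<delta>" "p - 1"] by simp
  \<comment> \<open>The two entries come from the product rule: Lipschitz constant of t^p on [0, M]
    times the maximum of (t + \<delta>)^(1-p), and M^p times the Lipschitz constant of (t +
    \<delta>)^(1-p).\<close>
  define C where "C = max (p * M powr (p - 1) * \<delta> powr (1 - p)) (M powr p * ((p - 1) * \<delta> powr (- p)))"
  have small: "(u x + \<delta>) powr (1 - p) \<le> \<delta> powr (1 - p)" for x
    using u(2)[of x] \<delta> p by (intro powr_mono2') auto
  show ?thesis
  proof (rule W0_dominated[where C = C, OF w(1) u(1)])
    show "(\<lambda>x. w x powr p / (u x + \<delta>) powr (p - 1)) \<in> borel_measurable lebesgue" by measurable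
    fix x y
    let ?A = "w x powr p" and ?A' = "w y powr p" and ?B = "(u x + \<delta>) powr (1 - p)" and ?B' = "(u y + \<delta>) powr (1 - p)"
    have "\<bar>?A * ?B - ?A' * ?B'\<bar> = \<bar>(?A - ?A') * ?B + ?A' * (?B - ?B')\<bar>" by (simp add: algebra_simps)
    also have "\<dots> \<le> \<bar>?A - ?A'\<bar> * ?B + ?A' * \<bar>?B - ?B'\<bar>"
      by (rule order_trans[OF abs_triangle_ineq]) (simp add: abs_mult)
    also have "\<dots> \<le> (p * M powr (p - 1) * \<bar>w x - w y\<bar>) * \<delta> powr (1 - p) + M powr p * ((p - 1) * \<delta> powr (- p) * \<bar>u x - u y\<bar>)"
    proof (rule add_mono)
      show "\<bar>?A - ?A'\<bar> * ?B \<le> (p * M powr (p - 1) * \<bar>w x - w y\<bar>) * \<delta> powr (1 - p)"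
        using w p small by (intro mult_mono powr_lipschitz_bounded) auto
      show "?A' * \<bar>?B - ?B'\<bar> \<le> M powr p * ((p - 1) * \<delta> powr (- p) * \<bar>u x - u y\<bar>)"
        using w u p \<delta> M by (intro mult_mono powr_negative_lipschitz powr_mono2) auto
    qed
    also have "\<dots> = (p * M powr (p - 1) * \<delta> powr (1 - p)) * \<bar>w x - w y\<bar> + (M powr p * ((p - 1) * \<delta> powr (- p))) * \<bar>u x - u y\<bar>"
      by (simp add: algebra_simps)
    also have "\<dots> \<le> C * \<bar>w x - w y\<bar> + C * \<bar>u x - u y\<bar>"
      by (intro add_mono mult_right_mono) (auto simp: C_def)
    finally show "\<bar>w x powr p / (u x + \<delta>) powr (p - 1) - w y powr p / (u y + \<delta>) powr (p - 1)\<bar>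
        \<le> C * (\<bar>w x - w y\<bar> + \<bar>u x - u y\<bar>)"
      unfolding eq by (simp add: distrib_left)
  next
    fix x
    have "w x powr p = w x powr (p - 1) * w x"
      using psi_mult_self[of p "w x"] psi_nonneg[OF w(2)[of x], of p] w(2)[of x] by simp
    also have "\<dots> \<le> M powr (p - 1) * w x"
      using w(2,3)[of x] p by (intro mult_right_mono powr_mono2) auto
    finally have "w x powr p * (u x + \<delta>) powr (1 - p) \<le> (M powr (p - 1) * w x) * \<delta> powr (1 - p)"
      using w(2)[of x] small by (intro mult_mono) auto
    also have "\<dots> = (1 * M powr (p - 1) * \<delta> powr (1 - p)) * w x" by (simp add: algebra_simps)
    also have "\<dots> \<le> (p * M powr (p - 1) * \<delta> powr (1 - p)) * w x"
      using p w(2)[of x] by (intro mult_right_mono) auto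
    also have "\<dots> \<le> C * w x"
      using w(2)[of x] by (intro mult_right_mono) (auto simp: C_def)
    also have "\<dots> \<le> C * (\<bar>w x\<bar> + \<bar>u x\<bar>)"
      using w(2)[of x] p by (intro mult_left_mono) (auto simp: C_def le_max_iff_disj)
    finally show "\<bar>w x powr p / (u x + \<delta>) powr (p - 1)\<bar> \<le> C * (\<bar>w x\<bar> + \<bar>u x\<bar>)"
      by (simp add: eq)
  qed (use p in auto)
qed

lemma psi_dquot_mult:
  fixes u v :: "'a::euclidean_space \<Rightarrow> real"
  assumes "p > 0"
  shows "psi p (dquot s p u (x, y)) * dquot s p v (x, y)
    = psi p (u x - u y) * (v x - v y) / norm (x - y) powr (real DIM('a) + s * p)"
proof (cases "x = y")
  case False
  define c where "c = 1 / norm (x - y) powr ((real DIM('a) + s * p) / p)"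
  have c: "c > 0" using False by (simp add: c_def)
  have "psi p (dquot s p u (x, y)) * dquot s p v (x, y) = (psi p c * c) * (psi p (u x - u y) * (v x - v y))"
    using psi_mult[of p c "u x - u y"] by (simp add: dquot_def c_def algebra_simps)
  also have "psi p c * c = 1 / norm (x - y) powr (real DIM('a) + s * p)"
    using assms c by (simp add: psi_mult_self) (simp add: c_def powr_divide powr_powr)
  finally show ?thesis by simp
qed (simp add: dquot_def)

text \<open>The discrete inequality is applied to the values of u + \<delta>, whose increments are
  those of u.\<close>

lemma picone_dquot:
  fixes u w :: "'a::euclidean_space \<Rightarrow> real"
  assumes p: "1 < p" and u: "\<And>x. u x \<ge> 0" and w: "\<And>x. w x \<ge> 0" and \<delta>: "\<delta> > 0"
  shows "psi p (dquot s p u z) * dquot s p (\<lambda>x. w x powr p / (u x + \<delta>) powr (p - 1)) z \<le> \<bar>dquot s p w z\<bar> powr p"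
proof -
  obtain x y where z: "z = (x, y)" by force
  have "psi p (u x - u y) * (w x powr p / (u x + \<delta>) powr (p - 1) - w y powr p / (u y + \<delta>) powr (p - 1)) \<le> \<bar>w x - w y\<bar> powr p"
    using discrete_Picone[of p "u x + \<delta>" "u y + \<delta>" "w x" "w y"] u[of x] u[of y] w[of x] w[of y] p \<delta> by simp
  then have "psi p (u x - u y) * (w x powr p / (u x + \<delta>) powr (p - 1) - w y powr p / (u y + \<delta>) powr (p - 1)) / norm (x - y) powr (real DIM('a) + s * p)
     \<le> \<bar>w x - w y\<bar> powr p / norm (x - y) powr (real DIM('a) + s * p)"
    by (rule divide_right_mono) simp
  also have "\<dots> = \<bar>dquot s p w (x, y)\<bar> powr p"
    using gagliardo_integrand_eq_dquot[of p s w] p by (simp add: gagliardo_integrand_def fun_eq_iff)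
  finally show ?thesis using p by (simp add: z psi_dquot_mult)
qed

lemma psi_picone_test_bound:
  assumes "p > 1" "a \<ge> 0" "\<delta> > 0"
  shows "0 \<le> psi p a * (b powr p / (a + \<delta>) powr (p - 1))"
    "psi p a * (b powr p / (a + \<delta>) powr (p - 1)) \<le> b powr p"
proof -
  have "psi p a \<le> (a + \<delta>) powr (p - 1)" "(a + \<delta>) powr (p - 1) > 0"
    using assms by (auto simp: psi_nonneg intro!: powr_mono2)
  then show "psi p a * (b powr p / (a + \<delta>) powr (p - 1)) \<le> b powr p"
    by (simp add: divide_le_eq mult.commute[of "b powr p"] mult_right_mono)
  show "0 \<le> psi p a * (b powr p / (a + \<delta>) powr (p - 1))"
    using assms by (simp add: psi_nonneg)
qed

subsection \<open>Weak solutions\<close>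

locale weighted_frac_problem =
  fixes \<Omega> :: "'a::euclidean_space set" and V :: "'a \<Rightarrow> real" and s p :: real
  assumes open_\<Omega>: "open \<Omega>" and bounded_\<Omega>: "bounded \<Omega>"
    and s01: "0 < s" "s < 1" and p1: "1 < p"
    and V_meas: "set_borel_measurable lebesgue \<Omega> V"
    and V_pos: "AE x in lebesgue. x \<in> \<Omega> \<longrightarrow> V x > 0"
begin

abbreviation "W \<equiv> W0 s p \<Omega>"
abbreviation "E \<equiv> energy s p"
abbreviation "dq \<equiv> dquot s p"

text \<open>The extension of V by zero, with the absolute value making it nonnegative everywhere. It
  agrees with V almost everywhere on \<Omega>, so all weighted integrals can be taken over the whole
  space without sign conditions.\<close>

definition wt :: "'a \<Rightarrow> real" where
  "wt x = indicator \<Omega> x * \<bar>V x\<bar>"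

definition wpow :: "('a \<Rightarrow> real) \<Rightarrow> real" where
  "wpow u = (LINT x|lebesgue. wt x * \<bar>u x\<bar> powr p)"

definition bform :: "('a \<Rightarrow> real) \<Rightarrow> ('a \<Rightarrow> real) \<Rightarrow> real" where
  "bform u v = Ks_const TYPE('a) s p * (LINT z|lebesgue. psi p (dq u z) * dq v z) + (LINT x|lebesgue. psi p (u x) * v x)"

definition wform :: "('a \<Rightarrow> real) \<Rightarrow> ('a \<Rightarrow> real) \<Rightarrow> real" where
  "wform u v = (LINT x|lebesgue. wt x * (psi p (u x) * v x))"

definition weak_solution :: "real \<Rightarrow> ('a \<Rightarrow> real) \<Rightarrow> bool" where
  "weak_solution \<mu> u \<longleftrightarrow> u \<in> W \<and> (\<forall>v\<in>W. bform u v = \<mu> * wform u v)"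

lemma p0: "p > 0" and p_ge1: "p \<ge> 1" using p1 by auto

lemma K_pos: "Ks_const TYPE('a) s p > 0"
  by (rule Ks_const_pos) (use p1 s01 in auto)

lemma wt_nonneg [simp]: "wt x \<ge> 0"
  by (simp add: wt_def)

lemma wt_measurable [measurable]: "wt \<in> borel_measurable lebesgue"
proof -
  have "(\<lambda>x. \<bar>indicator \<Omega> x *\<^sub>R V x\<bar>) \<in> borel_measurable lebesgue"
    using V_meas unfolding set_borel_measurable_def by measurable
  also have "(\<lambda>x. \<bar>indicator \<Omega> x *\<^sub>R V x\<bar>) = wt"
    by (auto simp: wt_def indicator_def)
  finally show ?thesis .
qed

lemma wt_pos: "AE x in lebesgue. x \<in> \<Omega> \<longrightarrow> wt x > 0"
  using V_pos by eventually_elim (auto simp: wt_def)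

lemmas W_D = W0_D[OF _ p0]

lemma W_lin: "u \<in> W \<Longrightarrow> v \<in> W \<Longrightarrow> (\<lambda>x. a * u x + b * v x) \<in> W"
  using W0_lin p_ge1 by blast

lemma W_scale: "u \<in> W \<Longrightarrow> (\<lambda>x. a * u x) \<in> W"
  using W_lin[of u u a 0] by simp

lemma W_abs: "u \<in> W \<Longrightarrow> (\<lambda>x. \<bar>u x\<bar>) \<in> W"
  by (rule W0_lipschitz_image[where F = abs]) (use p1 in auto)

lemma W_pos: "u \<in> W \<Longrightarrow> (\<lambda>x. max (u x) 0) \<in> W"
  by (rule W0_lipschitz_image[where F = "\<lambda>t. max t 0"]) (use p1 in auto)

lemma W_neg: "u \<in> W \<Longrightarrow> (\<lambda>x. max (- u x) 0) \<in> W"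
  by (rule W0_lipschitz_image[where F = "\<lambda>t. max (- t) 0"]) (use p1 in auto)

lemma weighted_pow_eq: "weighted_pow p \<Omega> V u = wpow u" if "u \<in> W"
proof -
  note [measurable] = W_D(1)[OF that]
  have [measurable]: "(\<lambda>x. indicator \<Omega> x *\<^sub>R V x) \<in> borel_measurable lebesgue"
    using V_meas unfolding set_borel_measurable_def .
  have "(\<lambda>x. (indicator \<Omega> x *\<^sub>R V x) * \<bar>u x\<bar> powr p) \<in> borel_measurable lebesgue" by measurable
  then have m: "(\<lambda>x. indicator \<Omega> x *\<^sub>R (V x * \<bar>u x\<bar> powr p)) \<in> borel_measurable lebesgue"
    by (simp add: mult.assoc)
  show ?thesis
    unfolding weighted_pow_def wpow_def set_lebesgue_integral_def
  proof (rule integral_cong_AE)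
    show "AE x in lebesgue. indicator \<Omega> x *\<^sub>R (V x * \<bar>u x\<bar> powr p) = wt x * \<bar>u x\<bar> powr p"
      using V_pos by eventually_elim (auto simp: wt_def indicator_def)
  qed (use m in measurable)
qed

lemma energy_eq: "u \<in> W \<Longrightarrow> E u = Ks_const TYPE('a) s p * (LINT z|lebesgue. \<bar>dq u z\<bar> powr p) + (LINT x|lebesgue. \<bar>u x\<bar> powr p)"
  by (simp add: energy_def gagliardo_pow_def Lp_pow_def gagliardo_integrand_eq_dquot[OF p0])

lemma energy_nonneg: "u \<in> W \<Longrightarrow> E u \<ge> 0"
  using K_pos by (simp add: energy_eq)

lemma energy_pos: "u \<in> W \<Longrightarrow> \<not> (AE x in lebesgue. u x = 0) \<Longrightarrow> E u > 0"
proof -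
  assume u: "u \<in> W" "\<not> (AE x in lebesgue. u x = 0)"
  have "(LINT x|lebesgue. \<bar>u x\<bar> powr p) \<noteq> 0"
    using u W_D(2)[OF u(1)] by (subst integral_nonneg_eq_0_iff_AE) auto
  then have "(LINT x|lebesgue. \<bar>u x\<bar> powr p) > 0"
    by (simp add: less_le)
  then show ?thesis using K_pos by (simp add: energy_eq[OF u(1)] add_nonneg_pos)
qed

lemma energy_le_twice:
  assumes u: "u \<in> W" and v: "v \<in> W"
  shows "E (\<lambda>x. a * u x + b * v x) \<le> 2 powr p * (\<bar>a\<bar> powr p * E u + \<bar>b\<bar> powr p * E v)"
proof -
  note I = W_D(2,3)[OF u] W_D(2,3)[OF v] W_D(2,3)[OF W_lin[OF u v, of a b]]
  have le: "\<bar>a * X + b * Y\<bar> powr p \<le> 2 powr p * (\<bar>a\<bar> powr p * \<bar>X\<bar> powr p + \<bar>b\<bar> powr p * \<bar>Y\<bar> powr p)" for X Y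
    using abs_add_powr_le2[OF p_ge1, of "a * X" "b * Y"] by (simp add: abs_mult powr_mult)
  have "(LINT z|lebesgue. \<bar>dq (\<lambda>x. a * u x + b * v x) z\<bar> powr p)
     \<le> (LINT z|lebesgue. 2 powr p * (\<bar>a\<bar> powr p * \<bar>dq u z\<bar> powr p + \<bar>b\<bar> powr p * \<bar>dq v z\<bar> powr p))"
    using I le by (intro integral_mono) (auto simp: dquot_lin)
  also have "\<dots> = 2 powr p * (\<bar>a\<bar> powr p * (LINT z|lebesgue. \<bar>dq u z\<bar> powr p) + \<bar>b\<bar> powr p * (LINT z|lebesgue. \<bar>dq v z\<bar> powr p))"
    using I by simp
  finally have 1: "Ks_const TYPE('a) s p * (LINT z|lebesgue. \<bar>dq (\<lambda>x. a * u x + b * v x) z\<bar> powr p)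
     \<le> Ks_const TYPE('a) s p * (2 powr p * (\<bar>a\<bar> powr p * (LINT z|lebesgue. \<bar>dq u z\<bar> powr p) + \<bar>b\<bar> powr p * (LINT z|lebesgue. \<bar>dq v z\<bar> powr p)))"
    using K_pos by (intro mult_left_mono) auto
  have "(LINT x|lebesgue. \<bar>a * u x + b * v x\<bar> powr p)
     \<le> (LINT x|lebesgue. 2 powr p * (\<bar>a\<bar> powr p * \<bar>u x\<bar> powr p + \<bar>b\<bar> powr p * \<bar>v x\<bar> powr p))"
    using I le by (intro integral_mono) auto
  also have "\<dots> = 2 powr p * (\<bar>a\<bar> powr p * (LINT x|lebesgue. \<bar>u x\<bar> powr p) + \<bar>b\<bar> powr p * (LINT x|lebesgue. \<bar>v x\<bar> powr p))"
    using I by simp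
  finally show ?thesis using 1
    unfolding energy_eq[OF u] energy_eq[OF v] energy_eq[OF W_lin[OF u v]] by (simp add: algebra_simps)
qed

lemma energy_scale: "u \<in> W \<Longrightarrow> E (\<lambda>x. c * u x) = \<bar>c\<bar> powr p * E u"
proof -
  assume u: "u \<in> W"
  have "dq (\<lambda>x. c * u x) z = c * dq u z" for z
    using dquot_lin[of s p c u 0 u z] by simp
  then show ?thesis
    by (simp add: energy_eq u W_scale abs_mult powr_mult algebra_simps)
qed

lemma wpow_scale: "wpow (\<lambda>x. c * u x) = \<bar>c\<bar> powr p * wpow u"
  unfolding wpow_def integral_mult_right_zero[symmetric] abs_mult powr_mult
  by (simp add: mult_ac)

lemma wpow_nonneg [simp]: "wpow u \<ge> 0"
  by (simp add: wpow_def)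

text \<open>The Bochner integral of a non-integrable function is 0 by default, so a positive value
  certifies integrability. This is how finiteness of the weighted integral is obtained before any
  embedding is available.\<close>

lemma wpow_pos_integrable: "wpow u > 0 \<Longrightarrow> integrable lebesgue (\<lambda>x. wt x * \<bar>u x\<bar> powr p)"
  using not_integrable_integral_eq unfolding wpow_def by fastforce

lemma energy_contraction:
  assumes u: "u \<in> W" and [measurable]: "F \<in> borel_measurable borel"
    and F: "\<And>a b. \<bar>F a - F b\<bar> \<le> \<bar>a - b\<bar>" "F 0 = 0"
  shows "E (\<lambda>x. F (u x)) \<le> E u"
proof -
  have Fu: "(\<lambda>x. F (u x)) \<in> W" by (rule W0_lipschitz_image) (use u F p1 in auto)
  have 1: "\<bar>dq (\<lambda>x. F (u x)) z\<bar> \<le> \<bar>dq u z\<bar>" for z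
    using F(1) by (auto simp: dquot_def abs_divide intro!: divide_right_mono)
  have 2: "\<bar>F (u x)\<bar> \<le> \<bar>u x\<bar>" for x
    using F(1)[of "u x" 0] F(2) by simp
  show ?thesis
    unfolding energy_eq[OF u] energy_eq[OF Fu]
    using K_pos W_D(2,3)[OF u] W_D(2,3)[OF Fu] 1 2 p1
    by (intro add_mono mult_left_mono integral_mono powr_mono2) auto
qed

lemma bform_self: "u \<in> W \<Longrightarrow> bform u u = E u"
  by (simp add: bform_def energy_eq psi_mult_self)

lemma wform_self: "wform u u = wpow u"
  by (simp add: wform_def wpow_def psi_mult_self)

lemma is_eigenvalue_iff:
  "is_eigenvalue s p \<Omega> V \<mu> \<longleftrightarrow> (\<exists>u. weak_solution \<mu> u \<and> \<not> (AE x in lebesgue. u x = 0))"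
proof -
  have lhs: "frac_plap s p u v + (LINT x:\<Omega>|lebesgue. \<bar>u x\<bar> powr (p - 2) * u x * v x) = bform u v"
    if u: "u \<in> W" and v: "v \<in> W" for u v
  proof -
    note [measurable] = W_D(1)[OF u] W_D(1)[OF v]
    have [measurable]: "\<Omega> \<in> sets lebesgue" using open_\<Omega> by simp
    have "(LINT x:\<Omega>|lebesgue. \<bar>u x\<bar> powr (p - 2) * u x * v x) = (LINT x|lebesgue. psi p (u x) * v x)"
      unfolding set_lebesgue_integral_def
    proof (rule integral_cong_AE)
      show "AE x in lebesgue. indicator \<Omega> x *\<^sub>R (\<bar>u x\<bar> powr (p - 2) * u x * v x) = psi p (u x) * v x"
        using W_D(4)[OF v] by eventually_elim (auto simp: psi_def)
    qed measurable
    then show ?thesis by (simp add: bform_def frac_plap_eq_dquot[OF p0])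
  qed
  have rhs: "(LINT x:\<Omega>|lebesgue. V x * \<bar>u x\<bar> powr (p - 2) * u x * v x) = wform u v"
    if u: "u \<in> W" and v: "v \<in> W" for u v
  proof -
    note [measurable] = W_D(1)[OF u] W_D(1)[OF v]
    have [measurable]: "(\<lambda>x. indicator \<Omega> x *\<^sub>R V x) \<in> borel_measurable lebesgue"
      using V_meas unfolding set_borel_measurable_def .
    have "(\<lambda>x. (indicator \<Omega> x *\<^sub>R V x) * \<bar>u x\<bar> powr (p - 2) * u x * v x) \<in> borel_measurable lebesgue" by measurable
    then have m: "(\<lambda>x. indicator \<Omega> x *\<^sub>R (V x * \<bar>u x\<bar> powr (p - 2) * u x * v x)) \<in> borel_measurable lebesgue"
      by (simp add: mult.assoc)
    show ?thesis
      unfolding set_lebesgue_integral_def wform_def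
    proof (rule integral_cong_AE)
      show "AE x in lebesgue. indicator \<Omega> x *\<^sub>R (V x * \<bar>u x\<bar> powr (p - 2) * u x * v x) = wt x * (psi p (u x) * v x)"
        using V_pos by eventually_elim (auto simp: wt_def psi_def)
    qed (use m in measurable)
  qed
  have "(\<forall>v\<in>W. frac_plap s p u v + (LINT x:\<Omega>|lebesgue. \<bar>u x\<bar> powr (p - 2) * u x * v x)
      = \<mu> * (LINT x:\<Omega>|lebesgue. V x * \<bar>u x\<bar> powr (p - 2) * u x * v x)) \<longleftrightarrow> (\<forall>v\<in>W. bform u v = \<mu> * wform u v)"
    if "u \<in> W" for u
    using lhs[OF that] rhs[OF that] by (intro ball_cong) auto
  then show ?thesis unfolding is_eigenvalue_def weak_solution_def by blast
qed

lemma weak_solution_uminus: "weak_solution \<mu> u \<Longrightarrow> weak_solution \<mu> (\<lambda>x. - u x)"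
proof -
  assume u: "weak_solution \<mu> u"
  have "dq (\<lambda>x. - u x) z = - dq u z" for z
    using dquot_lin[of s p "- 1" u 0 u z] by simp
  then have "bform (\<lambda>x. - u x) v = - bform u v" "wform (\<lambda>x. - u x) v = - wform u v" for v
    by (simp_all add: bform_def wform_def)
  moreover have "(\<lambda>x. - u x) \<in> W" using u W_scale[of u "- 1"] by (simp add: weak_solution_def)
  ultimately show ?thesis using u by (simp add: weak_solution_def)
qed

lemma weak_solution_cong:
  assumes u: "weak_solution \<mu> u" and u': "u' \<in> W" and ae: "AE x in lebesgue. u x = u' x"
  shows "weak_solution \<mu> u'"
proof -
  have W: "u \<in> W" using u by (simp add: weak_solution_def)
  have dae: "AE z in lebesgue. dq u z = dq u' z"
    using AE_lebesgue_fst[OF ae, where 'b = 'a] AE_lebesgue_snd[OF ae, where 'a = 'a]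
    by eventually_elim (simp add: dquot_def)
  have "bform u v = bform u' v" "wform u v = wform u' v" if v: "v \<in> W" for v
  proof -
    note [measurable] = W_D(1)[OF v] W_D(1)[OF u'] W_D(1)[OF W]
    have "(LINT z|lebesgue. psi p (dq u z) * dq v z) = (LINT z|lebesgue. psi p (dq u' z) * dq v z)"
      by (rule integral_cong_AE) (use dae in \<open>auto elim: AE_mp\<close>)
    moreover have "(LINT x|lebesgue. psi p (u x) * v x) = (LINT x|lebesgue. psi p (u' x) * v x)"
      by (rule integral_cong_AE) (use ae in \<open>auto elim: AE_mp\<close>)
    ultimately show "bform u v = bform u' v" by (simp add: bform_def)
    show "wform u v = wform u' v" unfolding wform_def
      by (rule integral_cong_AE) (use ae in \<open>auto elim: AE_mp\<close>)
  qed
  then show ?thesis using u u' by (simp add: weak_solution_def)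
qed

lemma weak_solution_energy: "weak_solution \<mu> u \<Longrightarrow> E u = \<mu> * wpow u"
  using bform_self wform_self by (auto simp: weak_solution_def)

lemma weak_solution_pos:
  assumes "weak_solution \<mu> u" "\<not> (AE x in lebesgue. u x = 0)"
  shows "\<mu> > 0" "wpow u > 0"
proof -
  have "\<mu> * wpow u > 0"
    using weak_solution_energy[OF assms(1)] energy_pos[OF _ assms(2)] assms(1) by (auto simp: weak_solution_def)
  then show "\<mu> > 0" "wpow u > 0"
    using wpow_nonneg[of u] by (auto simp: zero_less_mult_iff)
qed

text \<open>Testing the equation with \<open>|a|\<^sup>p u\<^sup>+ - |b|\<^sup>p u\<^sup>-\<close> bounds the energy on the plane spanned by
  \<open>u\<^sup>+\<close> and \<open>u\<^sup>-\<close>.\<close>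

lemma weak_solution_two_parts:
  assumes u: "weak_solution \<mu> u" and int: "integrable lebesgue (\<lambda>x. wt x * \<bar>u x\<bar> powr p)"
  shows "E (\<lambda>x. a * max (u x) 0 + b * max (- u x) 0)
      \<le> \<mu> * (\<bar>a\<bar> powr p * wpow (\<lambda>x. max (u x) 0) + \<bar>b\<bar> powr p * wpow (\<lambda>x. max (- u x) 0))" (is ?A)
    and "wpow (\<lambda>x. a * max (u x) 0 + b * max (- u x) 0)
      = \<bar>a\<bar> powr p * wpow (\<lambda>x. max (u x) 0) + \<bar>b\<bar> powr p * wpow (\<lambda>x. max (- u x) 0)" (is ?B)
proof -
  define P where "P x = max (u x) 0" for x
  define N where "N x = max (- u x) 0" for x
  have W: "u \<in> W" using u by (simp add: weak_solution_def)
  have P: "P \<in> W" and N: "N \<in> W" using W_pos[OF W] W_neg[OF W] by (auto simp: P_def[abs_def] N_def[abs_def])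
  define f where "f x = a * P x + b * N x" for x
  define v where "v x = \<bar>a\<bar> powr p * P x + (- (\<bar>b\<bar> powr p)) * N x" for x
  have f: "f \<in> W" and v: "v \<in> W"
    unfolding f_def[abs_def] v_def[abs_def] by (intro W_lin P N)+
  note [measurable] = W_D(1)[OF W] W_D(1)[OF P] W_D(1)[OF N] W_D(1)[OF v] W_D(1)[OF f]
  have u_eq: "u x = P x + - N x" for x by (auto simp: P_def N_def)
  have fp: "\<bar>f x\<bar> powr p = \<bar>a\<bar> powr p * \<bar>P x\<bar> powr p + \<bar>b\<bar> powr p * \<bar>N x\<bar> powr p" for x
    using powr_mult[of "\<bar>b\<bar>" "- u x" p]
    by (cases "u x \<ge> 0") (auto simp: f_def P_def N_def abs_mult powr_mult)
  \<comment> \<open>At each point only one of the two parts of u is nonzero, and its sign agrees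
    with the sign in front of that part in \<open>v\<close>.\<close>
  have pv: "psi p (u x) * v x = \<bar>f x\<bar> powr p" for x
  proof (cases "u x \<ge> 0")
    case True
    then show ?thesis unfolding fp using psi_mult_self[of p "u x"] by (simp add: v_def P_def N_def mult.left_commute)
  next
    case False
    then show ?thesis unfolding fp using psi_mult_self[of p "u x"] by (simp add: v_def P_def N_def mult.left_commute)
  qed
  have dqle: "\<bar>dq f z\<bar> powr p \<le> psi p (dq u z) * dq v z" for z
  proof -
    have du: "dq u z = dq P z + - dq N z"
      using dquot_lin[of s p 1 P "- 1" N z] by (simp add: u_eq[abs_def])
    have df: "dq f z = a * dq P z + (- b) * (- dq N z)"
      unfolding f_def[abs_def] by (simp add: dquot_lin)
    have dv: "dq v z = \<bar>a\<bar> powr p * dq P z + \<bar>- b\<bar> powr p * (- dq N z)"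
      unfolding v_def[abs_def] dquot_lin by simp
    \<comment> \<open>The parts u^+ and -u^- are both nondecreasing functions of u, so their
      increments between two points have the same sign.\<close>
    have "dq P z * (- dq N z) \<ge> 0"
    proof -
      have "(P x - P y) * (- (N x - N y)) \<ge> 0" for x y
      proof (cases "u x \<le> u y")
        case True
        then have "P x - P y \<le> 0" "- (N x - N y) \<le> 0" by (auto simp: P_def N_def)
        then show ?thesis by (rule mult_nonpos_nonpos)
      next
        case False
        then have "P x - P y \<ge> 0" "- (N x - N y) \<ge> 0" by (auto simp: P_def N_def)
        then show ?thesis by (rule mult_nonneg_nonneg)
      qed
      then have "(P (fst z) - P (snd z)) * (- (N (fst z) - N (snd z))) /
        (norm (fst z - snd z) powr ((real DIM('a) + s * p) / p) * norm (fst z - snd z) powr ((real DIM('a) + s * p) / p)) \<ge> 0"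
        by (intro divide_nonneg_nonneg) auto
      then show ?thesis unfolding dquot_def minus_divide_left times_divide_times_eq .
    qed
    then show ?thesis unfolding du df dv by (rule abs_powr_two_term_le[OF p_ge1])
  qed
  have intP: "integrable lebesgue (\<lambda>x. wt x * \<bar>P x\<bar> powr p)" and intN: "integrable lebesgue (\<lambda>x. wt x * \<bar>N x\<bar> powr p)"
    using p1 by (auto intro!: Bochner_Integration.integrable_bound[OF int] AE_I2 mult_left_mono powr_mono2 simp: abs_mult P_def N_def)
  have wf: "wpow f = \<bar>a\<bar> powr p * wpow P + \<bar>b\<bar> powr p * wpow N"
  proof -
    have "wt x * \<bar>f x\<bar> powr p = \<bar>a\<bar> powr p * (wt x * \<bar>P x\<bar> powr p) + \<bar>b\<bar> powr p * (wt x * \<bar>N x\<bar> powr p)" for x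
      unfolding fp by (simp add: algebra_simps)
    then show ?thesis using intP intN by (simp add: wpow_def)
  qed
  have "E f \<le> bform u v"
    unfolding energy_eq[OF f] bform_def pv
    using K_pos W_D(2,3)[OF f] W_D(2,3)[OF W] W_D(2,3)[OF v] dqle p1
    by (intro add_mono mult_left_mono integral_mono integrable_psi_mult) auto
  also have "\<dots> = \<mu> * wform u v" using u v by (simp add: weak_solution_def)
  also have "wform u v = wpow f" by (simp add: wform_def pv wpow_def)
  finally show ?A unfolding wf f_def P_def N_def .
  show ?B using wf unfolding f_def P_def N_def .
qed

subsection \<open>Strong maximum principle and positive eigenfunctions\<close>

text \<open>Picone handles the nonlocal part pointwise on the product space; in the zero order part
  \<open>psi p (u x)\<close> is at most (u x + \<delta>)^(p-1), which cancels the
  denominator.\<close>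

lemma bform_picone_le:
  assumes u: "u \<in> W" "\<And>x. u x \<ge> 0" and w: "w \<in> W" "\<And>x. w x \<ge> 0" "\<And>x. w x \<le> M" and \<delta>: "\<delta> > 0"
  shows "bform u (\<lambda>x. w x powr p / (u x + \<delta>) powr (p - 1)) \<le> E w"
proof -
  define \<eta> where "\<eta> x = w x powr p / (u x + \<delta>) powr (p - 1)" for x
  have \<eta>: "\<eta> \<in> W" unfolding \<eta>_def[abs_def] by (rule picone_test_in_W0[OF p1 u w \<delta>])
  note [measurable] = W_D(1)[OF u(1)] W_D(1)[OF w(1)] W_D(1)[OF \<eta>]
  have 1: "psi p (dq u z) * dq \<eta> z \<le> \<bar>dq w z\<bar> powr p" for z
    unfolding \<eta>_def[abs_def] by (rule picone_dquot[OF p1 u(2) w(2) \<delta>])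
  have 2: "psi p (u x) * \<eta> x \<le> \<bar>w x\<bar> powr p" for x
    using psi_picone_test_bound(2)[OF p1 u(2) \<delta>, of x "w x"] w(2)[of x] by (simp add: \<eta>_def)
  have "bform u \<eta> \<le> E w"
    unfolding energy_eq[OF w(1)] bform_def
    using K_pos W_D(2,3)[OF u(1)] W_D(2,3)[OF w(1)] W_D(2,3)[OF \<eta>] 1 2 p1
    by (intro add_mono mult_left_mono integral_mono integrable_psi_mult) auto
  then show ?thesis by (simp add: \<eta>_def[abs_def])
qed

text \<open>Nonlocal strong maximum principle: the Picone deficit of the test functions
  \<open>\<phi>\<^sup>p / (u + \<delta>)\<^sup>p\<^sup>-\<^sup>1\<close> stays bounded as \<open>\<delta> \<rightarrow> 0\<close>, while it blows up at every pair \<open>(x, y)\<close> with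
  \<open>u x > 0 = u y\<close> and \<open>\<phi> y > 0\<close>. No connectedness of \<open>\<Omega>\<close> is involved.\<close>

lemma strong_maximum_principle:
  assumes u: "u \<in> W" "\<And>x. u x \<ge> 0" and nz: "\<not> (AE x in lebesgue. u x = 0)"
    and super: "\<And>v. v \<in> W \<Longrightarrow> (\<And>x. v x \<ge> 0) \<Longrightarrow> bform u v \<ge> 0"
  shows "AE x in lebesgue. x \<in> \<Omega> \<longrightarrow> u x > 0"
proof -
  obtain \<phi> M where \<phi>: "\<phi> \<in> W" "\<And>x. 0 \<le> \<phi> x" "\<And>x. \<phi> x \<le> M" "\<And>x. x \<in> \<Omega> \<Longrightarrow> 0 < \<phi> x"
    using infdist_in_W0[OF s01 p1 open_\<Omega> bounded_\<Omega>] by metis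
  define \<delta> where "\<delta> n = inverse (real (Suc n))" for n
  have \<delta>: "\<delta> n > 0" for n by (simp add: \<delta>_def)
  define \<eta> where "\<eta> n x = \<phi> x powr p / (u x + \<delta> n) powr (p - 1)" for n x
  have \<eta>: "\<eta> n \<in> W" for n
    unfolding \<eta>_def[abs_def] by (rule picone_test_in_W0[OF p1 u \<phi>(1-3) \<delta>])
  note [measurable] = W_D(1)[OF u(1)] W_D(1)[OF \<phi>(1)] W_D(1)[OF \<eta>]
  \<comment> \<open>The Picone deficit: nonnegative pointwise, so a bound on its integral controls
    it almost everywhere.\<close>
  define g where "g n z = \<bar>dq \<phi> z\<bar> powr p - psi p (dq u z) * dq (\<eta> n) z" for n z
  have g_nonneg: "g n z \<ge> 0" for n z
    unfolding g_def \<eta>_def[abs_def] using picone_dquot[OF p1 u(2) \<phi>(2) \<delta>] by simp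
  have int_psi: "integrable lebesgue (\<lambda>z. psi p (dq u z) * dq (\<eta> n) z)" for n
    using W_D(3)[OF u(1)] W_D(3)[OF \<eta>] p1 by (intro integrable_psi_mult) auto
  have g_int: "integrable lebesgue (g n)" for n
    unfolding g_def[abs_def] using W_D(3)[OF \<phi>(1)] int_psi by auto
  have g_meas [measurable]: "g n \<in> borel_measurable lebesgue" for n using g_int by auto
  \<comment> \<open>The bound is independent of \<open>n\<close>: the supersolution property is
    tested with \<open>\<eta> n\<close>, and the zero order term is at most the integral of
    \<phi>^p.\<close>
  define C where "C = E \<phi> / Ks_const TYPE('a) s p"
  have g_bound: "(LINT z|lebesgue. g n z) \<le> C" for n
  proof -
    have "0 \<le> bform u (\<eta> n)"
      using super[OF \<eta>] by (simp add: \<eta>_def)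
    also have "(LINT x|lebesgue. psi p (u x) * \<eta> n x) \<le> (LINT x|lebesgue. \<bar>\<phi> x\<bar> powr p)"
      using W_D(2)[OF \<phi>(1)] W_D(2)[OF u(1)] W_D(2)[OF \<eta>] p1 psi_picone_test_bound(2)[OF p1 u(2) \<delta>] \<phi>(2)
      by (intro integral_mono integrable_psi_mult) (auto simp: \<eta>_def)
    then have "bform u (\<eta> n) \<le> Ks_const TYPE('a) s p * (LINT z|lebesgue. psi p (dq u z) * dq (\<eta> n) z) + (LINT x|lebesgue. \<bar>\<phi> x\<bar> powr p)"
      by (simp add: bform_def)
    finally have "0 \<le> Ks_const TYPE('a) s p * (LINT z|lebesgue. psi p (dq u z) * dq (\<eta> n) z) + (LINT x|lebesgue. \<bar>\<phi> x\<bar> powr p)" .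
    moreover have "(LINT z|lebesgue. g n z) = (LINT z|lebesgue. \<bar>dq \<phi> z\<bar> powr p) - (LINT z|lebesgue. psi p (dq u z) * dq (\<eta> n) z)"
      unfolding g_def using W_D(3)[OF \<phi>(1)] int_psi by (rule Bochner_Integration.integral_diff)
    then have D: "(LINT z|lebesgue. \<bar>dq \<phi> z\<bar> powr p) = (LINT z|lebesgue. g n z) + (LINT z|lebesgue. psi p (dq u z) * dq (\<eta> n) z)"
      by simp
    ultimately have "Ks_const TYPE('a) s p * (LINT z|lebesgue. g n z) \<le> E \<phi>"
      unfolding energy_eq[OF \<phi>(1)] D distrib_left by linarith
    then show ?thesis using K_pos by (simp add: C_def field_simps)
  qed
  have "(\<integral>\<^sup>+ z. liminf (\<lambda>n. ennreal (g n z)) \<partial>lebesgue) \<le> liminf (\<lambda>n. \<integral>\<^sup>+ z. ennreal (g n z) \<partial>lebesgue)"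
    by (rule nn_integral_liminf) measurable
  also have "\<dots> \<le> ennreal C"
  proof (rule Liminf_le)
    show "\<forall>\<^sub>F n in sequentially. (\<integral>\<^sup>+ z. ennreal (g n z) \<partial>lebesgue) \<le> ennreal C"
      using g_bound g_int g_nonneg
      by (subst nn_integral_eq_integral) (auto intro!: always_eventually ennreal_leI)
  qed simp
  finally have "(\<integral>\<^sup>+ z. liminf (\<lambda>n. ennreal (g n z)) \<partial>lebesgue) \<noteq> \<infinity>"
    by (auto simp: top_unique)
  \<comment> \<open>By Fatou the uniform bound passes to the limit inferior of the deficits.\<close>
  then have fin: "AE z in lebesgue. liminf (\<lambda>n. ennreal (g n z)) \<noteq> \<infinity>"
    by (intro nn_integral_noteq_infinite) measurable
  \<comment> \<open>Where u y = 0 the denominator of \<open>\<eta> n y\<close> is \<delta>^(p-1)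
    alone, so the value is \<phi>(y)^p (n+1)^(p-1), while \<open>\<eta> n x\<close> stays bounded
    because u x > 0.\<close>
  have blow: "liminf (\<lambda>n. ennreal (g n (x, y))) = \<infinity>" if x: "u x > 0" and y: "u y = 0" "\<phi> y > 0" for x y
  proof -
    define c where "c = norm (x - y) powr (real DIM('a) + s * p)"
    have c: "c > 0" using x y by (auto simp: c_def)
    define A where "A = u x powr (p - 1) / c"
    have A: "A > 0" using x c by (simp add: A_def)
    have low: "g n (x, y) \<ge> A * (\<phi> y powr p * real (Suc n) powr (p - 1) - \<phi> x powr p / u x powr (p - 1))" for n
    proof -
      have 1: "\<phi> x powr p / (u x + \<delta> n) powr (p - 1) \<le> \<phi> x powr p / u x powr (p - 1)"
        using x \<delta>[of n] p1 by (intro divide_left_mono powr_mono2) auto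
      have 2: "\<phi> y powr p / \<delta> n powr (p - 1) = \<phi> y powr p * real (Suc n) powr (p - 1)"
        by (simp add: \<delta>_def powr_divide inverse_eq_divide del: of_nat_Suc)
      have "A * (\<phi> y powr p * real (Suc n) powr (p - 1) - \<phi> x powr p / u x powr (p - 1)) \<le> A * (\<eta> n y - \<eta> n x)"
        using 1 A unfolding \<eta>_def y 2[symmetric] by (intro mult_left_mono) auto
      also have "\<dots> = - (psi p (dq u (x, y)) * dq (\<eta> n) (x, y))"
      proof -
        have "a / c * (Y - X) = - (a * (X - Y) / c)" for a X Y
          by (simp add: algebra_simps diff_divide_distrib)
        from this[of "u x powr (p - 1)" "\<eta> n y" "\<eta> n x"] show ?thesis
          unfolding psi_dquot_mult[OF p0] A_def using x y by (simp only: c_def[symmetric] psi_nonneg diff_0_right less_imp_le)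
      qed
      also have "\<dots> \<le> g n (x, y)" by (simp add: g_def)
      finally show ?thesis .
    qed
    have "filterlim (\<lambda>n. real (Suc n) powr (p - 1)) at_top sequentially"
    proof -
      have Suc_lim: "filterlim (\<lambda>n. real (Suc n)) at_top sequentially"
        by (rule filterlim_compose[OF filterlim_real_sequentially filterlim_Suc])
      have "filterlim (\<lambda>n. exp ((p - 1) * ln (real (Suc n)))) at_top sequentially"
        by (rule filterlim_compose[OF exp_at_top filterlim_tendsto_pos_mult_at_top[OF tendsto_const]])
           (use p1 filterlim_compose[OF ln_at_top Suc_lim] in auto)
      then show ?thesis by (simp add: powr_def)
    qed
    then have "filterlim (\<lambda>n. \<phi> y powr p * real (Suc n) powr (p - 1)) at_top sequentially"
      by (rule filterlim_tendsto_pos_mult_at_top[OF tendsto_const, rotated]) (use y in simp)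
    then have "filterlim (\<lambda>n. - (\<phi> x powr p / u x powr (p - 1)) + \<phi> y powr p * real (Suc n) powr (p - 1)) at_top sequentially"
      by (rule filterlim_tendsto_add_at_top[OF tendsto_const])
    then have "filterlim (\<lambda>n. A * (- (\<phi> x powr p / u x powr (p - 1)) + \<phi> y powr p * real (Suc n) powr (p - 1))) at_top sequentially"
      by (rule filterlim_tendsto_pos_mult_at_top[OF tendsto_const A])
    then have "filterlim (\<lambda>n. g n (x, y)) at_top sequentially"
      by (rule filterlim_at_top_mono) (use low in \<open>simp add: algebra_simps\<close>)
    then have "((\<lambda>n. ennreal (g n (x, y))) \<longlongrightarrow> top) sequentially"
      by (simp add: ennreal_tendsto_top_eq_at_top)
    then show ?thesis unfolding infinity_ennreal_def by (intro lim_imp_Liminf) auto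
  qed
  have "AE x in lebesgue. AE y in lebesgue. \<not> (u x > 0 \<and> u y = 0 \<and> \<phi> y > 0)"
  proof -
    have "AE z in lebesgue. \<not> (u (fst z) > 0 \<and> u (snd z) = 0 \<and> \<phi> (snd z) > 0)"
      using fin by eventually_elim (metis blow prod.collapse)
    from AE_lebesgue_pairD[OF this] show ?thesis by simp
  qed
  \<comment> \<open>One point with u x > 0 and a good slice decides all of \<Omega> at once, since
    the kernel couples it to every y. Such a point exists because u is not almost everywhere
    zero.\<close>
  moreover have "\<exists>x. u x > 0 \<and> (AE y in lebesgue. \<not> (u x > 0 \<and> u y = 0 \<and> \<phi> y > 0))"
  proof (rule ccontr)
    assume no: "\<not> ?thesis"
    have "AE x in lebesgue. u x = 0"
      using calculation by eventually_elim (use no u(2) in \<open>force simp: less_le\<close>)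
    with nz show False by blast
  qed
  then obtain x where x: "u x > 0" "AE y in lebesgue. \<not> (u x > 0 \<and> u y = 0 \<and> \<phi> y > 0)" by blast
  show ?thesis using x(2) by eventually_elim (use x(1) u(2) \<phi>(4) in \<open>force simp: less_le\<close>)
qed

section \<open>The first eigenvalue as an infimum, and solutions of one sign\<close>

definition quotients :: "real set" where
  "quotients = {E w / wpow w | w. w \<in> W \<and> wpow w > 0}"

lemma wpow_pos_nonzero: "wpow u > 0 \<Longrightarrow> \<not> (AE x in lebesgue. u x = 0)"
proof
  assume "wpow u > 0" "AE x in lebesgue. u x = 0"
  then have "AE x in lebesgue. wt x * \<bar>u x\<bar> powr p = 0" by (auto elim: AE_mp)
  then have "wpow u = 0" unfolding wpow_def by (rule integral_eq_zero_AE)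
  with \<open>wpow u > 0\<close> show False by simp
qed

lemma lambda1_eq: "lambda1 s p \<Omega> V = Inf quotients"
  unfolding lambda1_def quotients_def
  by (rule arg_cong[where f = Inf]) (use wpow_pos_nonzero weighted_pow_eq in \<open>auto; metis\<close>)

lemma lambda1_le: "w \<in> W \<Longrightarrow> wpow w > 0 \<Longrightarrow> lambda1 s p \<Omega> V \<le> E w / wpow w"
  unfolding lambda1_eq
  by (rule cInf_lower) (auto simp: quotients_def energy_nonneg intro!: bdd_belowI[of _ 0])

lemma lambda1_le_weak_solution:
  assumes "weak_solution \<mu> u" "\<not> (AE x in lebesgue. u x = 0)"
  shows "lambda1 s p \<Omega> V \<le> \<mu>"
  using lambda1_le[of u] weak_solution_pos[OF assms] weak_solution_energy[OF assms(1)] assms(1)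
  by (simp add: weak_solution_def)

lemma nonneg_weak_solution_pos:
  assumes u: "weak_solution \<mu> u" "\<And>x. u x \<ge> 0" and nz: "\<not> (AE x in lebesgue. u x = 0)"
  shows "AE x in lebesgue. x \<in> \<Omega> \<longrightarrow> u x > 0"
proof (rule strong_maximum_principle[OF _ u(2) nz])
  show "u \<in> W" using u by (simp add: weak_solution_def)
  fix v assume v: "v \<in> W" "\<And>x. v x \<ge> 0"
  have "wform u v \<ge> 0"
    unfolding wform_def using v(2) u(2) by (intro integral_nonneg_AE) (simp add: psi_nonneg)
  then show "bform u v \<ge> 0"
    using u v weak_solution_pos[OF u(1) nz] by (simp add: weak_solution_def)
qed

text \<open>The equation is tested with w^p / (u + \<delta>)^(p-1). Since u > 0 almost everywhere in
  \<Omega>, \<open>psi p (u x) * \<eta> n x\<close> tends to w^p as \<delta> tends to 0, and it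
  never exceeds w^p, so dominated convergence applies.\<close>

lemma nonneg_weak_solution_le:
  assumes u: "weak_solution \<mu> u" "\<And>x. u x \<ge> 0" and nz: "\<not> (AE x in lebesgue. u x = 0)"
    and w: "w \<in> W" "\<And>x. w x \<ge> 0" "\<And>x. w x \<le> M" and int: "integrable lebesgue (\<lambda>x. wt x * \<bar>w x\<bar> powr p)"
  shows "\<mu> * wpow w \<le> E w"
proof -
  have uW: "u \<in> W" using u by (simp add: weak_solution_def)
  define \<delta> where "\<delta> n = inverse (real (Suc n))" for n
  have \<delta>: "\<delta> n > 0" for n by (simp add: \<delta>_def)
  define \<eta> where "\<eta> n x = w x powr p / (u x + \<delta> n) powr (p - 1)" for n x
  have \<eta>: "\<eta> n \<in> W" for n
    unfolding \<eta>_def[abs_def] by (rule picone_test_in_W0[OF p1 uW u(2) w \<delta>])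
  note [measurable] = W_D(1)[OF uW] W_D(1)[OF w(1)] W_D(1)[OF \<eta>]
  have "(\<lambda>n. LINT x|lebesgue. wt x * (psi p (u x) * \<eta> n x)) \<longlonglongrightarrow> (LINT x|lebesgue. wt x * \<bar>w x\<bar> powr p)"
  proof (rule integral_dominated_convergence[OF _ _ int])
    show "AE x in lebesgue. (\<lambda>n. wt x * (psi p (u x) * \<eta> n x)) \<longlonglongrightarrow> wt x * \<bar>w x\<bar> powr p"
      using nonneg_weak_solution_pos[OF u nz]
    proof eventually_elim
      case (elim x)
      show ?case
      proof (cases "x \<in> \<Omega>")
        case True
        then have ux: "u x > 0" using elim by simp
        have "\<delta> \<longlonglongrightarrow> 0" unfolding \<delta>_def[abs_def] by (rule LIMSEQ_inverse_real_of_nat)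
        then have "(\<lambda>n. psi p (u x) * \<eta> n x) \<longlonglongrightarrow> psi p (u x) * (w x powr p / (u x + 0) powr (p - 1))"
          unfolding \<eta>_def using ux by (intro tendsto_intros) auto
        also have "psi p (u x) * (w x powr p / (u x + 0) powr (p - 1)) = \<bar>w x\<bar> powr p"
          using ux w(2)[of x] by (simp add: psi_nonneg)
        finally show ?thesis by (intro tendsto_intros)
      qed (simp add: wt_def)
    qed
    show "AE x in lebesgue. norm (wt x * (psi p (u x) * \<eta> n x)) \<le> wt x * \<bar>w x\<bar> powr p" for n
    proof (rule AE_I2)
      fix x
      show "norm (wt x * (psi p (u x) * \<eta> n x)) \<le> wt x * \<bar>w x\<bar> powr p"
      proof -
        have nn: "0 \<le> psi p (u x) * \<eta> n x" "psi p (u x) * \<eta> n x \<le> \<bar>w x\<bar> powr p"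
          using psi_picone_test_bound[OF p1 u(2) \<delta>, of x "w x"] w(2)[of x] by (auto simp: \<eta>_def)
        then have "norm (wt x * (psi p (u x) * \<eta> n x)) = wt x * (psi p (u x) * \<eta> n x)"
          unfolding real_norm_def by (intro abs_of_nonneg mult_nonneg_nonneg[OF wt_nonneg])
        with nn show ?thesis by (simp add: mult_left_mono)
      qed
    qed
  qed measurable
  then have "(\<lambda>n. \<mu> * wform u (\<eta> n)) \<longlonglongrightarrow> \<mu> * wpow w"
    unfolding wform_def wpow_def by (intro tendsto_intros)
  moreover have "\<mu> * wform u (\<eta> n) \<le> E w" for n
  proof -
    have "\<mu> * wform u (\<eta> n) = bform u (\<eta> n)" using u(1) \<eta> by (simp add: weak_solution_def)
    also have "\<dots> \<le> E w" unfolding \<eta>_def[abs_def] by (rule bform_picone_le[OF uW u(2) w \<delta>])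
    finally show ?thesis .
  qed
  ultimately show ?thesis by (intro LIMSEQ_le_const2) auto
qed

text \<open>The previous lemma makes \<mu> a lower bound for the Rayleigh quotients of bounded
  nonnegative functions; it has to be extended to all competitors.\<close>

lemma nonneg_weak_solution_first:
  assumes u: "weak_solution \<mu> u" "\<And>x. u x \<ge> 0" and nz: "\<not> (AE x in lebesgue. u x = 0)"
  shows "\<mu> = lambda1 s p \<Omega> V"
proof (rule antisym)
  have le: "\<mu> * wpow w \<le> E w" if w: "w \<in> W" and pos: "wpow w > 0" for w
  proof -
    note [measurable] = W_D(1)[OF w]
    note int = wpow_pos_integrable[OF pos]
    \<comment> \<open>Truncating |w| at height n is a contraction fixing 0, so it does not raise the
      energy, while the weighted integrals converge to that of w.\<close>
    define v where "v n x = min \<bar>w x\<bar> (real n)" for n x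
    have contr: "\<bar>min \<bar>a\<bar> (real n) - min \<bar>b\<bar> (real n)\<bar> \<le> \<bar>a - b\<bar>" for a b n by linarith
    have v: "v n \<in> W" for n
      unfolding v_def[abs_def] by (rule W0_lipschitz_image[OF w p_ge1, where F = "\<lambda>t. min \<bar>t\<bar> (real n)"]) (use contr in auto)
    note [measurable] = W_D(1)[OF v]
    have dom: "norm (wt x * \<bar>v n x\<bar> powr p) \<le> wt x * \<bar>w x\<bar> powr p" for x n
      using p1 by (auto simp: v_def abs_mult intro!: mult_left_mono powr_mono2)
    have vint: "integrable lebesgue (\<lambda>x. wt x * \<bar>v n x\<bar> powr p)" for n
      by (rule Bochner_Integration.integrable_bound[OF int]) (use dom in \<open>auto simp: abs_mult\<close>)
    have "(\<lambda>n. wpow (v n)) \<longlonglongrightarrow> wpow w"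
      unfolding wpow_def
    proof (rule integral_dominated_convergence[OF _ _ int])
      show "AE x in lebesgue. (\<lambda>n. wt x * \<bar>v n x\<bar> powr p) \<longlonglongrightarrow> wt x * \<bar>w x\<bar> powr p"
      proof (rule AE_I2)
        fix x
        have "eventually (\<lambda>n. wt x * \<bar>v n x\<bar> powr p = wt x * \<bar>w x\<bar> powr p) sequentially"
          using eventually_ge_at_top[of "nat \<lceil>\<bar>w x\<bar>\<rceil>"]
          by eventually_elim (simp add: v_def min_absorb1 nat_ceiling_le_eq)
        then show "(\<lambda>n. wt x * \<bar>v n x\<bar> powr p) \<longlonglongrightarrow> wt x * \<bar>w x\<bar> powr p"
          by (rule tendsto_eventually)
      qed
    qed (use dom in auto)
    moreover have "\<mu> * wpow (v n) \<le> E w" for n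
    proof -
      have "\<mu> * wpow (v n) \<le> E (v n)"
        by (rule nonneg_weak_solution_le[OF u nz v _ _ vint, where M = "real n"]) (auto simp: v_def)
      also have "\<dots> \<le> E w"
        unfolding v_def[abs_def] by (rule energy_contraction[OF w, where F = "\<lambda>t. min \<bar>t\<bar> (real n)"]) (use contr in auto)
      finally show ?thesis .
    qed
    ultimately show ?thesis by (intro LIMSEQ_le_const2[OF tendsto_mult_left]) auto
  qed
  show "\<mu> \<le> lambda1 s p \<Omega> V"
    unfolding lambda1_eq
  proof (rule cInf_greatest)
    show "quotients \<noteq> {}"
      using weak_solution_pos(2)[OF u(1) nz] u(1) by (auto simp: quotients_def weak_solution_def)
  qed (use le in \<open>auto simp: quotients_def field_simps\<close>)
  show "lambda1 s p \<Omega> V \<le> \<mu>" by (rule lambda1_le_weak_solution[OF u(1) nz])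
qed

lemma higher_eigenfunction_sign_change:
  assumes u: "weak_solution \<mu> u" and nz: "\<not> (AE x in lebesgue. u x = 0)" and \<mu>: "\<mu> \<noteq> lambda1 s p \<Omega> V"
  shows "\<not> (AE x in lebesgue. max (- u x) 0 = 0)"
proof
  assume ae: "AE x in lebesgue. max (- u x) 0 = 0"
  have uW: "u \<in> W" using u by (simp add: weak_solution_def)
  have eq: "AE x in lebesgue. u x = \<bar>u x\<bar>"
    using ae by eventually_elim (auto simp: max_def split: if_splits)
  have "weak_solution \<mu> (\<lambda>x. \<bar>u x\<bar>)"
    by (rule weak_solution_cong[OF u W_abs[OF uW] eq])
  then have "\<mu> = lambda1 s p \<Omega> V"
    by (rule nonneg_weak_solution_first) (use nz in auto)
  with \<mu> show False by simp
qed

subsection \<open>The second variational level\<close>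

text \<open>Continuity in norm bounds the energy near each \<omega> by 2^p (1 + E (f \<omega>)), and
  finitely many neighbourhoods cover the circle. Both facts are required for the real-valued
  \<open>SUP\<close> and \<open>INF\<close> in \<open>lambda2\<close> to behave as bounds.\<close>

lemma C1_energy_bdd:
  assumes f: "f \<in> C1 s p \<Omega> V"
  shows "bdd_above (E ` f ` sphere 0 1)" "0 \<le> (SUP u \<in> f ` sphere 0 1. E u)"
proof -
  have fW: "f \<omega> \<in> W" if "\<omega> \<in> sphere 0 1" for \<omega>
    using f that by (auto simp: C1_def S_V_def)
  have "\<exists>\<delta>>0. \<forall>\<theta>\<in>sphere 0 1. dist \<theta> \<omega> < \<delta> \<longrightarrow> E (f \<theta>) \<le> 2 powr p * (1 + E (f \<omega>))" if \<omega>: "\<omega> \<in> sphere 0 1" for \<omega>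
  proof -
    have "((\<lambda>\<theta>. W_norm s p (\<lambda>x. f \<theta> x - f \<omega> x)) \<longlongrightarrow> 0) (at \<omega> within sphere 0 1)"
      using f \<omega> by (auto simp: C1_def)
    then have "eventually (\<lambda>\<theta>. W_norm s p (\<lambda>x. f \<theta> x - f \<omega> x) < 1) (at \<omega> within sphere 0 1)"
      by (rule order_tendstoD(2)) simp
    then obtain \<delta> where \<delta>: "\<delta> > 0" "\<And>\<theta>. \<theta> \<in> sphere 0 1 \<Longrightarrow> \<theta> \<noteq> \<omega> \<Longrightarrow> dist \<theta> \<omega> < \<delta> \<Longrightarrow> W_norm s p (\<lambda>x. f \<theta> x - f \<omega> x) < 1"
      by (auto simp: eventually_at)
    have "E (f \<theta>) \<le> 2 powr p * (1 + E (f \<omega>))" if \<theta>: "\<theta> \<in> sphere 0 1" "dist \<theta> \<omega> < \<delta>" for \<theta>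
    proof (cases "\<theta> = \<omega>")
      case True
      have "1 \<le> 2 powr p" using p1 by (intro ge_one_powr_ge_zero) auto
      then have "1 * E (f \<omega>) \<le> 2 powr p * (1 + E (f \<omega>))"
        using energy_nonneg[OF fW[OF \<omega>]] by (intro mult_mono) auto
      then show ?thesis using True by simp
    next
      case False
      define d where "d x = f \<theta> x - f \<omega> x" for x
      have d: "d \<in> W" using W_lin[OF fW[OF \<theta>(1)] fW[OF \<omega>], of 1 "- 1"] by (simp add: d_def[abs_def])
      have "W_norm s p d < 1" using \<delta>(2)[OF \<theta>(1) False \<theta>(2)] by (simp add: d_def[abs_def])
      then have "E d \<le> 1"
        using ge_one_powr_ge_zero[of "E d" "1 / p"] p1 by (force simp: W_norm_def)
      have "E (f \<theta>) = E (\<lambda>x. 1 * d x + 1 * f \<omega> x)" by (simp add: d_def)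
      also have "\<dots> \<le> 2 powr p * (E d + E (f \<omega>))"
        using energy_le_twice[OF d fW[OF \<omega>], of 1 1] by simp
      also have "\<dots> \<le> 2 powr p * (1 + E (f \<omega>))"
        using \<open>E d \<le> 1\<close> by (intro mult_left_mono) auto
      finally show ?thesis .
    qed
    then show ?thesis using \<delta>(1) by blast
  qed
  then obtain \<delta> where \<delta>: "\<And>\<omega>. \<omega> \<in> sphere 0 1 \<Longrightarrow> \<delta> \<omega> > 0"
    "\<And>\<omega> \<theta>. \<omega> \<in> sphere 0 1 \<Longrightarrow> \<theta> \<in> sphere 0 1 \<Longrightarrow> dist \<theta> \<omega> < \<delta> \<omega> \<Longrightarrow> E (f \<theta>) \<le> 2 powr p * (1 + E (f \<omega>))"
    by metis
  have "compact (sphere (0::complex) 1)" by simp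
  then obtain D where D: "D \<subseteq> sphere 0 1" "finite D" "sphere 0 1 \<subseteq> (\<Union>\<omega>\<in>D. ball \<omega> (\<delta> \<omega>))"
  proof (rule compactE_image[where f = "\<lambda>\<omega>. ball \<omega> (\<delta> \<omega>)" and C = "sphere 0 1"])
    show "sphere 0 1 \<subseteq> (\<Union>\<omega>\<in>sphere 0 1. ball \<omega> (\<delta> \<omega>))"
      using \<delta>(1) by (intro subsetI UN_I) auto
  qed auto
  show bdd: "bdd_above (E ` f ` sphere 0 1)"
  proof (rule bdd_aboveI)
    fix y assume "y \<in> E ` f ` sphere 0 1"
    then obtain \<theta> where \<theta>: "\<theta> \<in> sphere 0 1" "y = E (f \<theta>)" by auto
    then obtain \<omega> where \<omega>: "\<omega> \<in> D" "dist \<theta> \<omega> < \<delta> \<omega>" using D(3) by (force simp: dist_commute)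
    have "y \<le> 2 powr p * (1 + E (f \<omega>))"
      unfolding \<theta>(2) by (rule \<delta>(2)) (use D(1) \<theta> \<omega> in auto)
    also have "\<dots> \<le> (\<Sum>\<omega>\<in>D. 2 powr p * (1 + E (f \<omega>)))"
      using D(1,2) \<omega>(1) energy_nonneg[OF fW] by (intro member_le_sum) (auto intro!: mult_nonneg_nonneg add_nonneg_nonneg)
    finally show "y \<le> (\<Sum>\<omega>\<in>D. 2 powr p * (1 + E (f \<omega>)))" .
  qed
  have one: "(1::complex) \<in> sphere 0 1" by simp
  have "0 \<le> E (f 1)" by (rule energy_nonneg[OF fW[OF one]])
  also have "\<dots> \<le> (SUP u \<in> f ` sphere 0 1. E u)"
    using bdd one by (intro cSUP_upper) auto
  finally show "0 \<le> (SUP u \<in> f ` sphere 0 1. E u)" .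
qed

lemma lambda2_le:
  assumes f: "f \<in> C1 s p \<Omega> V" and le: "\<And>\<omega>. \<omega> \<in> sphere 0 1 \<Longrightarrow> E (f \<omega>) \<le> c"
  shows "lambda2 s p \<Omega> V \<le> c"
proof -
  have "lambda2 s p \<Omega> V \<le> (SUP u \<in> f ` sphere 0 1. E u)"
    unfolding lambda2_def
    by (rule cINF_lower[OF _ f]) (auto intro!: bdd_belowI2[where m = 0] C1_energy_bdd)
  also have "\<dots> \<le> c"
    by (rule cSUP_least) (use le in auto)
  finally show ?thesis .
qed

lemma lambda2_le_sign_changing:
  assumes u: "weak_solution \<mu> u"
    and nzP: "\<not> (AE x in lebesgue. max (u x) 0 = 0)" and nzN: "\<not> (AE x in lebesgue. max (- u x) 0 = 0)"
  shows "lambda2 s p \<Omega> V \<le> \<mu>"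
proof -
  define P where "P x = max (u x) 0" for x
  define N where "N x = max (- u x) 0" for x
  have W: "u \<in> W" using u by (simp add: weak_solution_def)
  have P: "P \<in> W" and N: "N \<in> W" using W_pos[OF W] W_neg[OF W] by (auto simp: P_def[abs_def] N_def[abs_def])
  have nz: "\<not> (AE x in lebesgue. u x = 0)"
  proof
    assume "AE x in lebesgue. u x = 0"
    then have "AE x in lebesgue. max (u x) 0 = 0" by eventually_elim simp
    with nzP show False by simp
  qed
  note \<mu> = weak_solution_pos[OF u nz]
  note int = wpow_pos_integrable[OF \<mu>(2)]
  note parts = weak_solution_two_parts[OF u int, folded P_def N_def]
  define A where "A = wpow P"
  define B where "B = wpow N"
  \<comment> \<open>The choices (1, 0) and (0, 1) of (a, b) isolate the two parts; since their
    energies are positive, so are their weighted integrals \<open>A\<close> and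
    \<open>B\<close>.\<close>
  have "E P \<le> \<mu> * A" "E N \<le> \<mu> * B"
    using parts(1)[of 1 0] parts(1)[of 0 1] p1 by (auto simp: A_def B_def)
  then have "\<mu> * A > 0" "\<mu> * B > 0"
    using energy_pos[OF P] energy_pos[OF N] nzP nzN by (force simp: P_def[abs_def] N_def[abs_def])+
  then have AB: "A > 0" "B > 0" using \<mu>(1) by (auto simp: zero_less_mult_iff)
  \<comment> \<open>The weighted p-th power of Re \<omega> u^+ + Im \<omega> u^-. It is even in
    \<omega>, so dividing by its p-th root keeps the loop odd, and it is positive on the circle
    because \<open>A\<close> and \<open>B\<close> are.\<close>
  define c where "c \<omega> = \<bar>Re \<omega>\<bar> powr p * A + \<bar>Im \<omega>\<bar> powr p * B" for \<omega>
  have c: "c \<omega> > 0" if "\<omega> \<in> sphere 0 1" for \<omega>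
  proof -
    have "Re \<omega> \<noteq> 0 \<or> Im \<omega> \<noteq> 0" using that complex_eq_iff[of \<omega> 0] by auto
    then show ?thesis using AB by (auto simp: c_def intro: add_pos_nonneg add_nonneg_pos)
  qed
  define a where "a \<omega> = Re \<omega> / c \<omega> powr (1 / p)" for \<omega>
  define b where "b \<omega> = Im \<omega> / c \<omega> powr (1 / p)" for \<omega>
  define f where "f \<omega> = (\<lambda>x. a \<omega> * P x + b \<omega> * N x)" for \<omega>
  have fW: "f \<omega> \<in> W" for \<omega> unfolding f_def by (rule W_lin[OF P N])
  have ab1: "\<bar>a \<omega>\<bar> powr p * A + \<bar>b \<omega>\<bar> powr p * B = 1" if "\<omega> \<in> sphere 0 1" for \<omega>
  proof -
    have h: "\<bar>t / c \<omega> powr (1 / p)\<bar> powr p = \<bar>t\<bar> powr p / c \<omega>" for t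
      using c[OF that] p1 by (simp add: powr_divide powr_powr abs_divide)
    have "\<bar>a \<omega>\<bar> powr p * A + \<bar>b \<omega>\<bar> powr p * B = (\<bar>Re \<omega>\<bar> powr p * A + \<bar>Im \<omega>\<bar> powr p * B) / c \<omega>"
      unfolding a_def b_def h by (simp add: add_divide_distrib)
    also have "\<dots> = c \<omega> / c \<omega>" by (simp only: c_def)
    finally show ?thesis using c[OF that] by simp
  qed
  have "f \<in> C1 s p \<Omega> V"
    unfolding C1_def mem_Collect_eq
  proof (intro conjI ballI)
    fix \<omega> :: complex assume \<omega>: "\<omega> \<in> sphere 0 1"
    show "f \<omega> \<in> S_V s p \<Omega> V"
      using fW parts(2)[of "a \<omega>" "b \<omega>"] ab1[OF \<omega>] by (auto simp: S_V_def weighted_pow_eq f_def A_def B_def)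
    have "c (- \<omega>) = c \<omega>" by (simp add: c_def)
    then show "AE x in lebesgue. f (- \<omega>) x = - f \<omega> x"
      by (simp add: f_def a_def b_def algebra_simps)
    have ca: "(a \<longlongrightarrow> a \<omega>) (at \<omega> within sphere 0 1)" and cb: "(b \<longlongrightarrow> b \<omega>) (at \<omega> within sphere 0 1)"
    proof -
      have cc: "(c \<longlongrightarrow> c \<omega>) (at \<omega> within sphere 0 1)"
        unfolding c_def using p1 by (intro tendsto_intros tendsto_powr') auto
      have cp: "((\<lambda>\<theta>. c \<theta> powr (1 / p)) \<longlongrightarrow> c \<omega> powr (1 / p)) (at \<omega> within sphere 0 1)"
        using c[OF \<omega>] by (intro tendsto_powr[OF cc tendsto_const]) auto
      show "(a \<longlongrightarrow> a \<omega>) (at \<omega> within sphere 0 1)" "(b \<longlongrightarrow> b \<omega>) (at \<omega> within sphere 0 1)"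
        unfolding a_def b_def using c[OF \<omega>] by (intro tendsto_divide cp tendsto_intros; simp)+
    qed
    have lim: "((\<lambda>\<theta>. 2 powr p * (\<bar>a \<theta> - a \<omega>\<bar> powr p * E P + \<bar>b \<theta> - b \<omega>\<bar> powr p * E N)) \<longlongrightarrow>
        2 powr p * (\<bar>a \<omega> - a \<omega>\<bar> powr p * E P + \<bar>b \<omega> - b \<omega>\<bar> powr p * E N)) (at \<omega> within sphere 0 1)"
      using p1 by (intro tendsto_intros tendsto_powr' ca cb) auto
    have eq: "(\<lambda>x. f \<theta> x - f \<omega> x) = (\<lambda>x. (a \<theta> - a \<omega>) * P x + (b \<theta> - b \<omega>) * N x)" for \<theta>
      by (auto simp: f_def algebra_simps)
    have "((\<lambda>\<theta>. E (\<lambda>x. f \<theta> x - f \<omega> x)) \<longlongrightarrow> 0) (at \<omega> within sphere 0 1)"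
    proof (rule tendsto_sandwich[OF _ _ tendsto_const])
      show "\<forall>\<^sub>F \<theta> in at \<omega> within sphere 0 1. 0 \<le> E (\<lambda>x. f \<theta> x - f \<omega> x)"
        unfolding eq by (intro always_eventually allI energy_nonneg W_lin P N)
      show "\<forall>\<^sub>F \<theta> in at \<omega> within sphere 0 1. E (\<lambda>x. f \<theta> x - f \<omega> x)
          \<le> 2 powr p * (\<bar>a \<theta> - a \<omega>\<bar> powr p * E P + \<bar>b \<theta> - b \<omega>\<bar> powr p * E N)"
        unfolding eq by (intro always_eventually allI energy_le_twice P N)
    qed (use lim p1 in simp)
    then have "((\<lambda>\<theta>. E (\<lambda>x. f \<theta> x - f \<omega> x) powr (1 / p)) \<longlongrightarrow> 0 powr (1 / p)) (at \<omega> within sphere 0 1)"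
      using p1 unfolding eq by (intro tendsto_powr'[OF _ tendsto_const]) (auto intro!: always_eventually energy_nonneg W_lin P N)
    then show "((\<lambda>\<theta>. W_norm s p (\<lambda>x. f \<theta> x - f \<omega> x)) \<longlongrightarrow> 0) (at \<omega> within sphere 0 1)"
      using p1 by (simp add: W_norm_def)
  qed
  then show ?thesis
  proof (rule lambda2_le)
    fix \<omega> :: complex assume \<omega>: "\<omega> \<in> sphere 0 1"
    show "E (f \<omega>) \<le> \<mu>"
      using parts(1)[of "a \<omega>" "b \<omega>"] ab1[OF \<omega>] by (simp add: f_def A_def B_def)
  qed
qed

lemma lambda2_le_eigenvalue:
  assumes "is_eigenvalue s p \<Omega> V \<mu>" "\<mu> > lambda1 s p \<Omega> V"
  shows "lambda2 s p \<Omega> V \<le> \<mu>"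
proof -
  obtain u where u: "weak_solution \<mu> u" and nz: "\<not> (AE x in lebesgue. u x = 0)"
    using assms(1) is_eigenvalue_iff by blast
  show ?thesis
  proof (rule lambda2_le_sign_changing[OF u])
    show "\<not> (AE x in lebesgue. max (- u x) 0 = 0)"
      by (rule higher_eigenfunction_sign_change[OF u nz]) (use assms(2) in simp)
    have "\<not> (AE x in lebesgue. max (- (- u x)) 0 = 0)"
      by (rule higher_eigenfunction_sign_change[OF weak_solution_uminus[OF u]]) (use assms(2) nz in auto)
    then show "\<not> (AE x in lebesgue. max (u x) 0 = 0)" by simp
  qed
qed

end

subsection \<open>Dyadic averages\<close>

text \<open>The half-open dyadic cube of side 2^-k containing x. Coding it by equality of floors
  makes membership symmetric in the two points, which is what Fubini uses later.\<close>

definition cell :: "nat \<Rightarrow> 'a::euclidean_space \<Rightarrow> 'a set" where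
  "cell k x = {y. \<forall>b\<in>Basis. \<lfloor>2 ^ k * (y \<bullet> b)\<rfloor> = \<lfloor>2 ^ k * (x \<bullet> b)\<rfloor>}"

lemma cell_commute: "y \<in> cell k x \<longleftrightarrow> x \<in> cell k y"
  by (auto simp: cell_def)

lemma cell_pred_measurable [measurable]:
  "Measurable.pred (borel \<Otimes>\<^sub>M borel) (\<lambda>z. snd z \<in> cell k (fst z :: 'a::euclidean_space))"
  unfolding cell_def mem_Collect_eq by measurable

lemma cell_sets [measurable]: "cell k (x :: 'a::euclidean_space) \<in> sets borel"
  unfolding cell_def by measurable

text \<open>A cell is determined by finitely many integers. Countability allows one subsequence to
  be extracted for all cells simultaneously.\<close>

lemma countable_range_cell: "countable (range (cell k :: 'a::euclidean_space \<Rightarrow> 'a set))"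
proof -
  let ?F = "PiE (Basis :: 'a set) (\<lambda>_. UNIV :: int set)"
  have "range (cell k) \<subseteq> (\<lambda>f. {y. \<forall>b\<in>Basis. \<lfloor>2 ^ k * (y \<bullet> b)\<rfloor> = f b}) ` ?F"
  proof
    fix C assume "C \<in> range (cell k :: 'a \<Rightarrow> 'a set)"
    then obtain x :: 'a where "C = cell k x" by auto
    then have "C = {y. \<forall>b\<in>Basis. \<lfloor>2 ^ k * (y \<bullet> b)\<rfloor> = restrict (\<lambda>b. \<lfloor>2 ^ k * (x \<bullet> b)\<rfloor>) Basis b}"
      by (auto simp: cell_def)
    then show "C \<in> (\<lambda>f. {y. \<forall>b\<in>Basis. \<lfloor>2 ^ k * (y \<bullet> b)\<rfloor> = f b}) ` ?F"
      by (intro image_eqI[where x = "restrict (\<lambda>b. \<lfloor>2 ^ k * (x \<bullet> b)\<rfloor>) Basis"]) simp_all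
  qed
  moreover have "countable ?F" by (rule countable_PiE) auto
  ultimately show ?thesis by (meson countable_image countable_subset)
qed

lemma norm_diff_le_cell:
  fixes x y :: "'a::euclidean_space"
  assumes "y \<in> cell k x"
  shows "norm (x - y) \<le> real DIM('a) / 2 ^ k"
proof -
  have "norm (x - y) \<le> (\<Sum>b\<in>Basis. \<bar>(x - y) \<bullet> b\<bar>)" by (rule norm_le_l1)
  also have "\<dots> \<le> (\<Sum>b\<in>(Basis::'a set). 1 / 2 ^ k)"
  proof (rule sum_mono)
    fix b :: 'a assume "b \<in> Basis"
    then have "\<lfloor>2 ^ k * (y \<bullet> b)\<rfloor> = \<lfloor>2 ^ k * (x \<bullet> b)\<rfloor>" using assms by (simp add: cell_def)
    then have "\<bar>2 ^ k * (x \<bullet> b) - 2 ^ k * (y \<bullet> b)\<bar> \<le> 1" by linarith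
    then have "2 ^ k * \<bar>(x - y) \<bullet> b\<bar> \<le> 1"
      by (simp add: inner_diff_left abs_mult flip: right_diff_distrib)
    then show "\<bar>(x - y) \<bullet> b\<bar> \<le> 1 / 2 ^ k" by (simp add: field_simps)
  qed
  finally show ?thesis by simp
qed

text \<open>The cell lies between the open and the closed box with the same corners, which have
  equal volume.\<close>

lemma emeasure_cell:
  "emeasure lborel (cell k (x :: 'a::euclidean_space)) = ennreal ((1 / 2 ^ k) ^ DIM('a))"
proof -
  define a where "a = (\<Sum>b\<in>Basis. (of_int \<lfloor>2 ^ k * (x \<bullet> b)\<rfloor> / 2 ^ k) *\<^sub>R b)"
  define e where "e = (\<Sum>b\<in>Basis. ((of_int \<lfloor>2 ^ k * (x \<bullet> b)\<rfloor> + 1) / 2 ^ k) *\<^sub>R b)"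
  have a: "a \<bullet> b = of_int \<lfloor>2 ^ k * (x \<bullet> b)\<rfloor> / 2 ^ k" if "b \<in> Basis" for b
    using that by (simp add: a_def)
  have e: "e \<bullet> b = (of_int \<lfloor>2 ^ k * (x \<bullet> b)\<rfloor> + 1) / 2 ^ k" if "b \<in> Basis" for b
    using that by (simp add: e_def)
  have le: "a \<bullet> b \<le> e \<bullet> b" if "b \<in> Basis" for b
    using that by (simp add: a e divide_right_mono)
  have vol: "(\<Prod>b\<in>Basis. (e - a) \<bullet> b) = (1 / 2 ^ k) ^ DIM('a)"
    by (simp add: inner_diff_left a e flip: diff_divide_distrib)
  have sub1: "box a e \<subseteq> cell k x"
  proof
    fix y assume y: "y \<in> box a e"
    show "y \<in> cell k x" unfolding cell_def mem_Collect_eq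
    proof
      fix b :: 'a assume b: "b \<in> Basis"
      then have "a \<bullet> b < y \<bullet> b" "y \<bullet> b < e \<bullet> b" using y by (auto simp: mem_box)
      then have "of_int \<lfloor>2 ^ k * (x \<bullet> b)\<rfloor> < 2 ^ k * (y \<bullet> b)" "2 ^ k * (y \<bullet> b) < of_int \<lfloor>2 ^ k * (x \<bullet> b)\<rfloor> + 1"
        using b by (auto simp: a e field_simps)
      then show "\<lfloor>2 ^ k * (y \<bullet> b)\<rfloor> = \<lfloor>2 ^ k * (x \<bullet> b)\<rfloor>" by (intro floor_unique) auto
    qed
  qed
  have sub2: "cell k x \<subseteq> cbox a e"
  proof
    fix y assume y: "y \<in> cell k x"
    show "y \<in> cbox a e" unfolding mem_box
    proof
      fix b :: 'a assume b: "b \<in> Basis"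
      then have "\<lfloor>2 ^ k * (y \<bullet> b)\<rfloor> = \<lfloor>2 ^ k * (x \<bullet> b)\<rfloor>" using y by (auto simp: cell_def)
      then have "of_int \<lfloor>2 ^ k * (x \<bullet> b)\<rfloor> \<le> 2 ^ k * (y \<bullet> b)" "2 ^ k * (y \<bullet> b) \<le> of_int \<lfloor>2 ^ k * (x \<bullet> b)\<rfloor> + 1"
        by linarith+
      then show "a \<bullet> b \<le> y \<bullet> b \<and> y \<bullet> b \<le> e \<bullet> b" using b by (auto simp: a e field_simps)
    qed
  qed
  have "emeasure lborel (box a e) \<le> emeasure lborel (cell k x)" "emeasure lborel (cell k x) \<le> emeasure lborel (cbox a e)"
    using sub1 sub2 by (auto intro!: emeasure_mono)
  then show ?thesis using le vol by (simp add: emeasure_lborel_box emeasure_lborel_cbox)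
qed

section \<open>Jensen's inequality and averages over cells\<close>

lemma abs_powr_above_tangent:
  fixes a t p :: real
  assumes "p > 1"
  shows "\<bar>t\<bar> powr p + p * psi p t * (a - t) \<le> \<bar>a\<bar> powr p"
proof -
  have "convex_on UNIV (\<lambda>t::real. \<bar>t\<bar> powr p)"
    using abs_powr_convex[of p] assms by (intro convex_onI) auto
  then have "p * psi p t * (a - t) \<le> \<bar>a\<bar> powr p - \<bar>t\<bar> powr p"
    by (rule convex_on_imp_above_tangent) (auto intro: has_real_derivative_abs_powr assms)
  then show ?thesis by simp
qed

lemma integrable_on_finite_if_powr:
  fixes f :: "'b \<Rightarrow> real"
  assumes p: "p \<ge> 1" and [measurable]: "A \<in> sets M" "f \<in> borel_measurable M" and fin: "emeasure M A < \<infinity>"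
    and int: "(\<integral>\<^sup>+ y. indicator A y * ennreal (\<bar>f y\<bar> powr p) \<partial>M) < \<infinity>"
  shows "integrable M (\<lambda>y. indicator A y * f y)" "integrable M (\<lambda>y. indicator A y * \<bar>f y\<bar> powr p)"
proof -
  have "(\<integral>\<^sup>+ y. ennreal (norm (indicator A y * \<bar>f y\<bar> powr p)) \<partial>M) = (\<integral>\<^sup>+ y. indicator A y * ennreal (\<bar>f y\<bar> powr p) \<partial>M)"
    by (intro nn_integral_cong) (auto simp: indicator_def)
  then show i: "integrable M (\<lambda>y. indicator A y * \<bar>f y\<bar> powr p)"
    using int by (intro integrableI_bounded) auto
  show "integrable M (\<lambda>y. indicator A y * f y)"
  proof (rule Bochner_Integration.integrable_bound)
    show "integrable M (\<lambda>y. indicator A y + indicator A y * \<bar>f y\<bar> powr p)"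
      using i fin by (intro Bochner_Integration.integrable_add integrable_real_indicator) auto
    have "\<bar>t\<bar> \<le> 1 + \<bar>t\<bar> powr p" for t :: real
    proof (cases "\<bar>t\<bar> \<le> 1")
      case False
      then have "\<bar>t\<bar> powr 1 \<le> \<bar>t\<bar> powr p" using p by (intro powr_mono) auto
      then show ?thesis by simp
    qed (simp add: add_increasing2)
    then show "AE y in M. norm (indicator A y * f y) \<le> norm (indicator A y + indicator A y * \<bar>f y\<bar> powr p)"
      by (intro AE_I2) (auto simp: indicator_def)
  qed measurable
qed

text \<open>Jensen's inequality through the tangent line at the average t: the linear term
  integrates to 0. Stated with nonnegative integrals, so that an infinite right-hand side is
  allowed.\<close>

lemma powr_average_le:
  fixes f :: "'b \<Rightarrow> real"
  assumes p: "p > 1" and [measurable]: "A \<in> sets M" "f \<in> borel_measurable M" and m: "emeasure M A = ennreal m" "m > 0"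
  shows "ennreal (\<bar>(1 / m) * (LINT y|M. indicator A y * f y)\<bar> powr p)
    \<le> ennreal (1 / m) * (\<integral>\<^sup>+ y. indicator A y * ennreal (\<bar>f y\<bar> powr p) \<partial>M)"
proof (cases "(\<integral>\<^sup>+ y. indicator A y * ennreal (\<bar>f y\<bar> powr p) \<partial>M) = \<infinity>")
  case True
  then show ?thesis using m by (simp add: ennreal_mult_top)
next
  case False
  then have I: "integrable M (\<lambda>y. indicator A y * f y)" "integrable M (\<lambda>y. indicator A y * \<bar>f y\<bar> powr p)"
    using integrable_on_finite_if_powr[of p A M f] p m by (auto simp: less_top)
  define t where "t = (1 / m) * (LINT y|M. indicator A y * f y)"
  have int1: "(LINT y|M. indicator A y) = m" "integrable M (indicator A :: 'b \<Rightarrow> real)"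
    using m by (auto simp: measure_def)
  have "m * \<bar>t\<bar> powr p = (LINT y|M. \<bar>t\<bar> powr p * indicator A y + (p * psi p t) * (indicator A y * f y - t * indicator A y))"
    using I int1 m by (simp add: t_def)
  also have "\<dots> \<le> (LINT y|M. indicator A y * \<bar>f y\<bar> powr p)"
  proof (rule integral_mono)
    show "integrable M (\<lambda>y. \<bar>t\<bar> powr p * indicator A y + (p * psi p t) * (indicator A y * f y - t * indicator A y))"
      using I int1 by auto
    show "\<bar>t\<bar> powr p * indicator A y + (p * psi p t) * (indicator A y * f y - t * indicator A y) \<le> indicator A y * \<bar>f y\<bar> powr p" for y
      using abs_powr_above_tangent[OF p, of t "f y"] by (auto simp: indicator_def)
  qed (rule I)
  finally have "\<bar>t\<bar> powr p \<le> (1 / m) * (LINT y|M. indicator A y * \<bar>f y\<bar> powr p)"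
    using m by (simp add: field_simps)
  then have "ennreal (\<bar>t\<bar> powr p) \<le> ennreal ((1 / m) * (LINT y|M. indicator A y * \<bar>f y\<bar> powr p))"
    by (rule ennreal_leI)
  also have "\<dots> = ennreal (1 / m) * ennreal (LINT y|M. indicator A y * \<bar>f y\<bar> powr p)"
    using m by (intro ennreal_mult) auto
  also have "ennreal (LINT y|M. indicator A y * \<bar>f y\<bar> powr p) = (\<integral>\<^sup>+ y. ennreal (indicator A y * \<bar>f y\<bar> powr p) \<partial>M)"
    by (rule nn_integral_eq_integral[symmetric]) (use I in auto)
  also have "\<dots> = (\<integral>\<^sup>+ y. indicator A y * ennreal (\<bar>f y\<bar> powr p) \<partial>M)"
    by (intro nn_integral_cong) (auto simp: indicator_def)
  finally show ?thesis by (simp add: t_def)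
qed

definition cavg :: "nat \<Rightarrow> ('a::euclidean_space \<Rightarrow> real) \<Rightarrow> 'a \<Rightarrow> real" where
  "cavg k u x = (2 ^ k) ^ DIM('a) * (LINT y|lborel. indicator (cell k x) y * u y)"

lemma cell_indicator_measurable [measurable]:
  "(\<lambda>z. indicator (cell k (fst z)) (snd z) :: real) \<in> borel_measurable (borel \<Otimes>\<^sub>M (borel :: 'a::euclidean_space measure))"
proof -
  have "(\<lambda>z. indicator (cell k (fst z)) (snd z) :: real) = indicator {z. snd z \<in> cell k (fst z :: 'a)}"
    by (auto simp: indicator_def)
  moreover have "{z \<in> space (borel \<Otimes>\<^sub>M borel). snd z \<in> cell k (fst z :: 'a)} \<in> sets (borel \<Otimes>\<^sub>M borel)"
    by measurable
  ultimately show ?thesis by (simp add: space_pair_measure)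
qed

lemma cell_indicator_measurable_ennreal [measurable]:
  "(\<lambda>z. indicator (cell k (fst z)) (snd z) :: ennreal) \<in> borel_measurable (borel \<Otimes>\<^sub>M (borel :: 'a::euclidean_space measure))"
proof -
  have "(\<lambda>z. indicator (cell k (fst z)) (snd z) :: ennreal) = (\<lambda>z. ennreal (indicator (cell k (fst z :: 'a)) (snd z)))"
    by (auto simp: indicator_def)
  then show ?thesis by simp
qed

lemma cavg_measurable [measurable]:
  assumes [measurable]: "u \<in> borel_measurable borel"
  shows "cavg k u \<in> borel_measurable (borel :: 'a::euclidean_space measure)"
proof -
  have "(\<lambda>x. LINT y|lborel. indicator (cell k x) y * u y) \<in> borel_measurable borel"
    by (rule lborel.borel_measurable_lebesgue_integral) (simp add: case_prod_unfold)
  then show ?thesis unfolding cavg_def[abs_def] by simp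
qed

text \<open>Jensen applied to c - u. The constant c is kept free: it is later the value of u at a
  point, the average on the coarser level, or 0.\<close>

lemma powr_diff_cavg_le:
  fixes u :: "'a::euclidean_space \<Rightarrow> real"
  assumes p: "p > 1" and [measurable]: "u \<in> borel_measurable borel"
    and int: "(\<integral>\<^sup>+ y. ennreal (\<bar>u y\<bar> powr p) \<partial>lborel) < \<infinity>"
  shows "ennreal (\<bar>c - cavg k u x\<bar> powr p)
    \<le> ennreal ((2 ^ k) ^ DIM('a)) * (\<integral>\<^sup>+ y. indicator (cell k x) y * ennreal (\<bar>c - u y\<bar> powr p) \<partial>lborel)"
proof -
  define m where "m = (1 / 2 ^ k :: real) ^ DIM('a)"
  have m: "emeasure lborel (cell k x) = ennreal m" "m > 0"
    by (auto simp: emeasure_cell m_def)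
  have m': "1 / m = (2 ^ k) ^ DIM('a)" by (simp add: m_def power_one_over)
  have "(\<integral>\<^sup>+ y. indicator (cell k x) y * ennreal (\<bar>u y\<bar> powr p) \<partial>lborel) \<le> (\<integral>\<^sup>+ y. ennreal (\<bar>u y\<bar> powr p) \<partial>lborel)"
    by (intro nn_integral_mono) (auto simp: indicator_def)
  then have I: "integrable lborel (\<lambda>y. indicator (cell k x) y * u y)"
    using int m p by (intro integrable_on_finite_if_powr(1)[of p]) (auto simp: order_le_less_trans)
  have one: "integrable lborel (indicator (cell k x) :: 'a \<Rightarrow> real)" "measure lborel (cell k x) = m"
    using m by (auto simp: measure_def)
  have "(LINT y|lborel. indicator (cell k x) y * (c - u y)) = (LINT y|lborel. c * indicator (cell k x) y - indicator (cell k x) y * u y)"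
    by (simp add: algebra_simps)
  also have "\<dots> = c * m - (LINT y|lborel. indicator (cell k x) y * u y)"
    using I one by simp
  finally have "c - cavg k u x = (1 / m) * (LINT y|lborel. indicator (cell k x) y * (c - u y))"
    using m(2) by (simp add: cavg_def m'[symmetric] field_simps)
  then show ?thesis
    using powr_average_le[OF p _ _ m, of "\<lambda>y. c - u y"] by (simp add: m')
qed

subsection \<open>Chaining and the weighted embedding\<close>

definition gag_slice :: "real \<Rightarrow> real \<Rightarrow> ('a::euclidean_space \<Rightarrow> real) \<Rightarrow> 'a \<Rightarrow> ennreal" where
  "gag_slice s p u y = (\<integral>\<^sup>+ z. ennreal (gagliardo_integrand s p u (y, z)) \<partial>lborel)"

lemma gagliardo_integrand_borel [measurable]:
  fixes u :: "'a::euclidean_space \<Rightarrow> real"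
  assumes [measurable]: "u \<in> borel_measurable borel"
  shows "gagliardo_integrand s p u \<in> borel_measurable (borel \<Otimes>\<^sub>M borel)"
  unfolding gagliardo_integrand_def by measurable

lemma gag_slice_measurable [measurable]:
  fixes u :: "'a::euclidean_space \<Rightarrow> real"
  assumes [measurable]: "u \<in> borel_measurable borel"
  shows "gag_slice s p u \<in> borel_measurable borel"
  unfolding gag_slice_def[abs_def]
  by (rule lborel.borel_measurable_nn_integral) (simp add: case_prod_eta)

lemma nn_integral_gag_slice:
  fixes u :: "'a::euclidean_space \<Rightarrow> real"
  assumes [measurable]: "u \<in> borel_measurable borel"
  shows "(\<integral>\<^sup>+ y. gag_slice s p u y \<partial>lborel) = (\<integral>\<^sup>+ z. ennreal (gagliardo_integrand s p u z) \<partial>lebesgue)"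
proof -
  have "(\<integral>\<^sup>+ y. gag_slice s p u y \<partial>lborel) = (\<integral>\<^sup>+ z. ennreal (gagliardo_integrand s p u z) \<partial>(lborel \<Otimes>\<^sub>M lborel))"
    unfolding gag_slice_def by (subst lborel.nn_integral_fst[symmetric]) simp_all
  then show ?thesis by (simp add: lborel_prod nn_integral_completion)
qed

text \<open>Each z in the cell of x is within R = 2 N / 2^k of y, so |u y - u z|^p is at most R^(N +
  s p) times the Gagliardo integrand. Averaging costs 2^(k N), which leaves the gain 2^(-k s
  p).\<close>

lemma powr_diff_cavg_le_slice:
  fixes u :: "'a::euclidean_space \<Rightarrow> real"
  assumes sp: "s > 0" "p > 1" and [measurable]: "u \<in> borel_measurable borel"
    and int: "(\<integral>\<^sup>+ y. ennreal (\<bar>u y\<bar> powr p) \<partial>lborel) < \<infinity>"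
    and y: "y \<in> cell j x" "j \<ge> k"
  shows "ennreal (\<bar>u y - cavg k u x\<bar> powr p)
    \<le> ennreal ((2 * real DIM('a)) powr (real DIM('a) + s * p) * 2 powr (- (real k * (s * p)))) * gag_slice s p u y"
proof -
  define e where "e = real DIM('a) + s * p"
  define R where "R = 2 * real DIM('a) / 2 ^ k"
  have e: "e > 0" using sp by (simp add: e_def add_nonneg_pos)
  have yx: "norm (x - y) \<le> real DIM('a) / 2 ^ k"
  proof -
    have "norm (x - y) \<le> real DIM('a) / 2 ^ j" by (rule norm_diff_le_cell[OF y(1)])
    also have "\<dots> \<le> real DIM('a) / 2 ^ k"
      using y(2) by (intro divide_left_mono power_increasing) auto
    finally show ?thesis .
  qed
  have pt: "indicator (cell k x) z * ennreal (\<bar>u y - u z\<bar> powr p) \<le> ennreal (R powr e) * ennreal (gagliardo_integrand s p u (y, z))" for z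
  proof (cases "z \<in> cell k x \<and> y \<noteq> z")
    case True
    have "norm (y - z) \<le> norm (x - y) + norm (x - z)"
      by (metis add.commute dist_norm dist_triangle2 norm_minus_commute dist_triangle3)
    also have "\<dots> \<le> R" using yx norm_diff_le_cell[of z k x] True by (simp add: R_def)
    finally have "norm (y - z) powr e \<le> R powr e" using e by (intro powr_mono2) auto
    then have "norm (y - z) powr e * gagliardo_integrand s p u (y, z) \<le> R powr e * gagliardo_integrand s p u (y, z)"
      by (intro mult_right_mono) (auto simp: gagliardo_integrand_def)
    moreover have "norm (y - z) powr e * gagliardo_integrand s p u (y, z) = \<bar>u y - u z\<bar> powr p"
      using True by (simp add: gagliardo_integrand_def e_def)
    ultimately have "ennreal (\<bar>u y - u z\<bar> powr p) \<le> ennreal (R powr e * gagliardo_integrand s p u (y, z))"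
      by (intro ennreal_leI) simp
    then show ?thesis using True by (simp add: ennreal_mult' )
  qed (use sp in auto)
  have "ennreal (\<bar>u y - cavg k u x\<bar> powr p)
    \<le> ennreal ((2 ^ k) ^ DIM('a)) * (\<integral>\<^sup>+ z. indicator (cell k x) z * ennreal (\<bar>u y - u z\<bar> powr p) \<partial>lborel)"
    by (rule powr_diff_cavg_le[OF sp(2) _ int]) simp
  also have "\<dots> \<le> ennreal ((2 ^ k) ^ DIM('a)) * (\<integral>\<^sup>+ z. ennreal (R powr e) * ennreal (gagliardo_integrand s p u (y, z)) \<partial>lborel)"
    by (intro mult_left_mono nn_integral_mono pt) auto
  also have "\<dots> = ennreal ((2 ^ k) ^ DIM('a) * R powr e) * gag_slice s p u y"
    unfolding gag_slice_def by (subst nn_integral_cmult) (auto simp: ennreal_mult' mult.assoc)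
  also have "(2 ^ k) ^ DIM('a) * R powr e = (2 * real DIM('a)) powr e * 2 powr (- (real k * (s * p)))"
  proof -
    have "R powr e = (2 * real DIM('a)) powr e / 2 powr (real k * e)"
      by (simp add: R_def powr_divide powr_powr powr_realpow[symmetric])
    moreover have "(2 ^ k) ^ DIM('a) = 2 powr (real k * real DIM('a))"
      by (simp add: powr_powr powr_realpow[symmetric])
    moreover have "2 powr (real k * real DIM('a)) / 2 powr (real k * e) = 2 powr (- (real k * (s * p)))"
      by (simp add: e_def algebra_simps flip: powr_diff)
    ultimately show ?thesis by (metis (no_types, opaque_lifting) mult.commute times_divide_eq_right)
  qed
  finally show ?thesis by (simp add: e_def)
qed

text \<open>Jensen with exponent r: the average of v over a cell is at most (2^(k N))^(1/r) times
  \<Lambda>, an upper bound for the \<open>L^r\<close> norm of v.\<close>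

lemma nn_integral_cell_weight_le:
  fixes v :: "'a::euclidean_space \<Rightarrow> real"
  assumes r: "r > 1" and [measurable]: "v \<in> borel_measurable borel" and v: "\<And>x. v x \<ge> 0"
    and \<Lambda>: "(\<integral>\<^sup>+ x. ennreal (v x powr r) \<partial>lborel) \<le> ennreal (\<Lambda> powr r)" "\<Lambda> \<ge> 0"
  shows "ennreal ((2 ^ k) ^ DIM('a)) * (\<integral>\<^sup>+ x. indicator (cell k y) x * ennreal (v x) \<partial>lborel)
    \<le> ennreal (2 powr (real k * real DIM('a) / r) * \<Lambda>)"
proof -
  define m where "m = (1 / 2 ^ k :: real) ^ DIM('a)"
  have m: "emeasure lborel (cell k y) = ennreal m" "m > 0"
    by (auto simp: emeasure_cell m_def)
  have m': "1 / m = (2 ^ k) ^ DIM('a)" by (simp add: m_def power_one_over)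
  have le: "(\<integral>\<^sup>+ x. indicator (cell k y) x * ennreal (\<bar>v x\<bar> powr r) \<partial>lborel) \<le> ennreal (\<Lambda> powr r)"
    by (rule order_trans[OF nn_integral_mono \<Lambda>(1)]) (auto simp: indicator_def v)
  then have I: "integrable lborel (\<lambda>x. indicator (cell k y) x * v x)"
    using m r by (intro integrable_on_finite_if_powr(1)[of r]) (auto simp: order_le_less_trans)
  define t where "t = (1 / m) * (LINT x|lborel. indicator (cell k y) x * v x)"
  have t: "t \<ge> 0" using v m by (auto simp: t_def intro!: mult_nonneg_nonneg integral_nonneg_AE)
  have "ennreal (t powr r) \<le> ennreal (1 / m) * (\<integral>\<^sup>+ x. indicator (cell k y) x * ennreal (\<bar>v x\<bar> powr r) \<partial>lborel)"
    using powr_average_le[OF r _ _ m, of v, folded t_def] t by simp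
  also have "\<dots> \<le> ennreal (1 / m) * ennreal (\<Lambda> powr r)"
    by (intro mult_left_mono le) auto
  also have "\<dots> = ennreal ((1 / m) * \<Lambda> powr r)"
    using m by (intro ennreal_mult[symmetric]) auto
  finally have "t powr r \<le> (1 / m) * \<Lambda> powr r"
    using m by (subst (asm) ennreal_le_iff) auto
  then have "(t powr r) powr (1 / r) \<le> ((1 / m) * \<Lambda> powr r) powr (1 / r)"
    using r by (intro powr_mono2) auto
  then have "t \<le> (1 / m) powr (1 / r) * \<Lambda>"
    using r t \<Lambda>(2) unfolding powr_mult powr_powr by simp
  also have "(1 / m) powr (1 / r) = 2 powr (real k * real DIM('a) / r)"
    unfolding m' by (simp add: powr_powr powr_realpow[symmetric])
  finally have tle: "t \<le> 2 powr (real k * real DIM('a) / r) * \<Lambda>" .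
  have "(\<integral>\<^sup>+ x. indicator (cell k y) x * ennreal (v x) \<partial>lborel) = (\<integral>\<^sup>+ x. ennreal (indicator (cell k y) x * v x) \<partial>lborel)"
    by (intro nn_integral_cong) (auto simp: indicator_def)
  also have "\<dots> = ennreal (LINT x|lborel. indicator (cell k y) x * v x)"
    by (rule nn_integral_eq_integral[OF I]) (simp add: v)
  finally have "ennreal (1 / m) * (\<integral>\<^sup>+ x. indicator (cell k y) x * ennreal (v x) \<partial>lborel) = ennreal t"
    using m v by (simp add: t_def ennreal_mult' del: times_divide_eq_left)
  then show ?thesis using tle unfolding m' by (simp add: ennreal_leI)
qed

text \<open>Exchanging the integrals and using the symmetry of cells moves the averaging from h to
  v, where the bound of the previous lemma is uniform in y.\<close>

lemma nn_integral_weighted_cell_average_le: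
  fixes v :: "'a::euclidean_space \<Rightarrow> real" and h :: "'a \<Rightarrow> ennreal"
  assumes r: "r > 1" and [measurable]: "v \<in> borel_measurable borel" "h \<in> borel_measurable borel" and v: "\<And>x. v x \<ge> 0"
    and \<Lambda>: "(\<integral>\<^sup>+ x. ennreal (v x powr r) \<partial>lborel) \<le> ennreal (\<Lambda> powr r)" "\<Lambda> \<ge> 0"
  shows "(\<integral>\<^sup>+ x. ennreal (v x) * (ennreal ((2 ^ k) ^ DIM('a)) * (\<integral>\<^sup>+ y. indicator (cell k x) y * h y \<partial>lborel)) \<partial>lborel)
    \<le> ennreal (2 powr (real k * real DIM('a) / r) * \<Lambda>) * (\<integral>\<^sup>+ y. h y \<partial>lborel)"
proof -
  let ?c = "ennreal ((2 ^ k) ^ DIM('a))"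
  have sym: "indicator (cell k x) y = (indicator (cell k y) x :: ennreal)" for x y :: 'a
    using cell_commute[of x k y] by (simp add: indicator_def)
  have hm [measurable]: "(\<lambda>y. indicator (cell k x) y * h y) \<in> borel_measurable lborel" for x by measurable
  have [measurable]: "(\<lambda>z. indicator (cell k (fst z)) (snd z) * h (snd z)) \<in> borel_measurable (lborel \<Otimes>\<^sub>M lborel)"
    by measurable
  have "(\<integral>\<^sup>+ x. ennreal (v x) * (?c * (\<integral>\<^sup>+ y. indicator (cell k x) y * h y \<partial>lborel)) \<partial>lborel)
      = (\<integral>\<^sup>+ x. \<integral>\<^sup>+ y. ?c * ennreal (v x) * (indicator (cell k x) y * h y) \<partial>lborel \<partial>lborel)"
  proof (intro nn_integral_cong)
    fix x
    have "(\<integral>\<^sup>+ y. ?c * ennreal (v x) * (indicator (cell k x) y * h y) \<partial>lborel) = ?c * ennreal (v x) * (\<integral>\<^sup>+ y. indicator (cell k x) y * h y \<partial>lborel)"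
      by (rule nn_integral_cmult[OF hm])
    then show "ennreal (v x) * (?c * (\<integral>\<^sup>+ y. indicator (cell k x) y * h y \<partial>lborel)) = (\<integral>\<^sup>+ y. ?c * ennreal (v x) * (indicator (cell k x) y * h y) \<partial>lborel)"
      by (simp only: mult_ac)
  qed
  also have "\<dots> = (\<integral>\<^sup>+ y. \<integral>\<^sup>+ x. ?c * ennreal (v x) * (indicator (cell k x) y * h y) \<partial>lborel \<partial>lborel)"
    by (rule lborel_pair.Fubini'[symmetric]) (simp add: case_prod_unfold)
  also have "\<dots> = (\<integral>\<^sup>+ y. h y * (?c * (\<integral>\<^sup>+ x. indicator (cell k y) x * ennreal (v x) \<partial>lborel)) \<partial>lborel)"
    by (intro nn_integral_cong) (simp add: sym nn_integral_cmult[symmetric] mult_ac)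
  also have "\<dots> \<le> (\<integral>\<^sup>+ y. h y * ennreal (2 powr (real k * real DIM('a) / r) * \<Lambda>) \<partial>lborel)"
    by (intro nn_integral_mono mult_left_mono nn_integral_cell_weight_le[OF r _ v \<Lambda>]) auto
  also have "\<dots> = ennreal (2 powr (real k * real DIM('a) / r) * \<Lambda>) * (\<integral>\<^sup>+ y. h y \<partial>lborel)"
    by (simp add: nn_integral_multc mult.commute)
  finally show ?thesis .
qed

section \<open>Summing dyadic increments\<close>

text \<open>Taking p-th roots, the increments are at most \<sigma>^(1/p) \<rho>^j with \<rho> =
  q^(1/(2p)) < 1, so they telescope to a geometric series.\<close>

lemma chaining_pointwise:
  fixes g :: "nat \<Rightarrow> real" and \<sigma> p q :: real
  assumes p: "p \<ge> 1" and q: "0 < q" "q < 1" and \<sigma>: "\<sigma> \<ge> 0"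
    and le: "\<And>j. \<bar>g (Suc (k + j)) - g (k + j)\<bar> powr p \<le> q powr (real j / 2) * \<sigma>"
  shows "convergent g" and "g \<longlonglongrightarrow> l \<Longrightarrow> \<bar>l - g k\<bar> powr p \<le> (1 / (1 - q powr (1 / (2 * p)))) powr p * \<sigma>"
proof -
  define \<rho> where "\<rho> = q powr (1 / (2 * p))"
  have \<rho>: "0 < \<rho>" "\<rho> < 1" using q p powr_less_mono2[of "1 / (2 * p)" q 1] by (auto simp: \<rho>_def)
  define d where "d j = g (Suc (k + j)) - g (k + j)" for j
  have d: "\<bar>d j\<bar> \<le> \<sigma> powr (1 / p) * \<rho> ^ j" for j
  proof -
    have "(\<bar>d j\<bar> powr p) powr (1 / p) \<le> (q powr (real j / 2) * \<sigma>) powr (1 / p)"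
      using le[of j] p by (intro powr_mono2) (auto simp: d_def)
    moreover have "\<rho> ^ j = q powr (real j / 2 * (1 / p))"
      using q by (simp add: \<rho>_def powr_powr powr_realpow[symmetric] algebra_simps)
    ultimately show ?thesis using p \<sigma> q by (simp add: powr_powr powr_mult mult.commute)
  qed
  have sg: "summable (\<lambda>j. \<sigma> powr (1 / p) * \<rho> ^ j)"
    using \<rho> by (intro summable_mult summable_geometric) auto
  have sd: "summable (\<lambda>j. \<bar>d j\<bar>)"
    by (rule summable_comparison_test'[OF sg]) (use d in auto)
  have tele: "(\<Sum>j<n. d j) = g (k + n) - g k" for n
    using sum_lessThan_telescope[of "\<lambda>j. g (k + j)" n] by (simp add: d_def)
  have "(\<lambda>n. g (k + n) - g k) \<longlonglongrightarrow> suminf d"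
    using summable_LIMSEQ[OF summable_rabs_cancel[OF sd]] by (simp add: tele)
  then have "(\<lambda>n. (g (k + n) - g k) + g k) \<longlonglongrightarrow> suminf d + g k"
    by (intro tendsto_intros)
  then have lim: "g \<longlonglongrightarrow> suminf d + g k"
    by (simp add: add.commute[of k] LIMSEQ_offset)
  then show "convergent g" by (rule convergentI)
  assume "g \<longlonglongrightarrow> l"
  with lim have "suminf d + g k = l" by (rule LIMSEQ_unique)
  then have "l - g k = suminf d" by simp
  then have "\<bar>l - g k\<bar> \<le> (\<Sum>j. \<bar>d j\<bar>)" using summable_rabs[OF sd] by simp
  also have "\<dots> \<le> (\<Sum>j. \<sigma> powr (1 / p) * \<rho> ^ j)"
    by (rule suminf_le[OF d sd sg])
  also have "\<dots> = \<sigma> powr (1 / p) * (1 / (1 - \<rho>))"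
    using \<rho> by (simp add: suminf_mult suminf_geometric)
  finally have "\<bar>l - g k\<bar> powr p \<le> (\<sigma> powr (1 / p) * (1 / (1 - \<rho>))) powr p"
    using p by (intro powr_mono2) auto
  also have "\<dots> = (1 / (1 - \<rho>)) powr p * \<sigma>"
    using p \<sigma> unfolding powr_mult powr_powr by simp
  finally show "\<bar>l - g k\<bar> powr p \<le> (1 / (1 - q powr (1 / (2 * p)))) powr p * \<sigma>" by (simp add: \<rho>_def)
qed

text \<open>The decay q^k is divided in two: one half is spent on pointwise summability of the
  increments, the other on integrability of the majorant \<open>S\<close>.\<close>

lemma chaining:
  fixes g :: "nat \<Rightarrow> 'b \<Rightarrow> real"
  assumes p: "p \<ge> 1" and q: "0 < q" "q < 1" and A: "A \<ge> 0" and [measurable]: "\<And>k. g k \<in> borel_measurable M"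
    and le: "\<And>k. (\<integral>\<^sup>+ x. ennreal (\<bar>g (Suc k) x - g k x\<bar> powr p) \<partial>M) \<le> ennreal (A * q ^ k)"
  shows "AE x in M. convergent (\<lambda>k. g k x)"
    and "AE x in M. (\<lambda>k. g k x) \<longlonglongrightarrow> l x \<Longrightarrow>
      (\<integral>\<^sup>+ x. ennreal (\<bar>l x - g k x\<bar> powr p) \<partial>M)
        \<le> ennreal ((1 / (1 - q powr (1 / (2 * p)))) powr p * (A * q ^ k / (1 - sqrt q)))"
proof -
  define D where "D = (1 / (1 - q powr (1 / (2 * p)))) powr p"
  \<comment> \<open>One function dominating all increments beyond level \<open>k\<close>, each with
    the factor q^(j/2). Its integral is at most A q^k times the sum of sqrt(q)^j.\<close>
  define S where "S k x = (\<Sum>j. ennreal (q powr (- (real j / 2))) * ennreal (\<bar>g (Suc (k + j)) x - g (k + j) x\<bar> powr p))" for k x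
  have S_meas [measurable]: "S k \<in> borel_measurable M" for k unfolding S_def[abs_def] by measurable
  have sq: "0 < sqrt q" "sqrt q < 1" using q by (auto simp: real_sqrt_lt_1_iff)
  have qj: "q powr (- (real j / 2)) * q ^ j = sqrt q ^ j" for j
  proof -
    have "q powr (- (real j / 2)) * q ^ j = q powr (real j / 2)"
      using q by (simp add: powr_add[symmetric] flip: powr_realpow)
    also have "\<dots> = sqrt q ^ j" using q by (simp add: powr_half_sqrt[symmetric] powr_powr flip: powr_realpow)
    finally show ?thesis .
  qed
  have S_int: "(\<integral>\<^sup>+ x. S k x \<partial>M) \<le> ennreal (A * q ^ k / (1 - sqrt q))" for k
  proof -
    have "(\<integral>\<^sup>+ x. S k x \<partial>M) = (\<Sum>j. \<integral>\<^sup>+ x. ennreal (q powr (- (real j / 2))) * ennreal (\<bar>g (Suc (k + j)) x - g (k + j) x\<bar> powr p) \<partial>M)"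
      unfolding S_def by (rule nn_integral_suminf) measurable
    also have "\<dots> \<le> (\<Sum>j. ennreal (A * q ^ k * sqrt q ^ j))"
    proof (rule suminf_le)
      fix j
      have "(\<integral>\<^sup>+ x. ennreal (q powr (- (real j / 2))) * ennreal (\<bar>g (Suc (k + j)) x - g (k + j) x\<bar> powr p) \<partial>M)
          = ennreal (q powr (- (real j / 2))) * (\<integral>\<^sup>+ x. ennreal (\<bar>g (Suc (k + j)) x - g (k + j) x\<bar> powr p) \<partial>M)"
        by (rule nn_integral_cmult) measurable
      also have "\<dots> \<le> ennreal (q powr (- (real j / 2))) * ennreal (A * q ^ (k + j))"
        by (intro mult_left_mono le) auto
      also have "\<dots> = ennreal (q powr (- (real j / 2)) * (A * q ^ (k + j)))"
        using A q by (intro ennreal_mult[symmetric]) auto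
      also have "q powr (- (real j / 2)) * (A * q ^ (k + j)) = A * q ^ k * (q powr (- (real j / 2)) * q ^ j)"
        by (simp add: power_add)
      finally show "(\<integral>\<^sup>+ x. ennreal (q powr (- (real j / 2))) * ennreal (\<bar>g (Suc (k + j)) x - g (k + j) x\<bar> powr p) \<partial>M)
          \<le> ennreal (A * q ^ k * sqrt q ^ j)" unfolding qj .
    qed auto
    also have "\<dots> = ennreal (\<Sum>j. A * q ^ k * sqrt q ^ j)"
      using A q sq by (intro suminf_ennreal2) (auto intro!: summable_mult summable_geometric)
    also have "(\<Sum>j. A * q ^ k * sqrt q ^ j) = A * q ^ k / (1 - sqrt q)"
      using sq by (subst suminf_mult) (auto simp: suminf_geometric intro!: summable_geometric)
    finally show ?thesis .
  qed
  have pt: "\<bar>g (Suc (k + j)) x - g (k + j) x\<bar> powr p \<le> q powr (real j / 2) * enn2real (S k x)" if "S k x \<noteq> \<infinity>" for k j x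
  proof -
    have "ennreal (q powr (- (real j / 2)) * \<bar>g (Suc (k + j)) x - g (k + j) x\<bar> powr p) \<le> S k x"
      unfolding S_def using ennreal_le_suminf[of "\<lambda>j. ennreal (q powr (- (real j / 2))) * ennreal (\<bar>g (Suc (k + j)) x - g (k + j) x\<bar> powr p)" j]
      by (simp add: ennreal_mult)
    also have "S k x = ennreal (enn2real (S k x))" using that by (simp add: less_top)
    finally have "q powr (- (real j / 2)) * \<bar>g (Suc (k + j)) x - g (k + j) x\<bar> powr p \<le> enn2real (S k x)"
      by (subst (asm) ennreal_le_iff) auto
    then have "q powr (real j / 2) * (q powr (- (real j / 2)) * \<bar>g (Suc (k + j)) x - g (k + j) x\<bar> powr p) \<le> q powr (real j / 2) * enn2real (S k x)"
      by (intro mult_left_mono) auto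
    then show ?thesis using q by (simp add: powr_minus field_simps)
  qed
  have fin: "AE x in M. S k x \<noteq> \<infinity>" for k
    by (rule nn_integral_noteq_infinite) (use S_int[of k] in \<open>auto simp: top_unique\<close>)
  show "AE x in M. convergent (\<lambda>k. g k x)"
    using fin[of 0]
  proof eventually_elim
    case (elim x)
    show ?case by (rule chaining_pointwise(1)[OF p q _ pt[OF elim]]) simp
  qed
  assume l: "AE x in M. (\<lambda>k. g k x) \<longlonglongrightarrow> l x"
  have "(\<integral>\<^sup>+ x. ennreal (\<bar>l x - g k x\<bar> powr p) \<partial>M) \<le> (\<integral>\<^sup>+ x. ennreal D * S k x \<partial>M)"
  proof (rule nn_integral_mono_AE)
    show "AE x in M. ennreal (\<bar>l x - g k x\<bar> powr p) \<le> ennreal D * S k x"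
      using fin[of k] l
    proof eventually_elim
      case (elim x)
      have "\<bar>l x - g k x\<bar> powr p \<le> D * enn2real (S k x)"
        unfolding D_def by (rule chaining_pointwise(2)[OF p q _ pt[OF elim(1)] elim(2)]) simp
      then have "ennreal (\<bar>l x - g k x\<bar> powr p) \<le> ennreal D * ennreal (enn2real (S k x))"
        by (simp add: ennreal_leI D_def flip: ennreal_mult)
      then show ?case using elim(1) by (simp add: less_top)
    qed
  qed
  also have "\<dots> = ennreal D * (\<integral>\<^sup>+ x. S k x \<partial>M)" by (rule nn_integral_cmult) measurable
  also have "\<dots> \<le> ennreal D * ennreal (A * q ^ k / (1 - sqrt q))"
    by (intro mult_left_mono S_int) auto
  also have "\<dots> = ennreal (D * (A * q ^ k / (1 - sqrt q)))"
    using A q sq by (intro ennreal_mult[symmetric]) (auto simp: D_def)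
  finally show "(\<integral>\<^sup>+ x. ennreal (\<bar>l x - g k x\<bar> powr p) \<partial>M)
        \<le> ennreal ((1 / (1 - q powr (1 / (2 * p)))) powr p * (A * q ^ k / (1 - sqrt q)))" by (simp add: D_def)
qed

text \<open>The oscillation gain 2^(-k s p) meets the weight loss 2^((k+1) N / r). Averaging takes
  place on level k + 1, which is the origin of the extra factor 2^(N/r).\<close>

lemma cavg_increment_le:
  fixes u v :: "'a::euclidean_space \<Rightarrow> real"
  assumes sp: "s > 0" "p > 1" and r: "r > 1" and [measurable]: "u \<in> borel_measurable borel" "v \<in> borel_measurable borel"
    and int: "(\<integral>\<^sup>+ y. ennreal (\<bar>u y\<bar> powr p) \<partial>lborel) < \<infinity>"
    and v: "\<And>x. v x \<ge> 0"
    and \<Lambda>: "(\<integral>\<^sup>+ x. ennreal (v x powr r) \<partial>lborel) \<le> ennreal (\<Lambda> powr r)" "\<Lambda> \<ge> 0"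
    and G: "(\<integral>\<^sup>+ z. ennreal (gagliardo_integrand s p u z) \<partial>lebesgue) \<le> ennreal G" "G \<ge> 0"
  shows "(\<integral>\<^sup>+ x. ennreal (v x) * ennreal (\<bar>cavg (Suc k) u x - cavg k u x\<bar> powr p) \<partial>lborel)
    \<le> ennreal ((2 * real DIM('a)) powr (real DIM('a) + s * p) * 2 powr (real DIM('a) / r) * \<Lambda> * G
        * (2 powr (- (s * p - real DIM('a) / r))) ^ k)"
proof -
  define C where "C = (2 * real DIM('a)) powr (real DIM('a) + s * p)"
  define c where "c = C * 2 powr (- (real k * (s * p)))"
  have c: "c \<ge> 0" "C \<ge> 0" by (auto simp: c_def C_def)
  have pt: "ennreal (\<bar>cavg (Suc k) u x - cavg k u x\<bar> powr p)
      \<le> ennreal c * (ennreal ((2 ^ Suc k) ^ DIM('a)) * (\<integral>\<^sup>+ y. indicator (cell (Suc k) x) y * gag_slice s p u y \<partial>lborel))" for x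
  proof -
    have "ennreal (\<bar>cavg (Suc k) u x - cavg k u x\<bar> powr p) = ennreal (\<bar>cavg k u x - cavg (Suc k) u x\<bar> powr p)"
      by (simp add: abs_minus_commute)
    also have "\<dots> \<le> ennreal ((2 ^ Suc k) ^ DIM('a)) * (\<integral>\<^sup>+ y. indicator (cell (Suc k) x) y * ennreal (\<bar>cavg k u x - u y\<bar> powr p) \<partial>lborel)"
      by (rule powr_diff_cavg_le[OF sp(2) _ int]) simp
    also have "\<dots> \<le> ennreal ((2 ^ Suc k) ^ DIM('a)) * (\<integral>\<^sup>+ y. ennreal c * (indicator (cell (Suc k) x) y * gag_slice s p u y) \<partial>lborel)"
    proof (intro mult_left_mono nn_integral_mono)
      fix y
      show "indicator (cell (Suc k) x) y * ennreal (\<bar>cavg k u x - u y\<bar> powr p) \<le> ennreal c * (indicator (cell (Suc k) x) y * gag_slice s p u y)"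
      proof (cases "y \<in> cell (Suc k) x")
        case True
        have "ennreal (\<bar>u y - cavg k u x\<bar> powr p) \<le> ennreal c * gag_slice s p u y"
          unfolding c_def C_def by (rule powr_diff_cavg_le_slice[OF sp _ int True]) auto
        then show ?thesis using True by (simp add: abs_minus_commute)
      qed simp
    qed auto
    also have "(\<integral>\<^sup>+ y. ennreal c * (indicator (cell (Suc k) x) y * gag_slice s p u y) \<partial>lborel)
        = ennreal c * (\<integral>\<^sup>+ y. indicator (cell (Suc k) x) y * gag_slice s p u y \<partial>lborel)"
      by (rule nn_integral_cmult) measurable
    finally show ?thesis by (simp only: mult_ac)
  qed
  have "(\<integral>\<^sup>+ x. ennreal (v x) * ennreal (\<bar>cavg (Suc k) u x - cavg k u x\<bar> powr p) \<partial>lborel)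
    \<le> (\<integral>\<^sup>+ x. ennreal c * (ennreal (v x) * (ennreal ((2 ^ Suc k) ^ DIM('a)) * (\<integral>\<^sup>+ y. indicator (cell (Suc k) x) y * gag_slice s p u y \<partial>lborel))) \<partial>lborel)"
  proof (intro nn_integral_mono)
    fix x
    show "ennreal (v x) * ennreal (\<bar>cavg (Suc k) u x - cavg k u x\<bar> powr p) \<le> ennreal c * (ennreal (v x) * (ennreal ((2 ^ Suc k) ^ DIM('a)) * (\<integral>\<^sup>+ y. indicator (cell (Suc k) x) y * gag_slice s p u y \<partial>lborel)))"
      using mult_left_mono[OF pt[of x], of "ennreal (v x)"] by (simp only: mult_ac zero_le)
  qed
  also have "\<dots> = ennreal c * (\<integral>\<^sup>+ x. ennreal (v x) * (ennreal ((2 ^ Suc k) ^ DIM('a)) * (\<integral>\<^sup>+ y. indicator (cell (Suc k) x) y * gag_slice s p u y \<partial>lborel)) \<partial>lborel)"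
  proof (rule nn_integral_cmult)
    have "(\<lambda>x. \<integral>\<^sup>+ y. indicator (cell (Suc k) x) y * gag_slice s p u y \<partial>lborel) \<in> borel_measurable lborel"
      by (rule lborel.borel_measurable_nn_integral) (simp add: case_prod_unfold)
    then show "(\<lambda>x. ennreal (v x) * (ennreal ((2 ^ Suc k) ^ DIM('a)) * (\<integral>\<^sup>+ y. indicator (cell (Suc k) x) y * gag_slice s p u y \<partial>lborel))) \<in> borel_measurable lborel"
      by measurable
  qed
  also have "\<dots> \<le> ennreal c * (ennreal (2 powr (real (Suc k) * real DIM('a) / r) * \<Lambda>) * (\<integral>\<^sup>+ y. gag_slice s p u y \<partial>lborel))"
    by (intro mult_left_mono nn_integral_weighted_cell_average_le[OF r _ _ v \<Lambda>]) auto
  also have "\<dots> \<le> ennreal c * (ennreal (2 powr (real (Suc k) * real DIM('a) / r) * \<Lambda>) * ennreal G)"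
    by (intro mult_left_mono) (use G in \<open>auto simp: nn_integral_gag_slice\<close>)
  also have "\<dots> = ennreal (c * (2 powr (real (Suc k) * real DIM('a) / r) * \<Lambda> * G))"
    using c \<Lambda>(2) G(2) by (simp add: ennreal_mult)
  also have "c * (2 powr (real (Suc k) * real DIM('a) / r) * \<Lambda> * G)
      = C * 2 powr (real DIM('a) / r) * \<Lambda> * G * (2 powr (- (s * p - real DIM('a) / r))) ^ k"
  proof -
    have E: "2 powr (- (real k * (s * p))) * 2 powr (real (Suc k) * real DIM('a) / r)
        = 2 powr (real DIM('a) / r) * (2 powr (- (s * p - real DIM('a) / r))) ^ k"
      by (simp add: powr_add[symmetric] powr_powr algebra_simps add_divide_distrib flip: powr_realpow)
    have "c * (2 powr (real (Suc k) * real DIM('a) / r) * \<Lambda> * G)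
        = C * \<Lambda> * G * (2 powr (- (real k * (s * p))) * 2 powr (real (Suc k) * real DIM('a) / r))"
      unfolding c_def by (simp only: mult_ac)
    then show ?thesis unfolding E by (simp only: mult_ac)
  qed
  finally show ?thesis by (simp only: C_def)
qed

text \<open>The slice estimate at y = x: wherever \<open>gag_slice\<close> is finite, hence almost
  everywhere, the averages converge with rate 2^(-k s p) in the p-th power.\<close>

lemma cavg_tendsto_AE:
  fixes u :: "'a::euclidean_space \<Rightarrow> real"
  assumes sp: "s > 0" "p > 1" and [measurable]: "u \<in> borel_measurable borel"
    and int: "(\<integral>\<^sup>+ y. ennreal (\<bar>u y\<bar> powr p) \<partial>lborel) < \<infinity>"
    and G: "(\<integral>\<^sup>+ z. ennreal (gagliardo_integrand s p u z) \<partial>lebesgue) < \<infinity>"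
  shows "AE x in lborel. (\<lambda>k. cavg k u x) \<longlonglongrightarrow> u x"
proof -
  have "AE x in lborel. gag_slice s p u x \<noteq> \<infinity>"
    by (rule nn_integral_noteq_infinite) (use G in \<open>auto simp: nn_integral_gag_slice\<close>)
  then show ?thesis
  proof eventually_elim
    case (elim x)
    define C where "C = (2 * real DIM('a)) powr (real DIM('a) + s * p) * enn2real (gag_slice s p u x)"
    have le: "\<bar>u x - cavg k u x\<bar> powr p \<le> C * 2 powr (- (real k * (s * p)))" for k
    proof -
      have "ennreal (\<bar>u x - cavg k u x\<bar> powr p)
        \<le> ennreal ((2 * real DIM('a)) powr (real DIM('a) + s * p) * 2 powr (- (real k * (s * p)))) * gag_slice s p u x"
        by (rule powr_diff_cavg_le_slice[OF sp _ int, of x k]) (auto simp: cell_def)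
      also have "gag_slice s p u x = ennreal (enn2real (gag_slice s p u x))" using elim by (simp add: less_top)
      finally have "ennreal (\<bar>u x - cavg k u x\<bar> powr p) \<le> ennreal (C * 2 powr (- (real k * (s * p))))"
        by (simp add: C_def mult_ac flip: ennreal_mult)
      then show ?thesis by (subst (asm) ennreal_le_iff) (auto simp: C_def)
    qed
    have lim: "(\<lambda>k. C * 2 powr (- (real k * (s * p)))) \<longlonglongrightarrow> C * 0"
    proof (rule tendsto_mult_left)
      have "2 powr (- (s * p)) < 1" using sp by (simp add: powr_less_one)
      then have "(\<lambda>k. (2 powr (- (s * p))) ^ k) \<longlonglongrightarrow> 0" by (intro LIMSEQ_power_zero) auto
      then show "(\<lambda>k. 2 powr (- (real k * (s * p)))) \<longlonglongrightarrow> 0"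
        by (simp add: powr_powr mult.commute flip: powr_realpow)
    qed
    have "(\<lambda>k. \<bar>u x - cavg k u x\<bar> powr p) \<longlonglongrightarrow> 0"
    proof (rule tendsto_sandwich[OF _ _ tendsto_const])
      show "(\<lambda>k. C * 2 powr (- (real k * (s * p)))) \<longlonglongrightarrow> 0" using lim by simp
    qed (simp_all add: le)
    then have "(\<lambda>k. (\<bar>u x - cavg k u x\<bar> powr p) powr (1 / p)) \<longlonglongrightarrow> 0 powr (1 / p)"
      using sp by (intro tendsto_powr'[OF _ tendsto_const]) auto
    then have "(\<lambda>k. \<bar>u x - cavg k u x\<bar>) \<longlonglongrightarrow> 0"
      using sp by (simp add: powr_powr)
    then have "(\<lambda>k. u x - cavg k u x) \<longlonglongrightarrow> 0" by (rule tendsto_rabs_zero_cancel)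
    then have "(\<lambda>k. u x - (u x - cavg k u x)) \<longlonglongrightarrow> u x - 0" by (intro tendsto_intros)
    then show ?case by simp
  qed
qed

text \<open>The constant of \<open>chaining\<close> times the constant of
  \<open>cavg_increment_le\<close>, without the factors \<Lambda> and G.\<close>

definition cavg_const :: "real \<Rightarrow> real \<Rightarrow> real \<Rightarrow> real \<Rightarrow> real" where
  "cavg_const n s p r = (let q = 2 powr (- (s * p - n / r)) in
     (1 / (1 - q powr (1 / (2 * p)))) powr p * ((2 * n) powr (n + s * p) * 2 powr (n / r)) / (1 - sqrt q))"

lemma dyadic_ratio:
  fixes s p r n :: real
  assumes "r > 1" "r * (s * p) > n"
  shows "0 < 2 powr (- (s * p - n / r))" "2 powr (- (s * p - n / r)) < 1"
  using assms by (auto simp: field_simps intro!: powr_less_one)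

lemma cavg_const_nonneg:
  assumes "r > 1" "r * (s * p) > n"
  shows "cavg_const n s p r \<ge> 0"
proof -
  have "sqrt (2 powr (- (s * p - n / r))) < 1"
    using dyadic_ratio[OF assms] by (simp add: real_sqrt_lt_1_iff)
  then show ?thesis by (simp add: cavg_const_def Let_def)
qed

text \<open>Chaining over the dyadic averages. This is where \<open>r > N / (s p)\<close> enters: the ratio of the
  geometric series is \<open>2\<^sup>N\<^sup>/\<^sup>r\<^sup>-\<^sup>s\<^sup>p < 1\<close>.\<close>

lemma cavg_approximation:
  fixes u v :: "'a::euclidean_space \<Rightarrow> real"
  assumes sp: "s > 0" "p > 1" and r: "r > 1" "r * (s * p) > real DIM('a)"
    and [measurable]: "u \<in> borel_measurable borel" "v \<in> borel_measurable borel"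
    and int: "(\<integral>\<^sup>+ y. ennreal (\<bar>u y\<bar> powr p) \<partial>lborel) < \<infinity>"
    and v: "\<And>x. v x \<ge> 0"
    and \<Lambda>: "(\<integral>\<^sup>+ x. ennreal (v x powr r) \<partial>lborel) \<le> ennreal (\<Lambda> powr r)" "\<Lambda> \<ge> 0"
    and G: "(\<integral>\<^sup>+ z. ennreal (gagliardo_integrand s p u z) \<partial>lebesgue) \<le> ennreal G" "G \<ge> 0"
  shows "(\<integral>\<^sup>+ x. ennreal (v x) * ennreal (\<bar>u x - cavg k u x\<bar> powr p) \<partial>lborel)
    \<le> ennreal (cavg_const (real DIM('a)) s p r * \<Lambda> * G * (2 powr (- (s * p - real DIM('a) / r))) ^ k)"
proof -
  define q where "q = 2 powr (- (s * p - real DIM('a) / r))"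
  have q: "0 < q" "q < 1" unfolding q_def by (rule dyadic_ratio[OF r])+
  define A where "A = (2 * real DIM('a)) powr (real DIM('a) + s * p) * 2 powr (real DIM('a) / r)"
  \<comment> \<open>Chaining is carried out in the measure v dx, where the increments decay.\<close>
  define M where "M = density lborel (\<lambda>x. ennreal (v x))"
  have inM: "(\<integral>\<^sup>+ x. f x \<partial>M) = (\<integral>\<^sup>+ x. ennreal (v x) * f x \<partial>lborel)" if "f \<in> borel_measurable borel" for f
    unfolding M_def using that by (subst nn_integral_density) auto
  have "(\<integral>\<^sup>+ x. ennreal (\<bar>u x - cavg k u x\<bar> powr p) \<partial>M)
      \<le> ennreal ((1 / (1 - q powr (1 / (2 * p)))) powr p * ((A * \<Lambda> * G) * q ^ k / (1 - sqrt q)))"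
  proof (rule chaining(2)[OF _ q])
    show "AE x in M. (\<lambda>k. cavg k u x) \<longlonglongrightarrow> u x"
      unfolding M_def using cavg_tendsto_AE[OF sp _ int] G
      by (subst AE_density) (auto elim: AE_mp simp: order_le_less_trans)
    show "(\<integral>\<^sup>+ x. ennreal (\<bar>cavg (Suc k) u x - cavg k u x\<bar> powr p) \<partial>M) \<le> ennreal (A * \<Lambda> * G * q ^ k)" for k
      unfolding A_def q_def using cavg_increment_le[OF sp r(1) _ _ int v \<Lambda> G, of k]
      by (subst inM) auto
  qed (use sp \<Lambda> G in \<open>auto simp: A_def M_def\<close>)
  moreover have "cavg_const (real DIM('a)) s p r = (1 / (1 - q powr (1 / (2 * p)))) powr p * A / (1 - sqrt q)"
    by (simp only: cavg_const_def Let_def A_def q_def)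
  then have "(1 / (1 - q powr (1 / (2 * p)))) powr p * ((A * \<Lambda> * G) * q ^ k / (1 - sqrt q))
      = cavg_const (real DIM('a)) s p r * \<Lambda> * G * q ^ k"
    by (simp add: mult_ac)
  ultimately show ?thesis unfolding q_def[symmetric] by (subst (asm) inM) auto
qed

text \<open>u is split into its average over unit cells and the remainder: the remainder is the
  level 0 approximation error, controlled by the seminorm, and the average is controlled by the
  \<open>L^p\<close> norm.\<close>

lemma weighted_embedding:
  fixes u v :: "'a::euclidean_space \<Rightarrow> real"
  assumes sp: "s > 0" "p > 1" and r: "r > 1" "r * (s * p) > real DIM('a)"
    and [measurable]: "u \<in> borel_measurable borel" "v \<in> borel_measurable borel"
    and v: "\<And>x. v x \<ge> 0"
    and \<Lambda>: "(\<integral>\<^sup>+ x. ennreal (v x powr r) \<partial>lborel) \<le> ennreal (\<Lambda> powr r)" "\<Lambda> \<ge> 0"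
    and G: "(\<integral>\<^sup>+ z. ennreal (gagliardo_integrand s p u z) \<partial>lebesgue) \<le> ennreal G" "G \<ge> 0"
    and L: "(\<integral>\<^sup>+ y. ennreal (\<bar>u y\<bar> powr p) \<partial>lborel) \<le> ennreal L" "L \<ge> 0"
  shows "(\<integral>\<^sup>+ x. ennreal (v x) * ennreal (\<bar>u x\<bar> powr p) \<partial>lborel)
    \<le> ennreal (2 powr p * max (cavg_const (real DIM('a)) s p r) 1 * \<Lambda> * (G + L))"
proof -
  define C where "C = cavg_const (real DIM('a)) s p r"
  have C: "C \<ge> 0" unfolding C_def by (rule cavg_const_nonneg[OF r])
  have int: "(\<integral>\<^sup>+ y. ennreal (\<bar>u y\<bar> powr p) \<partial>lborel) < \<infinity>"
    using L(1) by (rule order_le_less_trans) simp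
  have 1: "(\<integral>\<^sup>+ x. ennreal (v x) * ennreal (\<bar>u x - cavg 0 u x\<bar> powr p) \<partial>lborel) \<le> ennreal (C * \<Lambda> * G)"
    using cavg_approximation[OF sp r _ _ int v \<Lambda> G, of 0] by (simp add: C_def)
  have "(\<integral>\<^sup>+ x. ennreal (v x) * ennreal (\<bar>cavg 0 u x\<bar> powr p) \<partial>lborel)
      \<le> (\<integral>\<^sup>+ x. ennreal (v x) * (ennreal ((2 ^ 0) ^ DIM('a)) * (\<integral>\<^sup>+ y. indicator (cell 0 x) y * ennreal (\<bar>u y\<bar> powr p) \<partial>lborel)) \<partial>lborel)"
    using powr_diff_cavg_le[OF sp(2) _ int, of 0 0] by (intro nn_integral_mono mult_left_mono) auto
  also have "\<dots> \<le> ennreal (2 powr (real 0 * real DIM('a) / r) * \<Lambda>) * (\<integral>\<^sup>+ y. ennreal (\<bar>u y\<bar> powr p) \<partial>lborel)"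
    by (rule nn_integral_weighted_cell_average_le[OF r(1) _ _ v \<Lambda>]) auto
  also have "\<dots> \<le> ennreal (2 powr (real 0 * real DIM('a) / r) * \<Lambda>) * ennreal L"
    by (intro mult_left_mono L) auto
  also have "\<dots> = ennreal (\<Lambda> * L)" using \<Lambda>(2) L(2) by (simp add: ennreal_mult)
  finally have 2: "(\<integral>\<^sup>+ x. ennreal (v x) * ennreal (\<bar>cavg 0 u x\<bar> powr p) \<partial>lborel) \<le> ennreal (\<Lambda> * L)" .
  have "(\<integral>\<^sup>+ x. ennreal (v x) * ennreal (\<bar>u x\<bar> powr p) \<partial>lborel)
      \<le> (\<integral>\<^sup>+ x. ennreal (2 powr p) * (ennreal (v x) * ennreal (\<bar>u x - cavg 0 u x\<bar> powr p) + ennreal (v x) * ennreal (\<bar>cavg 0 u x\<bar> powr p)) \<partial>lborel)"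
  proof (intro nn_integral_mono)
    fix x
    have "v x * \<bar>u x\<bar> powr p \<le> v x * (2 powr p * (\<bar>u x - cavg 0 u x\<bar> powr p + \<bar>cavg 0 u x\<bar> powr p))"
      using abs_add_powr_le2[of p "u x - cavg 0 u x" "cavg 0 u x"] sp v by (intro mult_left_mono) auto
    then have "ennreal (v x * \<bar>u x\<bar> powr p) \<le> ennreal (2 powr p * (v x * \<bar>u x - cavg 0 u x\<bar> powr p + v x * \<bar>cavg 0 u x\<bar> powr p))"
      by (intro ennreal_leI) (simp add: algebra_simps)
    then show "ennreal (v x) * ennreal (\<bar>u x\<bar> powr p) \<le> ennreal (2 powr p) * (ennreal (v x) * ennreal (\<bar>u x - cavg 0 u x\<bar> powr p) + ennreal (v x) * ennreal (\<bar>cavg 0 u x\<bar> powr p))"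
      using v[of x] by (simp add: ennreal_mult ennreal_plus)
  qed
  also have "\<dots> = ennreal (2 powr p) * ((\<integral>\<^sup>+ x. ennreal (v x) * ennreal (\<bar>u x - cavg 0 u x\<bar> powr p) \<partial>lborel)
      + (\<integral>\<^sup>+ x. ennreal (v x) * ennreal (\<bar>cavg 0 u x\<bar> powr p) \<partial>lborel))"
    by (subst nn_integral_cmult) (auto simp: nn_integral_add)
  also have "\<dots> \<le> ennreal (2 powr p) * (ennreal (C * \<Lambda> * G) + ennreal (\<Lambda> * L))"
    by (intro mult_left_mono add_mono 1 2) auto
  also have "\<dots> = ennreal (2 powr p * (C * \<Lambda> * G + \<Lambda> * L))"
    using C \<Lambda>(2) G(2) L(2) by (simp add: ennreal_mult ennreal_plus)
  also have "\<dots> \<le> ennreal (2 powr p * max C 1 * \<Lambda> * (G + L))"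
  proof (intro ennreal_leI)
    have "C * \<Lambda> * G + \<Lambda> * L \<le> max C 1 * (\<Lambda> * G) + max C 1 * (\<Lambda> * L)"
      using \<Lambda>(2) G(2) L(2) mult_right_mono[of C "max C 1" "\<Lambda> * G"] mult_right_mono[of 1 "max C 1" "\<Lambda> * L"]
      by (intro add_mono) (auto simp: mult.assoc)
    then have "2 powr p * (C * \<Lambda> * G + \<Lambda> * L) \<le> 2 powr p * (max C 1 * (\<Lambda> * G) + max C 1 * (\<Lambda> * L))"
      by (intro mult_left_mono) auto
    then show "2 powr p * (C * \<Lambda> * G + \<Lambda> * L) \<le> 2 powr p * max C 1 * \<Lambda> * (G + L)"
      by (simp add: algebra_simps)
  qed
  finally show ?thesis unfolding C_def .
qed

subsection \<open>Minimisers of the Rayleigh quotient\<close>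

locale subcritical_weighted_problem = weighted_frac_problem +
  fixes r :: real
  assumes nonempty_\<Omega>: "\<Omega> \<noteq> {}"
    and p_less: "p < real DIM('a) / s"
    and r_greater: "r > real DIM('a) / (s * p)"
    and V_integrable: "set_integrable lebesgue \<Omega> (\<lambda>x. \<bar>V x\<bar> powr r)"
begin

text \<open>The condition p < N / s makes N / (s p) exceed 1, hence r > 1, as Jensen with exponent r
  requires.\<close>

lemma r1: "r > 1" and r_subcritical: "r * (s * p) > real DIM('a)"
proof -
  have sp: "s * p > 0" using s01 p1 by simp
  have "real DIM('a) / (s * p) > 1" using p_less s01 sp by (simp add: field_simps)
  then show "r > 1" using r_greater by linarith
  show "r * (s * p) > real DIM('a)" using r_greater sp by (simp add: field_simps)
qed

lemma wt_powr_integrable: "integrable lebesgue (\<lambda>x. wt x powr r)"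
proof -
  have "(\<lambda>x. indicator \<Omega> x *\<^sub>R \<bar>V x\<bar> powr r) = (\<lambda>x. wt x powr r)"
    using r1 by (auto simp: wt_def indicator_def)
  then show ?thesis using V_integrable by (simp add: set_integrable_def)
qed

text \<open>Members of the space are only Lebesgue measurable, whereas averages, slices and Fubini
  are set up for Borel functions.\<close>

lemma W_borel_version:
  assumes u: "u \<in> W"
  obtains u' where "u' \<in> borel_measurable borel" "AE x in lebesgue. u x = u' x"
    "(\<integral>\<^sup>+ x. ennreal (\<bar>u' x\<bar> powr p) \<partial>lborel) = ennreal (LINT x|lebesgue. \<bar>u x\<bar> powr p)"
    "(\<integral>\<^sup>+ z. ennreal (gagliardo_integrand s p u' z) \<partial>lebesgue) = ennreal (LINT z|lebesgue. \<bar>dq u z\<bar> powr p)"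
proof -
  obtain u' where u': "u' \<in> borel_measurable lborel" and ae0: "AE x in lborel. u x = u' x"
    using completion_ex_borel_measurable_real[OF W_D(1)[OF u]] by auto
  have ae: "AE x in lebesgue. u x = u' x" using ae0 by (simp add: AE_completion_iff)
  have dae: "AE z in lebesgue. dq u z = dq u' z"
    using AE_lebesgue_fst[OF ae, where 'b = 'a] AE_lebesgue_snd[OF ae, where 'a = 'a]
    by eventually_elim (simp add: dquot_def)
  have "(\<integral>\<^sup>+ x. ennreal (\<bar>u' x\<bar> powr p) \<partial>lborel) = (\<integral>\<^sup>+ x. ennreal (\<bar>u' x\<bar> powr p) \<partial>lebesgue)"
    by (rule nn_integral_completion[symmetric])
  also have "\<dots> = (\<integral>\<^sup>+ x. ennreal (\<bar>u x\<bar> powr p) \<partial>lebesgue)"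
    by (rule nn_integral_cong_AE) (use ae in \<open>eventually_elim, simp\<close>)
  also have "\<dots> = ennreal (LINT x|lebesgue. \<bar>u x\<bar> powr p)"
    by (rule nn_integral_eq_integral) (use W_D(2)[OF u] in auto)
  finally have 1: "(\<integral>\<^sup>+ x. ennreal (\<bar>u' x\<bar> powr p) \<partial>lborel) = ennreal (LINT x|lebesgue. \<bar>u x\<bar> powr p)" .
  have "(\<integral>\<^sup>+ z. ennreal (gagliardo_integrand s p u' z) \<partial>lebesgue) = (\<integral>\<^sup>+ z. ennreal (\<bar>dq u z\<bar> powr p) \<partial>lebesgue)"
    unfolding gagliardo_integrand_eq_dquot[OF p0]
    by (rule nn_integral_cong_AE) (use dae in \<open>eventually_elim, simp\<close>)
  also have "\<dots> = ennreal (LINT z|lebesgue. \<bar>dq u z\<bar> powr p)"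
    by (rule nn_integral_eq_integral) (use W_D(3)[OF u] in auto)
  finally show ?thesis using that[of u'] u' ae 1 by simp
qed

text \<open>The last factor converts the bare Gagliardo integral, without the normalising constant,
  into energy.\<close>

definition emb_const :: real where
  "emb_const = 2 powr p * max (cavg_const (real DIM('a)) s p r) 1 * max 1 (1 / Ks_const TYPE('a) s p)"

lemma emb_const_pos: "emb_const > 0"
  unfolding emb_const_def by (intro mult_pos_pos) auto

text \<open>The weight is arbitrary rather than \<open>wt\<close>, because the isolation argument
  applies the bound to \<open>wt\<close> cut off to a sublevel set and needs the dependence on its
  \<open>L^r\<close> norm.\<close>

lemma embedding:
  assumes u: "u \<in> W" and [measurable]: "w \<in> borel_measurable lebesgue" and w: "\<And>x. w x \<ge> 0"
    and wr: "integrable lebesgue (\<lambda>x. w x powr r)"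
  shows "integrable lebesgue (\<lambda>x. w x * \<bar>u x\<bar> powr p)"
    and "(LINT x|lebesgue. w x * \<bar>u x\<bar> powr p) \<le> emb_const * (LINT x|lebesgue. w x powr r) powr (1 / r) * E u"
proof -
  note [measurable] = W_D(1)[OF u]
  obtain u' where u': "u' \<in> borel_measurable borel" "AE x in lebesgue. u x = u' x"
    "(\<integral>\<^sup>+ x. ennreal (\<bar>u' x\<bar> powr p) \<partial>lborel) = ennreal (LINT x|lebesgue. \<bar>u x\<bar> powr p)"
    "(\<integral>\<^sup>+ z. ennreal (gagliardo_integrand s p u' z) \<partial>lebesgue) = ennreal (LINT z|lebesgue. \<bar>dq u z\<bar> powr p)"
    by (rule W_borel_version[OF u])
  obtain w0 where w0: "w0 \<in> borel_measurable lborel" and w0_ae: "AE x in lborel. w x = w0 x"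
    using completion_ex_borel_measurable_real[OF assms(2)] by auto
  define w' where "w' x = max (w0 x) 0" for x
  have w': "w' \<in> borel_measurable borel" "\<And>x. w' x \<ge> 0" using w0 by (auto simp: w'_def[abs_def])
  have w'_ae: "AE x in lebesgue. w x = w' x"
    using AE_completion[OF w0_ae]
  proof eventually_elim
    case (elim x)
    then show ?case using w[of x] by (simp add: w'_def)
  qed
  define \<Lambda> where "\<Lambda> = (LINT x|lebesgue. w x powr r) powr (1 / r)"
  have \<Lambda>: "\<Lambda> \<ge> 0" "\<Lambda> powr r = (LINT x|lebesgue. w x powr r)"
    using r1 by (auto simp: \<Lambda>_def powr_powr)
  have "(\<integral>\<^sup>+ x. ennreal (w' x powr r) \<partial>lborel) = (\<integral>\<^sup>+ x. ennreal (w' x powr r) \<partial>lebesgue)"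
    by (rule nn_integral_completion[symmetric])
  also have "\<dots> = (\<integral>\<^sup>+ x. ennreal (w x powr r) \<partial>lebesgue)"
    by (rule nn_integral_cong_AE) (use w'_ae in \<open>eventually_elim, simp\<close>)
  also have "\<dots> = ennreal (\<Lambda> powr r)"
    unfolding \<Lambda>(2) by (rule nn_integral_eq_integral) (use wr in auto)
  finally have \<Lambda>': "(\<integral>\<^sup>+ x. ennreal (w' x powr r) \<partial>lborel) \<le> ennreal (\<Lambda> powr r)" by simp
  define G where "G = (LINT z|lebesgue. \<bar>dq u z\<bar> powr p)"
  define L where "L = (LINT x|lebesgue. \<bar>u x\<bar> powr p)"
  have GL: "G \<ge> 0" "L \<ge> 0" by (auto simp: G_def L_def)
  have "(\<integral>\<^sup>+ x. ennreal (w x * \<bar>u x\<bar> powr p) \<partial>lebesgue) = (\<integral>\<^sup>+ x. ennreal (w' x) * ennreal (\<bar>u' x\<bar> powr p) \<partial>lebesgue)"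
  proof (rule nn_integral_cong_AE)
    show "AE x in lebesgue. ennreal (w x * \<bar>u x\<bar> powr p) = ennreal (w' x) * ennreal (\<bar>u' x\<bar> powr p)"
      using w'_ae u'(2) by eventually_elim (auto simp: ennreal_mult w'(2))
  qed
  also have "\<dots> \<le> ennreal (2 powr p * max (cavg_const (real DIM('a)) s p r) 1 * \<Lambda> * (G + L))"
    unfolding nn_integral_completion
    by (rule weighted_embedding[OF s01(1) p1 r1 r_subcritical u'(1) w' \<Lambda>' \<Lambda>(1)]) (use u' GL in \<open>auto simp: G_def L_def\<close>)
  also have "\<dots> \<le> ennreal (emb_const * \<Lambda> * E u)"
  proof (rule ennreal_leI)
    have "G + L \<le> max 1 (1 / Ks_const TYPE('a) s p) * (Ks_const TYPE('a) s p * G + L)"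
    proof -
      have "1 * G \<le> (max 1 (1 / Ks_const TYPE('a) s p) * Ks_const TYPE('a) s p) * G"
        using GL K_pos by (intro mult_right_mono) (auto simp: max_def field_simps)
      moreover have "1 * L \<le> max 1 (1 / Ks_const TYPE('a) s p) * L"
        using GL by (intro mult_right_mono) auto
      ultimately show ?thesis by (simp add: distrib_left mult.assoc)
    qed
    also have "\<dots> = max 1 (1 / Ks_const TYPE('a) s p) * E u" by (simp add: energy_eq[OF u] G_def L_def)
    finally have "2 powr p * max (cavg_const (real DIM('a)) s p r) 1 * \<Lambda> * (G + L)
        \<le> 2 powr p * max (cavg_const (real DIM('a)) s p r) 1 * \<Lambda> * (max 1 (1 / Ks_const TYPE('a) s p) * E u)"
      using \<Lambda> by (intro mult_left_mono) auto
    then show "2 powr p * max (cavg_const (real DIM('a)) s p r) 1 * \<Lambda> * (G + L) \<le> emb_const * \<Lambda> * E u"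
      by (simp add: emb_const_def mult_ac)
  qed
  finally have le: "(\<integral>\<^sup>+ x. ennreal (w x * \<bar>u x\<bar> powr p) \<partial>lebesgue) \<le> ennreal (emb_const * \<Lambda> * E u)" .
  have le_norm: "(\<integral>\<^sup>+ x. ennreal (norm (w x * \<bar>u x\<bar> powr p)) \<partial>lebesgue) \<le> ennreal (emb_const * \<Lambda> * E u)"
    using le w by (simp add: abs_mult)
  show int: "integrable lebesgue (\<lambda>x. w x * \<bar>u x\<bar> powr p)"
    by (rule integrableI_bounded) (use le_norm in \<open>auto intro: order_le_less_trans\<close>)
  have "ennreal (LINT x|lebesgue. w x * \<bar>u x\<bar> powr p) \<le> ennreal (emb_const * \<Lambda> * E u)"
    using le nn_integral_eq_integral[OF int] w by simp
  then show "(LINT x|lebesgue. w x * \<bar>u x\<bar> powr p) \<le> emb_const * (LINT x|lebesgue. w x powr r) powr (1 / r) * E u"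
    using \<Lambda> energy_nonneg[OF u] emb_const_pos by (subst (asm) ennreal_le_iff) (auto simp: \<Lambda>_def)
qed

lemma wpow_integrable: "u \<in> W \<Longrightarrow> integrable lebesgue (\<lambda>x. wt x * \<bar>u x\<bar> powr p)"
  by (rule embedding(1)) (use wt_powr_integrable in auto)

lemma wpow_pos: "u \<in> W \<Longrightarrow> \<not> (AE x in lebesgue. u x = 0) \<Longrightarrow> wpow u > 0"
proof -
  assume u: "u \<in> W" "\<not> (AE x in lebesgue. u x = 0)"
  have "wpow u \<noteq> 0"
  proof
    assume "wpow u = 0"
    then have "AE x in lebesgue. wt x * \<bar>u x\<bar> powr p = 0"
      unfolding wpow_def using wpow_integrable[OF u(1)] by (subst (asm) integral_nonneg_eq_0_iff_AE) auto
    with W_D(4)[OF u(1)] wt_pos have "AE x in lebesgue. u x = 0"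
      by eventually_elim auto
    with u(2) show False by simp
  qed
  then show "wpow u > 0" using wpow_nonneg[of u] by linarith
qed

lemma lambda1_wpow_le: "w \<in> W \<Longrightarrow> lambda1 s p \<Omega> V * wpow w \<le> E w"
  using lambda1_le[of w] energy_nonneg[of w] wpow_nonneg[of w] by (cases "wpow w = 0") (auto simp: field_simps less_le)

lemma ex_nonzero: "\<exists>w\<in>W. wpow w > 0"
proof -
  obtain \<phi> M where \<phi>: "\<phi> \<in> W" "\<And>x. 0 \<le> \<phi> x" "\<And>x. \<phi> x \<le> M" "\<And>x. x \<in> \<Omega> \<Longrightarrow> 0 < \<phi> x"
    using infdist_in_W0[OF s01 p1 open_\<Omega> bounded_\<Omega>] by metis
  have "\<not> (AE x in lebesgue. \<phi> x = 0)"
  proof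
    assume "AE x in lebesgue. \<phi> x = 0"
    then have "AE x in lebesgue. x \<notin> \<Omega>" by eventually_elim (use \<phi>(4) in force)
    then have "\<Omega> \<in> null_sets lebesgue"
      using open_\<Omega> by (subst (asm) AE_iff_null_sets[symmetric]) auto
    then have "negligible \<Omega>" by (simp add: negligible_iff_null_sets)
    then show False using open_not_negligible[OF open_\<Omega> nonempty_\<Omega>] by simp
  qed
  then show ?thesis using wpow_pos[OF \<phi>(1)] \<phi>(1) by blast
qed

lemma lambda1_nonneg: "lambda1 s p \<Omega> V \<ge> 0"
  unfolding lambda1_eq
  by (rule cInf_greatest) (use ex_nonzero energy_nonneg in \<open>auto simp: quotients_def\<close>)

text \<open>The functional E - \<lambda>1 wpow is nonnegative on the whole space and not positive at
  u. Its one-sided derivatives at u in the directions v and -v are therefore nonnegative, which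
  gives the equation.\<close>

lemma minimizer_weak_solution:
  assumes u: "u \<in> W" and min: "E u \<le> lambda1 s p \<Omega> V * wpow u"
  shows "weak_solution (lambda1 s p \<Omega> V) u"
proof -
  define \<nu> where "\<nu> = lambda1 s p \<Omega> V"
  have ge: "\<nu> * wform u v \<le> bform u v" if v: "v \<in> W" for v
  proof -
    note [measurable] = W_D(1)[OF u] W_D(1)[OF v]
    define t where "t n = inverse (real (Suc n))" for n
    have t: "t n > 0" for n by (simp add: t_def)
    \<comment> \<open>The p-th root of the weight is multiplied into the functions, so that the
      weighted term also falls under \<open>integral_abs_powr_first_variation\<close>.\<close>
    define c where "c x = wt x powr (1 / p)" for x
    have cp: "\<bar>c x * y\<bar> powr p = wt x * \<bar>y\<bar> powr p" for x y
      using p1 by (simp add: c_def abs_mult powr_mult powr_powr)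
    have [measurable]: "c \<in> borel_measurable lebesgue" unfolding c_def[abs_def] by measurable
    have uv: "(\<lambda>x. u x + t n * v x) \<in> W" for n using W_lin[OF u v, of 1 "t n"] by simp
    have L1: "(\<lambda>n. ((LINT z|lebesgue. \<bar>dq u z + t n * dq v z\<bar> powr p) - (LINT z|lebesgue. \<bar>dq u z\<bar> powr p)) / t n)
        \<longlonglongrightarrow> p * (LINT z|lebesgue. psi p (dq u z) * dq v z)"
      unfolding t_def by (rule integral_abs_powr_first_variation[OF p1]) (use W_D(3) u v in auto)
    have L2: "(\<lambda>n. ((LINT x|lebesgue. \<bar>u x + t n * v x\<bar> powr p) - (LINT x|lebesgue. \<bar>u x\<bar> powr p)) / t n)
        \<longlonglongrightarrow> p * (LINT x|lebesgue. psi p (u x) * v x)"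
      unfolding t_def by (rule integral_abs_powr_first_variation[OF p1]) (use W_D(2) u v in auto)
    have L3: "(\<lambda>n. ((LINT x|lebesgue. \<bar>c x * u x + t n * (c x * v x)\<bar> powr p) - (LINT x|lebesgue. \<bar>c x * u x\<bar> powr p)) / t n)
        \<longlonglongrightarrow> p * (LINT x|lebesgue. psi p (c x * u x) * (c x * v x))"
      unfolding t_def by (rule integral_abs_powr_first_variation[OF p1]) (use wpow_integrable[OF u] wpow_integrable[OF v] in \<open>auto simp: cp\<close>)
    have d: "dq (\<lambda>x. u x + t n * v x) z = dq u z + t n * dq v z" for n z
      using dquot_lin[of s p 1 u "t n" v z] by simp
    have w1: "(LINT x|lebesgue. \<bar>c x * u x + t n * (c x * v x)\<bar> powr p) = wpow (\<lambda>x. u x + t n * v x)" for n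
    proof -
      have "c x * u x + t n * (c x * v x) = c x * (u x + t n * v x)" for x by (simp add: algebra_simps)
      then show ?thesis by (simp only: cp wpow_def)
    qed
    have w2: "(LINT x|lebesgue. \<bar>c x * u x\<bar> powr p) = wpow u" by (simp only: cp wpow_def)
    have w3: "(LINT x|lebesgue. psi p (c x * u x) * (c x * v x)) = wform u v"
    proof -
      have eq: "psi p (c x * u x) * (c x * v x) = wt x * (psi p (u x) * v x)" for x
      proof -
        have "psi p (c x * u x) * (c x * v x) = (psi p (c x) * c x) * (psi p (u x) * v x)"
          by (simp add: psi_mult)
        also have "psi p (c x) * c x = wt x" using cp[of x 1] by (simp add: psi_mult_self)
        finally show ?thesis .
      qed
      show ?thesis unfolding wform_def eq ..
    qed
    have lim: "(\<lambda>n. Ks_const TYPE('a) s p * (((LINT z|lebesgue. \<bar>dq u z + t n * dq v z\<bar> powr p) - (LINT z|lebesgue. \<bar>dq u z\<bar> powr p)) / t n)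
        + ((LINT x|lebesgue. \<bar>u x + t n * v x\<bar> powr p) - (LINT x|lebesgue. \<bar>u x\<bar> powr p)) / t n
        - \<nu> * ((wpow (\<lambda>x. u x + t n * v x) - wpow u) / t n))
        \<longlonglongrightarrow> Ks_const TYPE('a) s p * (p * (LINT z|lebesgue. psi p (dq u z) * dq v z)) + p * (LINT x|lebesgue. psi p (u x) * v x) - \<nu> * (p * wform u v)"
      using L3 unfolding w1 w2 w3 by (intro tendsto_intros L1 L2)
    have nonneg: "0 \<le> Ks_const TYPE('a) s p * (((LINT z|lebesgue. \<bar>dq u z + t n * dq v z\<bar> powr p) - (LINT z|lebesgue. \<bar>dq u z\<bar> powr p)) / t n)
        + ((LINT x|lebesgue. \<bar>u x + t n * v x\<bar> powr p) - (LINT x|lebesgue. \<bar>u x\<bar> powr p)) / t n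
        - \<nu> * ((wpow (\<lambda>x. u x + t n * v x) - wpow u) / t n)" (is "0 \<le> ?X") for n
    proof -
      have "?X = ((E (\<lambda>x. u x + t n * v x) - \<nu> * wpow (\<lambda>x. u x + t n * v x)) - (E u - \<nu> * wpow u)) / t n"
        unfolding energy_eq[OF uv] energy_eq[OF u] d using t[of n] by (simp add: field_simps)
      moreover have "E (\<lambda>x. u x + t n * v x) - \<nu> * wpow (\<lambda>x. u x + t n * v x) \<ge> 0" "E u - \<nu> * wpow u \<le> 0"
        using lambda1_wpow_le[OF uv] min by (auto simp: \<nu>_def)
      ultimately show ?thesis using t[of n] by (auto intro!: divide_nonneg_pos)
    qed
    have "0 \<le> Ks_const TYPE('a) s p * (p * (LINT z|lebesgue. psi p (dq u z) * dq v z)) + p * (LINT x|lebesgue. psi p (u x) * v x) - \<nu> * (p * wform u v)"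
      by (rule LIMSEQ_le_const[OF lim]) (use nonneg in auto)
    also have "\<dots> = p * (bform u v - \<nu> * wform u v)" by (simp add: bform_def algebra_simps)
    finally show ?thesis using p0 by (simp add: zero_le_mult_iff)
  qed
  have "bform u v = \<nu> * wform u v" if v: "v \<in> W" for v
  proof -
    have v': "(\<lambda>x. - v x) \<in> W" using W_scale[OF v, of "- 1"] by simp
    have "dq (\<lambda>x. - v x) z = - dq v z" for z using dquot_lin[of s p "- 1" v 0 v z] by simp
    then have "bform u (\<lambda>x. - v x) = - bform u v" "wform u (\<lambda>x. - v x) = - wform u v"
      by (simp_all add: bform_def wform_def)
    then show ?thesis using ge[OF v] ge[OF v'] by simp
  qed
  then show ?thesis using u by (simp add: weak_solution_def \<nu>_def)
qed

text \<open>By the two-part estimate with (1, 0) and (0, 1), both parts of u are minimisers and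
  hence nonnegative weak solutions; whichever is nonzero is positive almost everywhere in
  \<Omega>.\<close>

lemma first_eigenfunction_sign:
  assumes u: "weak_solution (lambda1 s p \<Omega> V) u" and nz: "\<not> (AE x in lebesgue. u x = 0)"
  shows "(AE x in lebesgue. x \<in> \<Omega> \<longrightarrow> u x > 0) \<or> (AE x in lebesgue. x \<in> \<Omega> \<longrightarrow> u x < 0)"
proof -
  have uW: "u \<in> W" using u by (simp add: weak_solution_def)
  note parts = weak_solution_two_parts(1)[OF u wpow_integrable[OF uW]]
  have P: "weak_solution (lambda1 s p \<Omega> V) (\<lambda>x. max (u x) 0)"
    by (rule minimizer_weak_solution[OF W_pos[OF uW]]) (use parts[of 1 0] in simp)
  have N: "weak_solution (lambda1 s p \<Omega> V) (\<lambda>x. max (- u x) 0)"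
    by (rule minimizer_weak_solution[OF W_neg[OF uW]]) (use parts[of 0 1] in simp)
  show ?thesis
  proof (cases "AE x in lebesgue. max (u x) 0 = 0")
    case False
    have "AE x in lebesgue. x \<in> \<Omega> \<longrightarrow> max (u x) 0 > 0"
      by (rule nonneg_weak_solution_pos[OF P _ False]) simp
    then have "AE x in lebesgue. x \<in> \<Omega> \<longrightarrow> u x > 0" by eventually_elim auto
    then show ?thesis ..
  next
    case True
    have False': "\<not> (AE x in lebesgue. max (- u x) 0 = 0)"
    proof
      assume "AE x in lebesgue. max (- u x) 0 = 0"
      with True have "AE x in lebesgue. u x = 0" by eventually_elim auto
      with nz show False by simp
    qed
    have "AE x in lebesgue. x \<in> \<Omega> \<longrightarrow> max (- u x) 0 > 0"
      by (rule nonneg_weak_solution_pos[OF N _ False']) simp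
    then have "AE x in lebesgue. x \<in> \<Omega> \<longrightarrow> u x < 0" by eventually_elim auto
    then show ?thesis ..
  qed
qed

text \<open>By the embedding, the negative parts of higher eigenfunctions live on sets that carry a
  fixed amount of \<open>V\<^sup>r\<close>, so eigenfunctions cannot approach a positive limit.\<close>

lemma no_positive_limit:
  assumes u: "\<And>n. weak_solution (\<mu> n) (u n)" "\<And>n. \<not> (AE x in lebesgue. u n x = 0)"
    and \<mu>: "\<And>n. \<mu> n \<noteq> lambda1 s p \<Omega> V" "\<And>n. \<mu> n \<le> B"
    and lim: "AE x in lebesgue. (\<lambda>n. u n x) \<longlonglongrightarrow> l x" and l: "AE x in lebesgue. x \<in> \<Omega> \<longrightarrow> l x > 0"
  shows False
proof -
  have uW: "u n \<in> W" for n using u(1) by (simp add: weak_solution_def)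
  note [measurable] = W_D(1)[OF uW]
  define N where "N n x = max (- u n x) 0" for n x
  have N: "N n \<in> W" for n unfolding N_def[abs_def] by (rule W_neg[OF uW])
  have nzN: "\<not> (AE x in lebesgue. N n x = 0)" for n
    unfolding N_def by (rule higher_eigenfunction_sign_change[OF u \<mu>(1)])
  \<comment> \<open>The negative part of \<open>u n\<close> sees only this portion of the weight,
    whose \<open>L^r\<close> norm tends to 0 by dominated convergence.\<close>
  define w where "w n x = wt x * indicator {x. u n x < 0} x" for n x
  have [measurable]: "w n \<in> borel_measurable lebesgue" for n unfolding w_def[abs_def] by measurable
  have w0: "w n x \<ge> 0" for n x by (simp add: w_def)
  have wle: "w n x powr r \<le> wt x powr r" for n x
    using r1 by (auto simp: w_def indicator_def)
  have wr: "integrable lebesgue (\<lambda>x. w n x powr r)" for n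
    by (rule Bochner_Integration.integrable_bound[OF wt_powr_integrable]) (use wle in auto)
  have "(\<lambda>n. LINT x|lebesgue. w n x powr r) \<longlonglongrightarrow> (LINT x|(lebesgue :: 'a measure). (0 :: real))"
  proof (rule integral_dominated_convergence[OF _ _ wt_powr_integrable])
    show "AE x in lebesgue. (\<lambda>n. w n x powr r) \<longlonglongrightarrow> 0"
      using lim l
    proof eventually_elim
      case (elim x)
      show ?case
      proof (cases "x \<in> \<Omega>")
        case True
        then have "eventually (\<lambda>n. u n x > 0) sequentially"
          using elim by (intro order_tendstoD(1)[OF elim(1)]) auto
        then have "eventually (\<lambda>n. w n x powr r = 0) sequentially"
          by eventually_elim (simp add: w_def)
        then show ?thesis by (rule tendsto_eventually)
      qed (simp add: w_def wt_def)
    qed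
  qed (use wle in auto)
  then have "(\<lambda>n. B * emb_const * (LINT x|lebesgue. w n x powr r) powr (1 / r)) \<longlonglongrightarrow> B * emb_const * 0 powr (1 / r)"
    using r1 by (intro tendsto_mult_left tendsto_powr' tendsto_const) auto
  then have "eventually (\<lambda>n. B * emb_const * (LINT x|lebesgue. w n x powr r) powr (1 / r) < 1) sequentially"
    by (intro order_tendstoD(2)) auto
  then obtain n where n: "B * emb_const * (LINT x|lebesgue. w n x powr r) powr (1 / r) < 1"
    by (auto simp: eventually_sequentially)
  have EN: "E (N n) > 0" by (rule energy_pos[OF N nzN])
  have \<mu>pos: "\<mu> n > 0" by (rule weak_solution_pos(1)[OF u])
  \<comment> \<open>Testing with the negative part and then embedding gives E (N n) < E (N n) once
    the norm of \<open>w n\<close> is small.\<close>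
  have "E (N n) \<le> \<mu> n * wpow (N n)"
    using weak_solution_two_parts(1)[OF u(1)[of n] wpow_integrable[OF uW[of n]], of 0 1] by (simp add: N_def[abs_def])
  also have "wpow (N n) = (LINT x|lebesgue. w n x * \<bar>N n x\<bar> powr p)"
    unfolding wpow_def by (rule Bochner_Integration.integral_cong) (auto simp: w_def N_def indicator_def max_def)
  also have "\<mu> n * \<dots> \<le> B * (emb_const * (LINT x|lebesgue. w n x powr r) powr (1 / r) * E (N n))"
    using \<mu>(2)[of n] \<mu>pos w0 by (intro mult_mono embedding(2)[OF N _ w0 wr]) auto
  also have "\<dots> = (B * emb_const * (LINT x|lebesgue. w n x powr r) powr (1 / r)) * E (N n)"
    by (simp add: mult_ac)
  also have "\<dots> < 1 * E (N n)" using n EN by (intro mult_strict_right_mono)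
  finally show False by simp
qed

end

subsection \<open>Compactness and isolation of the first eigenvalue\<close>

text \<open>From |t| \<le> 1 + |t|^p and cells of volume at most 1. The bound depends neither on the
  cell nor on its level.\<close>

lemma abs_cell_integral_le:
  fixes u :: "'a::euclidean_space \<Rightarrow> real"
  assumes p: "p \<ge> 1" and [measurable]: "u \<in> borel_measurable borel"
    and L: "(\<integral>\<^sup>+ y. ennreal (\<bar>u y\<bar> powr p) \<partial>lborel) \<le> ennreal L" "L \<ge> 0"
  shows "\<bar>LINT y|lborel. indicator (cell k x) y * u y\<bar> \<le> 1 + L"
proof -
  define m where "m = (1 / 2 ^ k :: real) ^ DIM('a)"
  have m: "emeasure lborel (cell k x) = ennreal m" "0 \<le> m" "m \<le> 1"
    by (auto simp: emeasure_cell m_def power_one_over intro!: power_le_one one_le_power)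
  have le: "(\<integral>\<^sup>+ y. indicator (cell k x) y * ennreal (\<bar>u y\<bar> powr p) \<partial>lborel) \<le> ennreal L"
    by (rule order_trans[OF nn_integral_mono L(1)]) (auto simp: indicator_def)
  have I: "integrable lborel (\<lambda>y. indicator (cell k x) y * u y)" "integrable lborel (\<lambda>y. indicator (cell k x) y * \<bar>u y\<bar> powr p)"
    using integrable_on_finite_if_powr[of p "cell k x" lborel u] p m le by (auto simp: order_le_less_trans)
  have one: "integrable lborel (indicator (cell k x) :: 'a \<Rightarrow> real)" "(LINT y|lborel. indicator (cell k x) y) = m"
    using m by (auto simp: measure_def)
  have "\<bar>LINT y|lborel. indicator (cell k x) y * u y\<bar> \<le> (LINT y|lborel. \<bar>indicator (cell k x) y * u y\<bar>)"
    by (rule integral_abs_bound)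
  also have "\<dots> \<le> (LINT y|lborel. indicator (cell k x) y + indicator (cell k x) y * \<bar>u y\<bar> powr p)"
  proof (rule integral_mono)
    show "integrable lborel (\<lambda>y. \<bar>indicator (cell k x) y * u y\<bar>)" using I by auto
    show "integrable lborel (\<lambda>y. indicator (cell k x) y + indicator (cell k x) y * \<bar>u y\<bar> powr p)" using I one by auto
    have "\<bar>t\<bar> \<le> 1 + \<bar>t\<bar> powr p" for t :: real
    proof (cases "\<bar>t\<bar> \<le> 1")
      case False
      then have "\<bar>t\<bar> powr 1 \<le> \<bar>t\<bar> powr p" using p by (intro powr_mono) auto
      then show ?thesis by simp
    qed (simp add: add_increasing2)
    then show "\<bar>indicator (cell k x) y * u y\<bar> \<le> indicator (cell k x) y + indicator (cell k x) y * \<bar>u y\<bar> powr p" for y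
      by (auto simp: indicator_def)
  qed
  also have "\<dots> = m + (LINT y|lborel. indicator (cell k x) y * \<bar>u y\<bar> powr p)"
    using I one by simp
  also have "(LINT y|lborel. indicator (cell k x) y * \<bar>u y\<bar> powr p) \<le> L"
  proof -
    have "ennreal (LINT y|lborel. indicator (cell k x) y * \<bar>u y\<bar> powr p) = (\<integral>\<^sup>+ y. ennreal (indicator (cell k x) y * \<bar>u y\<bar> powr p) \<partial>lborel)"
      by (rule nn_integral_eq_integral[symmetric]) (use I in auto)
    also have "\<dots> = (\<integral>\<^sup>+ y. indicator (cell k x) y * ennreal (\<bar>u y\<bar> powr p) \<partial>lborel)"
      by (intro nn_integral_cong) (auto simp: indicator_def)
    also have "\<dots> \<le> ennreal L" by (rule le)
    finally show ?thesis using L(2) by (simp add: ennreal_le_iff)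
  qed
  finally show ?thesis using m(3) by linarith
qed

text \<open>The integrals over the countably many cells of all levels are uniformly bounded, so a
  diagonal subsequence converges on every cell, and with it every average at every point.\<close>

lemma cavg_convergent_subsequence:
  fixes u :: "nat \<Rightarrow> 'a::euclidean_space \<Rightarrow> real"
  assumes p: "p \<ge> 1" and [measurable]: "\<And>n. u n \<in> borel_measurable borel"
    and L: "\<And>n. (\<integral>\<^sup>+ y. ennreal (\<bar>u n y\<bar> powr p) \<partial>lborel) \<le> ennreal L" "L \<ge> 0"
  shows "\<exists>\<kappa> :: nat \<Rightarrow> nat. strict_mono \<kappa> \<and> (\<forall>k x. convergent (\<lambda>n. cavg k (u (\<kappa> n)) x))"
proof -
  define S where "S = (\<Union>k. range (cell k :: 'a \<Rightarrow> 'a set))"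
  have cS: "countable S" unfolding S_def by (intro countable_UN countable_range_cell) auto
  define f where "f n C = (LINT y|lborel. indicator C y * u n y)" for n C
  have bound: "norm (f n C) \<le> 1 + L" if "C \<in> S" for n C
    using that abs_cell_integral_le[OF p _ L] by (auto simp: S_def f_def)
  obtain \<kappa> where \<kappa>: "strict_mono \<kappa>" "\<And>C. C \<in> S \<Longrightarrow> \<exists>l. (\<lambda>n. f (\<kappa> n) C) \<longlonglongrightarrow> l"
    using function_convergent_subsequence[of S f "1 + L", OF cS bound] by blast
  have "convergent (\<lambda>n. cavg k (u (\<kappa> n)) x)" for k x
  proof -
    obtain l where "(\<lambda>n. LINT y|lborel. indicator (cell k x) y * u (\<kappa> n) y) \<longlonglongrightarrow> l"
      using \<kappa>(2)[of "cell k x"] by (auto simp: S_def f_def)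
    then have "(\<lambda>n. cavg k (u (\<kappa> n)) x) \<longlonglongrightarrow> (2 ^ k) ^ DIM('a) * l"
      unfolding cavg_def by (rule tendsto_mult_left)
    then show ?thesis by (rule convergentI)
  qed
  with \<kappa>(1) show ?thesis by blast
qed

lemma tendsto_zero_AE_subseq:
  fixes f :: "nat \<Rightarrow> 'b \<Rightarrow> real"
  assumes [measurable]: "\<And>n. f n \<in> borel_measurable M" and f: "\<And>n x. f n x \<ge> 0"
    and lim: "(\<lambda>n. \<integral>\<^sup>+ x. ennreal (f n x) \<partial>M) \<longlonglongrightarrow> 0"
  shows "\<exists>\<rho> :: nat \<Rightarrow> nat. strict_mono \<rho> \<and> (AE x in M. (\<lambda>n. f (\<rho> n) x) \<longlonglongrightarrow> 0)"
proof -
  have "eventually (\<lambda>n. (\<integral>\<^sup>+ x. ennreal (f n x) \<partial>M) < \<infinity>) sequentially"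
    using lim by (rule order_tendstoD(2)) simp
  then obtain n0 where n0: "\<And>n. n \<ge> n0 \<Longrightarrow> (\<integral>\<^sup>+ x. ennreal (f n x) \<partial>M) < \<infinity>"
    by (auto simp: eventually_sequentially)
  \<comment> \<open>Early terms may have infinite integral, and \<open>tendsto_L1_AE_subseq\<close>
    asks for integrability of every term.\<close>
  define g where "g n = f (n0 + n)" for n
  have g: "integrable M (g n)" for n
    using n0[of "n0 + n"] f unfolding g_def by (intro integrableI_bounded) auto
  have "(\<lambda>n. LINT x|M. norm (g n x)) \<longlonglongrightarrow> 0"
  proof -
    have "(\<lambda>n. \<integral>\<^sup>+ x. ennreal (g n x) \<partial>M) \<longlonglongrightarrow> 0"
      using LIMSEQ_ignore_initial_segment[OF lim, of n0] by (simp add: g_def add.commute)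
    moreover have "(\<integral>\<^sup>+ x. ennreal (g n x) \<partial>M) = ennreal (LINT x|M. norm (g n x))" for n
      using nn_integral_eq_integral[OF g] f by (simp add: g_def)
    ultimately have "(\<lambda>n. ennreal (LINT x|M. norm (g n x))) \<longlonglongrightarrow> ennreal 0" by simp
    then show ?thesis by (subst (asm) tendsto_ennreal_iff) auto
  qed
  from tendsto_L1_AE_subseq[OF g this] obtain \<rho> where \<rho>: "strict_mono \<rho>" "AE x in M. (\<lambda>n. g (\<rho> n) x) \<longlonglongrightarrow> 0"
    by auto
  have "strict_mono (\<lambda>n. n0 + \<rho> n)" using \<rho>(1) by (simp add: strict_mono_def)
  with \<rho>(2) show ?thesis by (intro exI[of _ "\<lambda>n. n0 + \<rho> n"]) (simp add: g_def)
qed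

lemma ennreal_tendsto_zeroI:
  fixes T :: "nat \<Rightarrow> ennreal"
  assumes "\<And>e. e > 0 \<Longrightarrow> eventually (\<lambda>n. T n \<le> ennreal e) sequentially"
  shows "T \<longlonglongrightarrow> 0"
proof (rule order_tendstoI)
  fix y :: ennreal assume "0 < y"
  then obtain z where z: "0 < z" "z < y" using dense by blast
  then obtain e where e: "z = ennreal e" "e > 0"
    by (cases z) (auto simp: ennreal_less_zero_iff)
  show "eventually (\<lambda>n. T n < y) sequentially"
    using assms[OF e(2)] by eventually_elim (use z e in auto)
qed simp

lemma nn_integral_affine:
  assumes [measurable]: "f \<in> borel_measurable M" "g \<in> borel_measurable M" "h \<in> borel_measurable M"
  shows "(\<integral>\<^sup>+ x. c * (d * (f x + g x) + h x) \<partial>M) = c * (d * ((\<integral>\<^sup>+ x. f x \<partial>M) + (\<integral>\<^sup>+ x. g x \<partial>M)) + (\<integral>\<^sup>+ x. h x \<partial>M))"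
  by (simp add: nn_integral_cmult nn_integral_add)

text \<open>The difference u_n - l is split at level k into u_n minus its average, the average minus
  its limit \<open>a k\<close>, and \<open>a k\<close> minus l. The outer two are small uniformly in
  n for large k by chaining; the middle one tends to 0 for fixed k. The increments of
  \<open>a\<close> inherit the decay from those of the averages by Fatou.\<close>

lemma weighted_cavg_limit:
  fixes u :: "nat \<Rightarrow> 'a::euclidean_space \<Rightarrow> real"
  assumes sp: "s > 0" "p > 1" and r: "r > 1" "r * (s * p) > real DIM('a)"
    and [measurable]: "\<And>n. u n \<in> borel_measurable borel" "v \<in> borel_measurable borel"
    and L: "\<And>n. (\<integral>\<^sup>+ y. ennreal (\<bar>u n y\<bar> powr p) \<partial>lborel) \<le> ennreal L" "L \<ge> 0"
    and G: "\<And>n. (\<integral>\<^sup>+ z. ennreal (gagliardo_integrand s p (u n) z) \<partial>lebesgue) \<le> ennreal G" "G \<ge> 0"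
    and v: "\<And>x. v x \<ge> 0" and v1: "(\<integral>\<^sup>+ x. ennreal (v x) \<partial>lborel) < \<infinity>"
    and \<Lambda>: "(\<integral>\<^sup>+ x. ennreal (v x powr r) \<partial>lborel) \<le> ennreal (\<Lambda> powr r)" "\<Lambda> \<ge> 0"
    and conv: "\<And>k x. convergent (\<lambda>n. cavg k (u n) x)"
  shows "\<exists>l \<in> borel_measurable borel.
    (\<lambda>n. \<integral>\<^sup>+ x. ennreal (v x) * ennreal (\<bar>u n x - l x\<bar> powr p) \<partial>lborel) \<longlonglongrightarrow> 0"
proof -
  have int: "(\<integral>\<^sup>+ y. ennreal (\<bar>u n y\<bar> powr p) \<partial>lborel) < \<infinity>" for n
    using L(1) by (rule order_le_less_trans) simp
  define q where "q = 2 powr (- (s * p - real DIM('a) / r))"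
  have q: "0 < q" "q < 1" unfolding q_def by (rule dyadic_ratio[OF r])+
  define A where "A = (2 * real DIM('a)) powr (real DIM('a) + s * p) * 2 powr (real DIM('a) / r) * \<Lambda> * G"
  have A: "A \<ge> 0" using \<Lambda> G by (simp add: A_def)
  define M where "M = density lborel (\<lambda>x. ennreal (v x))"
  have setsM [measurable_cong]: "sets M = sets borel" by (simp add: M_def)
  have inM: "(\<integral>\<^sup>+ x. f x \<partial>M) = (\<integral>\<^sup>+ x. ennreal (v x) * f x \<partial>lborel)" if "f \<in> borel_measurable borel" for f
    unfolding M_def using that by (subst nn_integral_density) auto
  define a where "a k x = lim (\<lambda>n. cavg k (u n) x)" for k x
  have a: "(\<lambda>n. cavg k (u n) x) \<longlonglongrightarrow> a k x" for k x
    unfolding a_def using conv convergent_LIMSEQ_iff by blast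
  have a_meas [measurable]: "a k \<in> borel_measurable borel" for k
    by (rule borel_measurable_LIMSEQ_real[OF a]) simp
  have incr: "(\<integral>\<^sup>+ x. ennreal (\<bar>a (Suc k) x - a k x\<bar> powr p) \<partial>M) \<le> ennreal (A * q ^ k)" for k
  proof -
    have "(\<integral>\<^sup>+ x. ennreal (\<bar>a (Suc k) x - a k x\<bar> powr p) \<partial>M)
        = (\<integral>\<^sup>+ x. liminf (\<lambda>n. ennreal (\<bar>cavg (Suc k) (u n) x - cavg k (u n) x\<bar> powr p)) \<partial>M)"
    proof (rule nn_integral_cong)
      fix x
      have "(\<lambda>n. ennreal (\<bar>cavg (Suc k) (u n) x - cavg k (u n) x\<bar> powr p)) \<longlonglongrightarrow> ennreal (\<bar>a (Suc k) x - a k x\<bar> powr p)"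
        using sp by (intro tendsto_ennrealI tendsto_powr' tendsto_intros a) auto
      then show "ennreal (\<bar>a (Suc k) x - a k x\<bar> powr p) = liminf (\<lambda>n. ennreal (\<bar>cavg (Suc k) (u n) x - cavg k (u n) x\<bar> powr p))"
        by (intro lim_imp_Liminf[symmetric]) auto
    qed
    also have "\<dots> \<le> liminf (\<lambda>n. \<integral>\<^sup>+ x. ennreal (\<bar>cavg (Suc k) (u n) x - cavg k (u n) x\<bar> powr p) \<partial>M)"
      by (rule nn_integral_liminf) measurable
    also have "\<dots> \<le> ennreal (A * q ^ k)"
    proof (rule Liminf_le)
      have "(\<integral>\<^sup>+ x. ennreal (\<bar>cavg (Suc k) (u n) x - cavg k (u n) x\<bar> powr p) \<partial>M) \<le> ennreal (A * q ^ k)" for n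
        unfolding A_def q_def using cavg_increment_le[OF sp r(1) _ _ int v \<Lambda> G, of n k]
        by (subst inM) auto
      then show "\<forall>\<^sub>F n in sequentially. (\<integral>\<^sup>+ x. ennreal (\<bar>cavg (Suc k) (u n) x - cavg k (u n) x\<bar> powr p) \<partial>M) \<le> ennreal (A * q ^ k)"
        by (intro always_eventually allI)
    qed simp
    finally show ?thesis .
  qed
  define l where "l x = lim (\<lambda>k. a k x)" for x
  have l_meas [measurable]: "l \<in> borel_measurable borel"
    unfolding l_def[abs_def] by (rule borel_measurable_lim_metric) simp
  have p1: "p \<ge> 1" using sp by simp
  have aM: "a k \<in> borel_measurable M" for k by measurable
  have "AE x in M. convergent (\<lambda>k. a k x)"
    by (rule chaining(1)[OF p1 q A aM incr])
  then have "AE x in M. (\<lambda>k. a k x) \<longlonglongrightarrow> l x"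
    by eventually_elim (simp add: l_def convergent_LIMSEQ_iff)
  note tail = chaining(2)[OF p1 q A aM incr this]
  define D where "D = (1 / (1 - q powr (1 / (2 * p)))) powr p * A / (1 - sqrt q)"
  define C where "C = cavg_const (real DIM('a)) s p r * \<Lambda> * G"
  have "sqrt q < 1" using q by (simp add: real_sqrt_lt_1_iff)
  then have D: "D \<ge> 0" using A by (simp add: D_def)
  have C: "C \<ge> 0" using cavg_const_nonneg[OF r] \<Lambda> G by (simp add: C_def)
  define b where "b k n = (\<integral>\<^sup>+ x. ennreal (\<bar>cavg k (u n) x - a k x\<bar> powr p) \<partial>M)" for k n
  have b: "b k \<longlonglongrightarrow> 0" for k
  proof -
    \<comment> \<open>Averages of a fixed level are bounded uniformly, and constants are integrable
      because v dx is a finite measure: this is the majorant.\<close>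
    define B where "B = (2 ^ k) ^ DIM('a) * (1 + L)"
    have cB: "\<bar>cavg k (u n) x\<bar> \<le> B" for n x
      using abs_cell_integral_le[OF p1 _ L, of n k x] unfolding cavg_def B_def
      by (auto simp: abs_mult intro!: mult_left_mono)
    have aB: "\<bar>a k x\<bar> \<le> B" for x
      by (rule LIMSEQ_le_const2[OF tendsto_rabs[OF a]]) (use cB in auto)
    have "(\<lambda>n. \<integral>\<^sup>+ x. ennreal (\<bar>cavg k (u n) x - a k x\<bar> powr p) \<partial>M) \<longlonglongrightarrow> (\<integral>\<^sup>+ x. 0 \<partial>M)"
    proof (rule nn_integral_dominated_convergence[where w = "\<lambda>x. ennreal ((2 * B) powr p)"])
      show "AE x in M. ennreal (\<bar>cavg k (u n) x - a k x\<bar> powr p) \<le> ennreal ((2 * B) powr p)" for n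
      proof (rule AE_I2)
        fix x
        have "\<bar>cavg k (u n) x - a k x\<bar> \<le> 2 * B" using cB[of n x] aB[of x] by linarith
        then show "ennreal (\<bar>cavg k (u n) x - a k x\<bar> powr p) \<le> ennreal ((2 * B) powr p)"
          using sp by (intro ennreal_leI powr_mono2) auto
      qed
      have "(\<integral>\<^sup>+ x. ennreal ((2 * B) powr p) \<partial>M) = (\<integral>\<^sup>+ x. ennreal (v x) * ennreal ((2 * B) powr p) \<partial>lborel)"
        by (rule inM) simp
      also have "\<dots> = (\<integral>\<^sup>+ x. ennreal (v x) \<partial>lborel) * ennreal ((2 * B) powr p)"
        by (rule nn_integral_multc) simp
      also have "\<dots> < \<infinity>" using v1 by (simp add: ennreal_mult_less_top)
      finally show "(\<integral>\<^sup>+ x. ennreal ((2 * B) powr p) \<partial>M) < \<infinity>" .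
      show "AE x in M. (\<lambda>n. ennreal (\<bar>cavg k (u n) x - a k x\<bar> powr p)) \<longlonglongrightarrow> 0"
      proof (rule AE_I2)
        fix x
        have "(\<lambda>n. ennreal (\<bar>cavg k (u n) x - a k x\<bar> powr p)) \<longlonglongrightarrow> ennreal (\<bar>a k x - a k x\<bar> powr p)"
          using sp by (intro tendsto_ennrealI tendsto_powr' tendsto_intros a) auto
        then show "(\<lambda>n. ennreal (\<bar>cavg k (u n) x - a k x\<bar> powr p)) \<longlonglongrightarrow> 0" using sp by simp
      qed
    qed measurable
    then show ?thesis by (simp add: b_def[abs_def])
  qed
  have main: "(\<integral>\<^sup>+ x. ennreal (\<bar>u n x - l x\<bar> powr p) \<partial>M)
      \<le> ennreal (2 powr p) * (ennreal (2 powr p) * (ennreal (C * q ^ k) + b k n) + ennreal (D * q ^ k))" for n k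
  proof -
    have 1: "(\<integral>\<^sup>+ x. ennreal (\<bar>u n x - cavg k (u n) x\<bar> powr p) \<partial>M) \<le> ennreal (C * q ^ k)"
      unfolding C_def q_def using cavg_approximation[OF sp r _ _ int v \<Lambda> G, of n k] by (subst inM) auto
    have 3: "(\<integral>\<^sup>+ x. ennreal (\<bar>a k x - l x\<bar> powr p) \<partial>M) \<le> ennreal (D * q ^ k)"
      using tail[of k] by (simp add: D_def abs_minus_commute mult_ac)
    have pt: "ennreal (\<bar>u n x - l x\<bar> powr p) \<le> ennreal (2 powr p) * (ennreal (2 powr p) *
      (ennreal (\<bar>u n x - cavg k (u n) x\<bar> powr p) + ennreal (\<bar>cavg k (u n) x - a k x\<bar> powr p)) + ennreal (\<bar>a k x - l x\<bar> powr p))" for x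
    proof -
      have "\<bar>u n x - l x\<bar> powr p \<le> 2 powr p * (\<bar>u n x - a k x\<bar> powr p + \<bar>a k x - l x\<bar> powr p)"
        using abs_add_powr_le2[OF p1, of "u n x - a k x" "a k x - l x"] by simp
      also have "\<dots> \<le> 2 powr p * (2 powr p * (\<bar>u n x - cavg k (u n) x\<bar> powr p + \<bar>cavg k (u n) x - a k x\<bar> powr p) + \<bar>a k x - l x\<bar> powr p)"
        using abs_add_powr_le2[OF p1, of "u n x - cavg k (u n) x" "cavg k (u n) x - a k x"]
        by (intro mult_left_mono add_right_mono) auto
      finally have "ennreal (\<bar>u n x - l x\<bar> powr p) \<le> ennreal (2 powr p * (2 powr p * (\<bar>u n x - cavg k (u n) x\<bar> powr p + \<bar>cavg k (u n) x - a k x\<bar> powr p) + \<bar>a k x - l x\<bar> powr p))"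
        by (rule ennreal_leI)
      then show ?thesis by (simp add: ennreal_mult ennreal_plus)
    qed
    have "(\<integral>\<^sup>+ x. ennreal (\<bar>u n x - l x\<bar> powr p) \<partial>M) \<le> (\<integral>\<^sup>+ x. ennreal (2 powr p) * (ennreal (2 powr p) *
      (ennreal (\<bar>u n x - cavg k (u n) x\<bar> powr p) + ennreal (\<bar>cavg k (u n) x - a k x\<bar> powr p)) + ennreal (\<bar>a k x - l x\<bar> powr p)) \<partial>M)"
      by (intro nn_integral_mono pt)
    also have "\<dots> = ennreal (2 powr p) * (ennreal (2 powr p) * ((\<integral>\<^sup>+ x. ennreal (\<bar>u n x - cavg k (u n) x\<bar> powr p) \<partial>M) + b k n)
        + (\<integral>\<^sup>+ x. ennreal (\<bar>a k x - l x\<bar> powr p) \<partial>M))"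
      unfolding b_def by (rule nn_integral_affine) measurable
    also have "\<dots> \<le> ennreal (2 powr p) * (ennreal (2 powr p) * (ennreal (C * q ^ k) + b k n) + ennreal (D * q ^ k))"
      by (intro mult_left_mono add_mono 1 3) auto
    finally show ?thesis .
  qed
  have "(\<lambda>n. \<integral>\<^sup>+ x. ennreal (\<bar>u n x - l x\<bar> powr p) \<partial>M) \<longlonglongrightarrow> 0"
  proof (rule ennreal_tendsto_zeroI)
    fix e :: real assume e: "e > 0"
    have "(\<lambda>k. 2 powr p * (2 powr p * (C * q ^ k + q ^ k) + D * q ^ k)) \<longlonglongrightarrow> 2 powr p * (2 powr p * (C * 0 + 0) + D * 0)"
      using q by (intro tendsto_intros LIMSEQ_power_zero) auto
    then have "eventually (\<lambda>k. 2 powr p * (2 powr p * (C * q ^ k + q ^ k) + D * q ^ k) < e) sequentially"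
      using e by (intro order_tendstoD(2)) auto
    then obtain k where k: "2 powr p * (2 powr p * (C * q ^ k + q ^ k) + D * q ^ k) < e"
      by (auto simp: eventually_sequentially)
    have "eventually (\<lambda>n. b k n < ennreal (q ^ k)) sequentially"
      using q by (intro order_tendstoD(2)[OF b]) simp
    then show "eventually (\<lambda>n. (\<integral>\<^sup>+ x. ennreal (\<bar>u n x - l x\<bar> powr p) \<partial>M) \<le> ennreal e) sequentially"
    proof eventually_elim
      case (elim n)
      have "(\<integral>\<^sup>+ x. ennreal (\<bar>u n x - l x\<bar> powr p) \<partial>M)
        \<le> ennreal (2 powr p) * (ennreal (2 powr p) * (ennreal (C * q ^ k) + b k n) + ennreal (D * q ^ k))" by (rule main)
      also have "\<dots> \<le> ennreal (2 powr p) * (ennreal (2 powr p) * (ennreal (C * q ^ k) + ennreal (q ^ k)) + ennreal (D * q ^ k))"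
        using elim by (intro mult_left_mono add_mono) auto
      also have "\<dots> = ennreal (2 powr p * (2 powr p * (C * q ^ k + q ^ k) + D * q ^ k))"
        using C D q by (simp add: ennreal_mult ennreal_plus)
      also have "\<dots> \<le> ennreal e" using k by (intro ennreal_leI) simp
      finally show ?case .
    qed
  qed
  then show ?thesis
    by (intro bexI[of _ l]) (simp_all add: inM)
qed

context subcritical_weighted_problem
begin

text \<open>Strong convergence holds in the weighted space; the energy inequality comes from almost
  everywhere convergence and Fatou, on the space and on the product.\<close>

lemma compactness:
  assumes u: "\<And>n. u n \<in> W" and lim: "(\<lambda>n. E (u n)) \<longlonglongrightarrow> c"
  obtains k :: "nat \<Rightarrow> nat" and l where "strict_mono k" "l \<in> W" "AE x in lebesgue. (\<lambda>n. u (k n) x) \<longlonglongrightarrow> l x"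
    "E l \<le> c" "(\<lambda>n. wpow (\<lambda>x. u (k n) x - l x)) \<longlonglongrightarrow> 0"
proof -
  define K where "K = Ks_const TYPE('a) s p"
  have K: "K > 0" unfolding K_def by (rule K_pos)
  define G where "G n = (LINT z|lebesgue. \<bar>dq (u n) z\<bar> powr p)" for n
  define L where "L n = (LINT x|lebesgue. \<bar>u n x\<bar> powr p)" for n
  have GL0: "G n \<ge> 0" "L n \<ge> 0" for n by (auto simp: G_def L_def)
  have E_GL: "E (u n) = K * G n + L n" for n by (simp add: energy_eq[OF u] G_def L_def K_def)
  obtain B where B: "\<And>n. \<bar>E (u n)\<bar> \<le> B"
    using Bseq_eq_bounded convergent_imp_Bseq[OF convergentI[OF lim]] by (auto simp: Bseq_def)
  have GL: "G n \<le> B / K" "L n \<le> B" for n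
  proof -
    have "K * G n + L n \<le> B" using B[of n] by (simp add: E_GL)
    moreover have "0 \<le> K * G n" using GL0[of n] K by simp
    ultimately have "K * G n \<le> B" "L n \<le> B" using GL0[of n] by linarith+
    then show "G n \<le> B / K" "L n \<le> B" using K by (auto simp: field_simps)
  qed
  have B0: "B \<ge> 0" using B[of 0] by linarith
  \<comment> \<open>The two parts of the energy are made to converge separately, so that Fatou can
    be applied to each and the limits add up to \<open>c\<close>.\<close>
  have "bounded (range (\<lambda>n. (G n, L n)))"
  proof (rule bounded_subset)
    show "bounded ({0..B / K} \<times> {0..B})" by (intro bounded_Times) auto
  qed (use GL GL0 in auto)
  then obtain gl \<tau> where \<tau>: "strict_mono \<tau>" "((\<lambda>n. (G n, L n)) \<circ> \<tau>) \<longlonglongrightarrow> gl"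
    using bounded_imp_convergent_subsequence by blast
  define g where "g = fst gl"
  define b where "b = snd gl"
  have g: "(\<lambda>n. G (\<tau> n)) \<longlonglongrightarrow> g" and b: "(\<lambda>n. L (\<tau> n)) \<longlonglongrightarrow> b"
    using tendsto_fst[OF \<tau>(2)] tendsto_snd[OF \<tau>(2)] by (auto simp: g_def b_def o_def)
  have gb0: "g \<ge> 0" "b \<ge> 0"
    using LIMSEQ_le_const[OF g] LIMSEQ_le_const[OF b] GL0 by auto
  have c: "c = K * g + b"
  proof (rule LIMSEQ_unique)
    show "(\<lambda>n. E (u (\<tau> n))) \<longlonglongrightarrow> c" using LIMSEQ_subseq_LIMSEQ[OF lim \<tau>(1)] by (simp add: o_def)
    show "(\<lambda>n. E (u (\<tau> n))) \<longlonglongrightarrow> K * g + b" unfolding E_GL by (intro tendsto_intros g b)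
  qed
  have "\<exists>u'. u' \<in> borel_measurable borel \<and> (AE x in lebesgue. u (\<tau> n) x = u' x) \<and>
    (\<integral>\<^sup>+ x. ennreal (\<bar>u' x\<bar> powr p) \<partial>lborel) = ennreal (L (\<tau> n)) \<and>
    (\<integral>\<^sup>+ z. ennreal (gagliardo_integrand s p u' z) \<partial>lebesgue) = ennreal (G (\<tau> n))" for n
  proof -
    obtain w where "w \<in> borel_measurable borel" "AE x in lebesgue. u (\<tau> n) x = w x"
      "(\<integral>\<^sup>+ x. ennreal (\<bar>w x\<bar> powr p) \<partial>lborel) = ennreal (LINT x|lebesgue. \<bar>u (\<tau> n) x\<bar> powr p)"
      "(\<integral>\<^sup>+ z. ennreal (gagliardo_integrand s p w z) \<partial>lebesgue) = ennreal (LINT z|lebesgue. \<bar>dq (u (\<tau> n)) z\<bar> powr p)"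
      by (rule W_borel_version[OF u])
    then show ?thesis unfolding G_def L_def by (intro exI[of _ w] conjI)
  qed
  then obtain u' where "\<forall>n. u' n \<in> borel_measurable borel \<and> (AE x in lebesgue. u (\<tau> n) x = u' n x) \<and>
    (\<integral>\<^sup>+ x. ennreal (\<bar>u' n x\<bar> powr p) \<partial>lborel) = ennreal (L (\<tau> n)) \<and>
    (\<integral>\<^sup>+ z. ennreal (gagliardo_integrand s p (u' n) z) \<partial>lebesgue) = ennreal (G (\<tau> n))"
    using choice[of "\<lambda>n u'. u' \<in> borel_measurable borel \<and> (AE x in lebesgue. u (\<tau> n) x = u' x) \<and>
    (\<integral>\<^sup>+ x. ennreal (\<bar>u' x\<bar> powr p) \<partial>lborel) = ennreal (L (\<tau> n)) \<and>
    (\<integral>\<^sup>+ z. ennreal (gagliardo_integrand s p u' z) \<partial>lebesgue) = ennreal (G (\<tau> n))"] by blast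
  then have u': "\<And>n. u' n \<in> borel_measurable borel" "\<And>n. AE x in lebesgue. u (\<tau> n) x = u' n x"
    "\<And>n. (\<integral>\<^sup>+ x. ennreal (\<bar>u' n x\<bar> powr p) \<partial>lborel) = ennreal (L (\<tau> n))"
    "\<And>n. (\<integral>\<^sup>+ z. ennreal (gagliardo_integrand s p (u' n) z) \<partial>lebesgue) = ennreal (G (\<tau> n))"
    by blast+
  note [measurable] = u'(1)
  have \<Omega>_borel [measurable]: "\<Omega> \<in> sets borel" using open_\<Omega> by simp
  have \<Omega>_fin: "emeasure lborel \<Omega> < \<infinity>" using emeasure_bounded_finite[OF bounded_\<Omega>] .
  \<comment> \<open>Adding the indicator makes the weight at least 1 on \<Omega>, so convergence in
    the weighted norm also yields almost everywhere convergence there along a subsequence.\<close>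
  define v1 where "v1 x = wt x + indicator \<Omega> x" for x
  have [measurable]: "\<Omega> \<in> sets lebesgue" using \<Omega>_borel by simp
  have [measurable]: "v1 \<in> borel_measurable lebesgue"
    unfolding v1_def[abs_def] by (intro borel_measurable_add wt_measurable borel_measurable_indicator) simp
  obtain v0 where v0: "v0 \<in> borel_measurable lborel" and v0_ae: "AE x in lborel. v1 x = v0 x"
    using completion_ex_borel_measurable_real[of v1 lborel] by auto
  define v where "v x = max (v0 x) 0" for x
  have v: "v \<in> borel_measurable borel" "\<And>x. v x \<ge> 0" using v0 by (auto simp: v_def[abs_def])
  note [measurable] = v(1)
  have v_ae: "AE x in lebesgue. v x = v1 x"
    using AE_completion[OF v0_ae]
  proof eventually_elim
    case (elim x)
    have "v1 x \<ge> 0" by (simp add: v1_def)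
    with elim show ?case by (simp add: v_def)
  qed
  have \<Omega>_int: "integrable lebesgue (indicator \<Omega> :: 'a \<Rightarrow> real)"
    using \<Omega>_fin by (intro integrable_real_indicator) auto
  have v1_int: "integrable lebesgue (\<lambda>x. v1 x powr r)"
  proof (rule Bochner_Integration.integrable_bound)
    show "integrable lebesgue (\<lambda>x. 2 powr r * (wt x powr r + indicator \<Omega> x))"
      using wt_powr_integrable \<Omega>_int by auto
    show "AE x in lebesgue. norm (v1 x powr r) \<le> norm (2 powr r * (wt x powr r + indicator \<Omega> x))"
    proof (rule AE_I2)
      fix x
      have "\<bar>wt x + indicator \<Omega> x\<bar> powr r \<le> 2 powr r * (\<bar>wt x\<bar> powr r + \<bar>indicator \<Omega> x\<bar> powr r)"
        using r1 by (intro abs_add_powr_le2) simp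
      also have "\<bar>indicator \<Omega> x\<bar> powr r = (indicator \<Omega> x :: real)" using r1 by (simp add: indicator_def)
      finally show "norm (v1 x powr r) \<le> norm (2 powr r * (wt x powr r + indicator \<Omega> x))"
        by (simp add: v1_def add_nonneg_nonneg)
    qed
  qed measurable
  define \<Lambda> where "\<Lambda> = (LINT x|lebesgue. v1 x powr r) powr (1 / r)"
  have \<Lambda>: "\<Lambda> \<ge> 0" "\<Lambda> powr r = (LINT x|lebesgue. v1 x powr r)"
    using r1 by (auto simp: \<Lambda>_def powr_powr)
  have "(\<integral>\<^sup>+ x. ennreal (v x powr r) \<partial>lborel) = (\<integral>\<^sup>+ x. ennreal (v x powr r) \<partial>lebesgue)"
    by (rule nn_integral_completion[symmetric])
  also have "\<dots> = (\<integral>\<^sup>+ x. ennreal (v1 x powr r) \<partial>lebesgue)"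
    by (rule nn_integral_cong_AE) (use v_ae in \<open>eventually_elim, simp\<close>)
  also have "\<dots> = ennreal (\<Lambda> powr r)"
    unfolding \<Lambda>(2) by (rule nn_integral_eq_integral) (use v1_int in auto)
  finally have v\<Lambda>: "(\<integral>\<^sup>+ x. ennreal (v x powr r) \<partial>lborel) \<le> ennreal (\<Lambda> powr r)" by simp
  have "(\<integral>\<^sup>+ x. ennreal (v x) \<partial>lborel) = (\<integral>\<^sup>+ x. ennreal (v x) \<partial>lebesgue)"
    by (rule nn_integral_completion[symmetric])
  also have "\<dots> \<le> (\<integral>\<^sup>+ x. ennreal (indicator \<Omega> x + v1 x powr r) \<partial>lebesgue)"
  proof (rule nn_integral_mono_AE)
    show "AE x in lebesgue. ennreal (v x) \<le> ennreal (indicator \<Omega> x + v1 x powr r)"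
      using v_ae
    proof eventually_elim
      case (elim x)
      show ?case
      proof (cases "x \<in> \<Omega>")
        case True
        have "v1 x \<le> v1 x powr r"
          using r1 True powr_mono[of 1 r "v1 x"] by (simp add: v1_def)
        then show ?thesis using True elim by (intro ennreal_leI) simp
      qed (simp add: elim v1_def wt_def)
    qed
  qed
  also have "\<dots> < \<infinity>"
    using v1_int \<Omega>_int by (subst nn_integral_eq_integral) auto
  finally have v_fin: "(\<integral>\<^sup>+ x. ennreal (v x) \<partial>lborel) < \<infinity>" .
  have u'L: "(\<integral>\<^sup>+ x. ennreal (\<bar>u' n x\<bar> powr p) \<partial>lborel) \<le> ennreal B" for n
    unfolding u'(3) using GL by (intro ennreal_leI)
  have u'G: "(\<integral>\<^sup>+ z. ennreal (gagliardo_integrand s p (u' n) z) \<partial>lebesgue) \<le> ennreal (B / K)" for n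
    unfolding u'(4) using GL by (intro ennreal_leI)
  obtain \<kappa> :: "nat \<Rightarrow> nat" where \<kappa>: "strict_mono \<kappa>" "\<forall>k x. convergent (\<lambda>n. cavg k (u' (\<kappa> n)) x)"
    using cavg_convergent_subsequence[of p u' B, OF p_ge1 u'(1) u'L B0] by auto
  have BK: "B / K \<ge> 0" using B0 K by simp
  have "\<exists>l0 \<in> borel_measurable borel. (\<lambda>n. \<integral>\<^sup>+ x. ennreal (v x) * ennreal (\<bar>u' (\<kappa> n) x - l0 x\<bar> powr p) \<partial>lborel) \<longlonglongrightarrow> 0"
    by (rule weighted_cavg_limit[where u = "\<lambda>n. u' (\<kappa> n)", OF s01(1) p1 r1 r_subcritical u'(1) v(1) u'L B0 u'G BK v(2) v_fin v\<Lambda> \<Lambda>(1)])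
       (use \<kappa>(2) in simp)
  then obtain l0 where l0: "l0 \<in> borel_measurable borel"
    "(\<lambda>n. \<integral>\<^sup>+ x. ennreal (v x) * ennreal (\<bar>u' (\<kappa> n) x - l0 x\<bar> powr p) \<partial>lborel) \<longlonglongrightarrow> 0" by auto
  note [measurable] = l0(1)
  have l0': "(\<lambda>n. \<integral>\<^sup>+ x. ennreal (v x * \<bar>u' (\<kappa> n) x - l0 x\<bar> powr p) \<partial>lborel) \<longlonglongrightarrow> 0"
    using l0(2) v(2) by (simp add: ennreal_mult)
  have "\<exists>\<rho> :: nat \<Rightarrow> nat. strict_mono \<rho> \<and> (AE x in lborel. (\<lambda>n. v x * \<bar>u' (\<kappa> (\<rho> n)) x - l0 x\<bar> powr p) \<longlonglongrightarrow> 0)"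
    by (rule tendsto_zero_AE_subseq[OF _ _ l0']) (use v(2) in auto)
  then obtain \<rho> :: "nat \<Rightarrow> nat" where \<rho>: "strict_mono \<rho>" "AE x in lborel. (\<lambda>n. v x * \<bar>u' (\<kappa> (\<rho> n)) x - l0 x\<bar> powr p) \<longlonglongrightarrow> 0"
    by auto
  define k where "k n = \<tau> (\<kappa> (\<rho> n))" for n
  have k_mono: "strict_mono k"
    using \<tau>(1) \<kappa>(1) \<rho>(1) by (simp add: k_def strict_mono_def)
  \<comment> \<open>The weight vanishes almost everywhere outside \<Omega>, so \<open>l0\<close> is
    undetermined there and is cut off to satisfy the exterior condition.\<close>
  define l where "l x = indicator \<Omega> x * l0 x" for x
  have l_borel: "l \<in> borel_measurable borel" unfolding l_def[abs_def] by measurable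
  then have [measurable]: "l \<in> borel_measurable lebesgue" by (intro measurable_completion) simp
  have u'_ae: "AE x in lebesgue. \<forall>n. u (\<tau> n) x = u' n x"
    using u'(2) by (subst AE_all_countable) auto
  have u_out: "AE x in lebesgue. \<forall>n. x \<notin> \<Omega> \<longrightarrow> u n x = 0"
    using W_D(4)[OF u] by (subst AE_all_countable) auto
  have conv: "AE x in lebesgue. (\<lambda>n. u (k n) x) \<longlonglongrightarrow> l x"
    using u'_ae u_out v_ae AE_completion[OF \<rho>(2)]
  proof eventually_elim
    case (elim x)
    show ?case
    proof (cases "x \<in> \<Omega>")
      case True
      have vx: "v x > 0" using elim(3) True by (simp add: v1_def add_nonneg_pos)
      have "(\<lambda>n. inverse (v x) * (v x * \<bar>u' (\<kappa> (\<rho> n)) x - l0 x\<bar> powr p)) \<longlonglongrightarrow> inverse (v x) * 0"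
        using elim(4) by (intro tendsto_mult_left)
      then have "(\<lambda>n. \<bar>u' (\<kappa> (\<rho> n)) x - l0 x\<bar> powr p) \<longlonglongrightarrow> 0" using vx by simp
      then have "(\<lambda>n. (\<bar>u' (\<kappa> (\<rho> n)) x - l0 x\<bar> powr p) powr (1 / p)) \<longlonglongrightarrow> 0 powr (1 / p)"
        using p1 by (intro tendsto_powr'[OF _ tendsto_const]) auto
      then have "(\<lambda>n. \<bar>u' (\<kappa> (\<rho> n)) x - l0 x\<bar>) \<longlonglongrightarrow> 0" using p1 by (simp add: powr_powr)
      then have "(\<lambda>n. u' (\<kappa> (\<rho> n)) x - l0 x) \<longlonglongrightarrow> 0" by (rule tendsto_rabs_zero_cancel)
      then have "(\<lambda>n. u' (\<kappa> (\<rho> n)) x) \<longlonglongrightarrow> l0 x" using LIM_zero_iff by blast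
      then show ?thesis using True elim(1) by (simp add: k_def l_def)
    qed (use elim(2) in \<open>simp add: l_def\<close>)
  qed
  have dconv: "AE z in lebesgue. (\<lambda>n. dq (u (k n)) z) \<longlonglongrightarrow> dq l z"
    using AE_lebesgue_fst[OF conv, where 'b = 'a] AE_lebesgue_snd[OF conv, where 'a = 'a]
  proof eventually_elim
    case (elim z)
    show ?case unfolding dquot_def divide_inverse by (intro tendsto_mult_right tendsto_diff elim)
  qed
  note [measurable] = W_D(1)[OF u]
  have fatou: "(\<integral>\<^sup>+ x. ennreal (\<bar>f x\<bar> powr p) \<partial>N) \<le> ennreal m"
    if [measurable]: "\<And>n. F n \<in> borel_measurable N" "f \<in> borel_measurable N"
      and "AE x in N. (\<lambda>n. F n x) \<longlonglongrightarrow> f x" "(\<lambda>n. \<integral>\<^sup>+ x. ennreal (\<bar>F n x\<bar> powr p) \<partial>N) \<longlonglongrightarrow> ennreal m"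
    for F :: "nat \<Rightarrow> 'c \<Rightarrow> real" and f N m
  proof -
    have "(\<integral>\<^sup>+ x. ennreal (\<bar>f x\<bar> powr p) \<partial>N) = (\<integral>\<^sup>+ x. liminf (\<lambda>n. ennreal (\<bar>F n x\<bar> powr p)) \<partial>N)"
    proof (rule nn_integral_cong_AE)
      show "AE x in N. ennreal (\<bar>f x\<bar> powr p) = liminf (\<lambda>n. ennreal (\<bar>F n x\<bar> powr p))"
        using that(3)
      proof eventually_elim
        case (elim x)
        have "(\<lambda>n. ennreal (\<bar>F n x\<bar> powr p)) \<longlonglongrightarrow> ennreal (\<bar>f x\<bar> powr p)"
          using p1 by (intro tendsto_ennrealI tendsto_powr' tendsto_intros elim) auto
        then show ?case by (intro lim_imp_Liminf[symmetric]) auto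
      qed
    qed
    also have "\<dots> \<le> liminf (\<lambda>n. \<integral>\<^sup>+ x. ennreal (\<bar>F n x\<bar> powr p) \<partial>N)"
      by (rule nn_integral_liminf) measurable
    also have "\<dots> = ennreal m" by (rule lim_imp_Liminf[OF _ that(4)]) simp
    finally show ?thesis .
  qed
  have sub: "(\<lambda>n. G (k n)) \<longlonglongrightarrow> g" "(\<lambda>n. L (k n)) \<longlonglongrightarrow> b"
  proof -
    have "strict_mono (\<lambda>n. \<kappa> (\<rho> n))" using \<kappa>(1) \<rho>(1) by (simp add: strict_mono_def)
    then show "(\<lambda>n. G (k n)) \<longlonglongrightarrow> g" "(\<lambda>n. L (k n)) \<longlonglongrightarrow> b"
      using LIMSEQ_subseq_LIMSEQ[OF g] LIMSEQ_subseq_LIMSEQ[OF b] by (auto simp: k_def o_def)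
  qed
  have l_Lp: "(\<integral>\<^sup>+ x. ennreal (\<bar>l x\<bar> powr p) \<partial>lebesgue) \<le> ennreal b"
  proof (rule fatou[OF _ _ conv])
    have "(\<integral>\<^sup>+ x. ennreal (\<bar>u (k n) x\<bar> powr p) \<partial>lebesgue) = ennreal (L (k n))" for n
      unfolding L_def by (rule nn_integral_eq_integral) (use W_D(2)[OF u] in auto)
    then show "(\<lambda>n. \<integral>\<^sup>+ x. ennreal (\<bar>u (k n) x\<bar> powr p) \<partial>lebesgue) \<longlonglongrightarrow> ennreal b"
      using sub(2) by (simp add: tendsto_ennrealI)
  qed measurable
  have l_gag: "(\<integral>\<^sup>+ z. ennreal (\<bar>dq l z\<bar> powr p) \<partial>lebesgue) \<le> ennreal g"
  proof (rule fatou[OF _ _ dconv])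
    have "(\<integral>\<^sup>+ z. ennreal (\<bar>dq (u (k n)) z\<bar> powr p) \<partial>lebesgue) = ennreal (G (k n))" for n
      unfolding G_def by (rule nn_integral_eq_integral) (use W_D(3)[OF u] in auto)
    then show "(\<lambda>n. \<integral>\<^sup>+ z. ennreal (\<bar>dq (u (k n)) z\<bar> powr p) \<partial>lebesgue) \<longlonglongrightarrow> ennreal g"
      using sub(1) by (simp add: tendsto_ennrealI)
  qed measurable
  have l_int: "integrable lebesgue (\<lambda>x. \<bar>l x\<bar> powr p)" "integrable lebesgue (\<lambda>z. \<bar>dq l z\<bar> powr p)"
    using l_Lp l_gag by (auto intro!: integrableI_bounded intro: order_le_less_trans)
  have lW: "l \<in> W"
    unfolding W0_def gagliardo_integrand_eq_dquot[OF p0] using l_int by (auto simp: l_def)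
  have "(LINT x|lebesgue. \<bar>l x\<bar> powr p) \<le> b" "(LINT z|lebesgue. \<bar>dq l z\<bar> powr p) \<le> g"
    using l_Lp l_gag l_int gb0 by (auto simp: nn_integral_eq_integral ennreal_le_iff)
  then have El: "E l \<le> c"
    unfolding energy_eq[OF lW] c K_def[symmetric] using K by (intro add_mono mult_left_mono) auto
  have diffW: "(\<lambda>x. u n x - l x) \<in> W" for n using W_lin[OF u lW, of 1 n "- 1"] by simp
  have "(\<lambda>n. ennreal (wpow (\<lambda>x. u (k n) x - l x))) \<longlonglongrightarrow> 0"
  proof (rule tendsto_sandwich[OF _ _ tendsto_const])
    show "(\<lambda>n. \<integral>\<^sup>+ x. ennreal (v x * \<bar>u' (\<kappa> (\<rho> n)) x - l0 x\<bar> powr p) \<partial>lborel) \<longlonglongrightarrow> 0"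
      using LIMSEQ_subseq_LIMSEQ[OF l0' \<rho>(1)] by (simp add: o_def)
    have "ennreal (wpow (\<lambda>x. u (k n) x - l x)) \<le> (\<integral>\<^sup>+ x. ennreal (v x * \<bar>u' (\<kappa> (\<rho> n)) x - l0 x\<bar> powr p) \<partial>lborel)" for n
    proof -
      have "ennreal (wpow (\<lambda>x. u (k n) x - l x)) = (\<integral>\<^sup>+ x. ennreal (wt x * \<bar>u (k n) x - l x\<bar> powr p) \<partial>lebesgue)"
        unfolding wpow_def by (rule nn_integral_eq_integral[symmetric]) (use wpow_integrable[OF diffW] in auto)
      also have "\<dots> \<le> (\<integral>\<^sup>+ x. ennreal (v x * \<bar>u' (\<kappa> (\<rho> n)) x - l0 x\<bar> powr p) \<partial>lebesgue)"
      proof (rule nn_integral_mono_AE)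
        show "AE x in lebesgue. ennreal (wt x * \<bar>u (k n) x - l x\<bar> powr p) \<le> ennreal (v x * \<bar>u' (\<kappa> (\<rho> n)) x - l0 x\<bar> powr p)"
          using u'_ae v_ae
        proof eventually_elim
          case (elim x)
          show ?case
          proof (cases "x \<in> \<Omega>")
            case True
            then show ?thesis using elim
              by (intro ennreal_leI) (simp add: k_def l_def v1_def mult_right_mono)
          qed (simp add: wt_def)
        qed
      qed
      finally show ?thesis by (simp add: nn_integral_completion)
    qed
    then show "\<forall>\<^sub>F n in sequentially. ennreal (wpow (\<lambda>x. u (k n) x - l x)) \<le> (\<integral>\<^sup>+ x. ennreal (v x * \<bar>u' (\<kappa> (\<rho> n)) x - l0 x\<bar> powr p) \<partial>lborel)"
      by (intro always_eventually allI)
  qed simp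
  then have "(\<lambda>n. wpow (\<lambda>x. u (k n) x - l x)) \<longlonglongrightarrow> 0"
    unfolding ennreal_0[symmetric] by (subst (asm) tendsto_ennreal_iff) auto
  with k_mono lW conv El show ?thesis by (rule that)
qed

text \<open>The constraint must survive the limit. In the nearly sharp triangle inequality with
  parameter t, n tends to infinity first and removes the error term; then t tends to 0, giving wpow
  l \<ge> 1. Since E l \<le> \<lambda>1, the limit l is a minimiser.\<close>

lemma limit_first_eigenfunction:
  assumes u: "\<And>n. u n \<in> W" and u1: "\<And>n. wpow (u n) = 1" and lim: "(\<lambda>n. E (u n)) \<longlonglongrightarrow> lambda1 s p \<Omega> V"
  obtains k :: "nat \<Rightarrow> nat" and l where "strict_mono k" "AE x in lebesgue. (\<lambda>n. u (k n) x) \<longlonglongrightarrow> l x"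
    "weak_solution (lambda1 s p \<Omega> V) l" "\<not> (AE x in lebesgue. l x = 0)"
proof -
  obtain k :: "nat \<Rightarrow> nat" and l where k: "strict_mono k" "l \<in> W" "AE x in lebesgue. (\<lambda>n. u (k n) x) \<longlonglongrightarrow> l x"
    "E l \<le> lambda1 s p \<Omega> V" "(\<lambda>n. wpow (\<lambda>x. u (k n) x - l x)) \<longlonglongrightarrow> 0"
    by (rule compactness[OF u lim])
  have dW: "(\<lambda>x. u n x - l x) \<in> W" for n using W_lin[OF u k(2), of 1 n "- 1"] by simp
  have le: "1 \<le> (1 - t) powr (1 - p) * wpow l" if t: "0 < t" "t < 1" for t
  proof -
    have "1 \<le> (1 - t) powr (1 - p) * wpow l + t powr (1 - p) * wpow (\<lambda>x. u (k n) x - l x)" for n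
    proof -
      have "wpow (u (k n)) \<le> (LINT x|lebesgue. (1 - t) powr (1 - p) * (wt x * \<bar>l x\<bar> powr p) + t powr (1 - p) * (wt x * \<bar>u (k n) x - l x\<bar> powr p))"
        unfolding wpow_def
      proof (rule integral_mono)
        fix x
        have "\<bar>u (k n) x\<bar> powr p \<le> (1 - t) powr (1 - p) * \<bar>l x\<bar> powr p + t powr (1 - p) * \<bar>u (k n) x - l x\<bar> powr p"
          using abs_add_powr_le[OF p_ge1 t, of "l x" "u (k n) x - l x"] by simp
        then have "wt x * \<bar>u (k n) x\<bar> powr p \<le> wt x * ((1 - t) powr (1 - p) * \<bar>l x\<bar> powr p + t powr (1 - p) * \<bar>u (k n) x - l x\<bar> powr p)"
          by (intro mult_left_mono) auto
        then show "wt x * \<bar>u (k n) x\<bar> powr p \<le> (1 - t) powr (1 - p) * (wt x * \<bar>l x\<bar> powr p) + t powr (1 - p) * (wt x * \<bar>u (k n) x - l x\<bar> powr p)"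
          by (simp add: algebra_simps)
      qed (use wpow_integrable[OF u] wpow_integrable[OF k(2)] wpow_integrable[OF dW] in auto)
      also have "\<dots> = (1 - t) powr (1 - p) * wpow l + t powr (1 - p) * wpow (\<lambda>x. u (k n) x - l x)"
        using wpow_integrable[OF k(2)] wpow_integrable[OF dW] by (simp add: wpow_def)
      finally show ?thesis by (simp add: u1)
    qed
    moreover have "(\<lambda>n. (1 - t) powr (1 - p) * wpow l + t powr (1 - p) * wpow (\<lambda>x. u (k n) x - l x)) \<longlonglongrightarrow> (1 - t) powr (1 - p) * wpow l + t powr (1 - p) * 0"
      by (intro tendsto_intros k(5))
    ultimately show ?thesis using LIMSEQ_le_const[of _ "(1 - t) powr (1 - p) * wpow l" 1] by simp
  qed
  have "1 \<le> wpow l"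
  proof -
    \<comment> \<open>The double successor keeps t strictly below 1.\<close>
    define t where "t n = inverse (real (Suc (Suc n)))" for n
    have t: "0 < t n" "t n < 1" for n by (auto simp: t_def inverse_eq_divide divide_less_eq)
    have "t \<longlonglongrightarrow> 0" unfolding t_def[abs_def] using LIMSEQ_Suc[OF LIMSEQ_inverse_real_of_nat] by simp
    then have "(\<lambda>n. (1 - t n) powr (1 - p) * wpow l) \<longlonglongrightarrow> (1 - 0) powr (1 - p) * wpow l"
      by (intro tendsto_intros) auto
    then have "(\<lambda>n. (1 - t n) powr (1 - p) * wpow l) \<longlonglongrightarrow> wpow l" by simp
    then show ?thesis by (rule LIMSEQ_le_const) (use le t in auto)
  qed
  then have min: "E l \<le> lambda1 s p \<Omega> V * wpow l" and nz: "\<not> (AE x in lebesgue. l x = 0)"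
    using k(4) lambda1_nonneg mult_left_mono[of 1 "wpow l" "lambda1 s p \<Omega> V"] wpow_pos_nonzero[of l] by auto
  show ?thesis by (rule that[OF k(1,3) minimizer_weak_solution[OF k(2) min] nz])
qed

section \<open>Normalisation, attainment and isolation\<close>

lemma weak_solution_scale:
  assumes u: "weak_solution \<mu> u"
  shows "weak_solution \<mu> (\<lambda>x. c * u x)"
proof -
  have "dq (\<lambda>x. c * u x) z = c * dq u z" for z
    using dquot_lin[of s p c u 0 u z] by simp
  then have "bform (\<lambda>x. c * u x) v = psi p c * bform u v" "wform (\<lambda>x. c * u x) v = psi p c * wform u v" for v
    by (simp_all add: bform_def wform_def psi_mult distrib_left mult.left_commute mult.assoc)
  moreover have "(\<lambda>x. c * u x) \<in> W" using u W_scale by (simp add: weak_solution_def)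
  ultimately show ?thesis using u by (simp add: weak_solution_def)
qed

lemma normalize:
  assumes u: "u \<in> W" and pos: "wpow u > 0"
  obtains c where "c > 0" "wpow (\<lambda>x. c * u x) = 1" "E (\<lambda>x. c * u x) = E u / wpow u"
proof -
  define c where "c = wpow u powr (- (1 / p))"
  have c: "c > 0" using pos by (simp add: c_def)
  have "c powr p = wpow u powr (- (1 / p) * p)" unfolding c_def by (rule powr_powr)
  also have "- (1 / p) * p = - 1" using p1 by simp
  also have "wpow u powr (- 1) = inverse (wpow u)" using pos by (simp add: powr_minus)
  finally have "\<bar>c\<bar> powr p = inverse (wpow u)" using c by simp
  then have "wpow (\<lambda>x. c * u x) = 1" "E (\<lambda>x. c * u x) = E u / wpow u"
    using pos wpow_scale[of c u] energy_scale[OF u, of c] by (auto simp: divide_inverse)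
  with c show ?thesis by (rule that)
qed

text \<open>A normalised minimising sequence has energies tending to the infimum, so its limit is a
  first eigenfunction. Membership in the set of eigenvalues is part of
  \<open>isolated_in\<close>.\<close>

lemma lambda1_eigenvalue: "is_eigenvalue s p \<Omega> V (lambda1 s p \<Omega> V)"
proof -
  have ne: "quotients \<noteq> {}" and bdd: "bdd_below quotients"
    using ex_nonzero energy_nonneg by (auto simp: quotients_def intro!: bdd_belowI[of _ 0])
  have "\<exists>u\<in>W. wpow u = 1 \<and> E u < lambda1 s p \<Omega> V + inverse (real (Suc n))" for n
  proof -
    have "Inf quotients < lambda1 s p \<Omega> V + inverse (real (Suc n))" by (simp add: lambda1_eq)
    then obtain w where w: "w \<in> W" "wpow w > 0" "E w / wpow w < lambda1 s p \<Omega> V + inverse (real (Suc n))"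
      using cInf_less_iff[OF ne bdd] by (auto simp: quotients_def)
    obtain c where "c > 0" "wpow (\<lambda>x. c * w x) = 1" "E (\<lambda>x. c * w x) = E w / wpow w"
      by (rule normalize[OF w(1,2)])
    then show ?thesis using w W_scale[OF w(1)] by auto
  qed
  then obtain u where u: "\<And>n. u n \<in> W" "\<And>n. wpow (u n) = 1" "\<And>n. E (u n) < lambda1 s p \<Omega> V + inverse (real (Suc n))"
    by metis
  have "(\<lambda>n. E (u n)) \<longlonglongrightarrow> lambda1 s p \<Omega> V"
  proof (rule tendsto_sandwich[OF _ _ tendsto_const])
    show "\<forall>\<^sub>F n in sequentially. lambda1 s p \<Omega> V \<le> E (u n)"
      using lambda1_wpow_le[OF u(1)] by (simp add: u(2))
    show "\<forall>\<^sub>F n in sequentially. E (u n) \<le> lambda1 s p \<Omega> V + inverse (real (Suc n))"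
      using u(3) by (intro always_eventually allI less_imp_le)
    show "(\<lambda>n. lambda1 s p \<Omega> V + inverse (real (Suc n))) \<longlonglongrightarrow> lambda1 s p \<Omega> V"
      by (rule LIMSEQ_inverse_real_of_nat_add)
  qed
  from limit_first_eigenfunction[OF u(1,2) this] show ?thesis
    unfolding is_eigenvalue_iff by blast
qed

lemma lambda1_isolated: "lambda1 s p \<Omega> V isolated_in {\<mu>. is_eigenvalue s p \<Omega> V \<mu>}"
  unfolding isolated_in_islimpt_iff
proof
  show "lambda1 s p \<Omega> V \<in> {\<mu>. is_eigenvalue s p \<Omega> V \<mu>}" using lambda1_eigenvalue by simp
  show "\<not> lambda1 s p \<Omega> V islimpt {\<mu>. is_eigenvalue s p \<Omega> V \<mu>}"
  proof
    assume "lambda1 s p \<Omega> V islimpt {\<mu>. is_eigenvalue s p \<Omega> V \<mu>}"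
    then obtain \<mu> where \<mu>: "\<And>n. is_eigenvalue s p \<Omega> V (\<mu> n)" "\<And>n. \<mu> n \<noteq> lambda1 s p \<Omega> V" "\<mu> \<longlonglongrightarrow> lambda1 s p \<Omega> V"
      unfolding islimpt_sequential by auto
    have "\<exists>u. weak_solution (\<mu> n) u \<and> wpow u = 1" for n
    proof -
      obtain w where w: "weak_solution (\<mu> n) w" "\<not> (AE x in lebesgue. w x = 0)"
        using \<mu>(1) is_eigenvalue_iff by blast
      have "w \<in> W" using w(1) by (simp add: weak_solution_def)
      then obtain c where "wpow (\<lambda>x. c * w x) = 1"
        using normalize[OF _ weak_solution_pos(2)[OF w]] by metis
      then show ?thesis using weak_solution_scale[OF w(1), of c] by blast
    qed
    then obtain u where u: "\<And>n. weak_solution (\<mu> n) (u n)" "\<And>n. wpow (u n) = 1" by metis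
    have uW: "u n \<in> W" for n using u(1) by (simp add: weak_solution_def)
    have nz: "\<not> (AE x in lebesgue. u n x = 0)" for n
      using wpow_pos_nonzero[of "u n"] u(2)[of n] by simp
    have Elim: "(\<lambda>n. E (u n)) \<longlonglongrightarrow> lambda1 s p \<Omega> V"
      using \<mu>(3) weak_solution_energy[OF u(1)] u(2) by simp
    obtain k :: "nat \<Rightarrow> nat" and l where k: "strict_mono k" "AE x in lebesgue. (\<lambda>n. u (k n) x) \<longlonglongrightarrow> l x"
      "weak_solution (lambda1 s p \<Omega> V) l" "\<not> (AE x in lebesgue. l x = 0)"
      by (rule limit_first_eigenfunction[OF uW u(2) Elim])
    obtain B where B: "\<And>n. \<bar>\<mu> n\<bar> \<le> B"
      using convergent_imp_Bseq[OF convergentI[OF \<mu>(3)]] by (auto simp: Bseq_def)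
    have B': "\<mu> n \<le> B" for n using B[of n] by linarith
    from first_eigenfunction_sign[OF k(3,4)] show False
    proof
      assume "AE x in lebesgue. x \<in> \<Omega> \<longrightarrow> l x > 0"
      then show False
        by (rule no_positive_limit[OF u(1) nz \<mu>(2) B' k(2)])
    next
      \<comment> \<open>A negative limit is reduced to the positive case by changing the sign of the
        eigenfunctions, which solve the same equations.\<close>
      assume neg: "AE x in lebesgue. x \<in> \<Omega> \<longrightarrow> l x < 0"
      show False
      proof (rule no_positive_limit[of "\<lambda>n. \<mu> (k n)" "\<lambda>n x. - u (k n) x" B "\<lambda>x. - l x"])
        show "AE x in lebesgue. (\<lambda>n. - u (k n) x) \<longlonglongrightarrow> - l x"
          using k(2) by eventually_elim (rule tendsto_minus)
        show "AE x in lebesgue. x \<in> \<Omega> \<longrightarrow> - l x > 0" using neg by eventually_elim simp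
      qed (use weak_solution_uminus[OF u(1)] nz \<mu>(2) B' in auto)
    qed
  qed
qed

end

theorem proposition3p5:
  fixes \<Omega> :: "'a::euclidean_space set" and V :: "'a \<Rightarrow> real" and s p r :: real
  assumes "open \<Omega>" and "bounded \<Omega>" and "\<Omega> \<noteq> {}"
    and "0 < s" and "s < 1"
    and "1 < p" and "p < real DIM('a) / s"
    and "r > real DIM('a) / (s * p)"
    and "set_borel_measurable lebesgue \<Omega> V"
    and "set_integrable lebesgue \<Omega> (\<lambda>x. \<bar>V x\<bar> powr r)"
    and "AE x in lebesgue. x \<in> \<Omega> \<longrightarrow> V x > 0"
  shows "(\<forall>\<mu>. is_eigenvalue s p \<Omega> V \<mu> \<and> \<mu> > lambda1 s p \<Omega> V \<longrightarrow> \<mu> \<ge> lambda2 s p \<Omega> V)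
    \<and> lambda1 s p \<Omega> V isolated_in {\<mu>. is_eigenvalue s p \<Omega> V \<mu>}"
proof -
  interpret subcritical_weighted_problem \<Omega> V s p r
    by unfold_locales (use assms in auto)
  show ?thesis using lambda2_le_eigenvalue lambda1_isolated by blast
qed

end
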